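(* Let $X=\{X(t),t\ge t_0\}$, with $t_0=0$, be a diffusion process such that $X(t_0)=x_0$, and let $a$ and $b$ be two constant boundaries such that $a<x_0<b$. Let $\lambda>0$. Then the Laplace transforms $$g_a^\lambda(x_0)=\int_{t_0}^{+\infty}e^{-\lambda t}g_a(t|x_0,t_0)\,dt,\qquad g_b^\lambda(x_0)=\int_{t_0}^{+\infty}e^{-\lambda t}g_b(t|x_0,t_0)\,dt$$ admit the following three equivalent expressions. (1) $$g_a^\lambda(x_0)=\frac{f_{T_b}^\lambda(x_0)f_{T_a}^\lambda(b)-f_{T_a}^\lambda(x_0)}{f_{T_a}^\lambda(b)f_{T_b}^\lambda(a)-1},\qquad g_b^\lambda(x_0)=\frac{f_{T_a}^\lambda(x_0)f_{T_b}^\lambda(a)-f_{T_b}^\lambda(x_0)}{f_{T_a}^\lambda(b)f_{T_b}^\lambda(a)-1}.$$ (2) $$g_a^\lambda(x_0)=\frac{[1-\lambda F_X^\lambda(b|x_0)]F_X^\lambda(a|b)-[1-\lambda F_X^\lambda(b|b)]F_X^\lambda(a|x_0)}{[1-\lambda F_X^\lambda(b|a)]F_X^\lambda(a|b)-[1-\lambda F_X^\lambda(b|b)]F_X^\lambda(a|a)},$$ $$g_b^\lambda(x_0)=\frac{[1-\lambda F_X^\lambda(b|x_0)]F_X^\lambda(a|a)-[1-\lambda F_X^\lambda(b|a)]F_X^\lambda(a|x_0)}{[1-\lambda F_X^\lambda(b|b)]F_X^\lambda(a|a)-[1-\lambda F_X^\lambda(b|a)]F_X^\lambda(a|b)}.$$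 (3) For arbitrary points $x_1>b$ and $x_2<a$ of $I$, $$g_a^\lambda(x_0)=\frac{f_X^\lambda(x_1|x_0)f_X^\lambda(x_2|b)-f_X^\lambda(x_1|b)f_X^\lambda(x_2|x_0)}{f_X^\lambda(x_1|a)f_X^\lambda(x_2|b)-f_X^\lambda(x_1|b)f_X^\lambda(x_2|a)}=\frac{v_1(\lambda,x_0)v_2(\lambda,b)-v_2(\lambda,x_0)v_1(\lambda,b)}{v_1(\lambda,a)v_2(\lambda,b)-v_2(\lambda,a)v_1(\lambda,b)},$$ $$g_b^\lambda(x_0)=\frac{f_X^\lambda(x_1|a)f_X^\lambda(x_2|x_0)-f_X^\lambda(x_1|x_0)f_X^\lambda(x_2|a)}{f_X^\lambda(x_1|a)f_X^\lambda(x_2|b)-f_X^\lambda(x_1|b)f_X^\lambda(x_2|a)}=\frac{v_1(\lambda,a)v_2(\lambda,x_0)-v_2(\lambda,a)v_1(\lambda,x_0)}{v_1(\lambda,a)v_2(\lambda,b)-v_2(\lambda,a)v_1(\lambda,b)}.$$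
   Context: $X=\{X(t),t\ge t_0\}$ is a one-dimensional regular time homogeneous diffusion process on a probability space $(\Omega,\mathcal A,\mathbb P)$ with $P(X(t_0)=x_0)=1$ and diffusion interval $I$ (an interval with endpoints $r_1<r_2$, possibly infinite; unless otherwise specified $I$ is open and $r_1,r_2$ are natural boundaries), having transition distribution function $F_{X(t)}(x|y,\tau)=P(X(t)\le x|X(\tau)=y)$ and transition density $f_{X(t)}(x|y,\tau)$. The constants $a,b$ belong to $I$. The first hitting times are $T_a=\inf\{t\ge t_0:X(t)=a\}$ and $T_b=\inf\{t\ge t_0:X(t)=b\}$; $f_{T_a}(t|y,t_0)$ and $f_{T_b}(t|y,t_0)$ denote their densities when the process starts from $y$ at time $t_0$. The functions $g_a,g_b$ are the (sub-probability) densities defined by $$g_a(t|x_0,t_0)\,dt=P(T_a\in dt,\ T_a<T_b|X(t_0)=x_0),\qquad g_b(t|x_0,t_0)\,dt=P(T_b\in dt,\ T_a>T_b|X(t_0)=x_0).$$ All these densities are assumed to exist. Laplace transforms (with $t_0=0$): $$F_X^\lambda(x|y)=\int_0^{+\infty}e^{-\lambda t}F_{X(t)}(x|y,t_0)\,dt,\quad f_X^\lambda(x|y)=\int_0^{+\infty}e^{-\lambda t}f_{X(t)}(x|y,t_0)\,dt,\quad f_{T_a}^\lambda(y)=\int_0^{+\infty}e^{-\lambda t}f_{T_a}(t|y,t_0)\,dt,$$ and $f_{T_b}^\lambda(y)$ is defined like $f_{T_a}^\lambda(y)$. The functions $v_1(\lambda,x),v_2(\lambda,x)$ are fundamental (i.e.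 linearly independent) solutions, on $I$, of the Laplace transformed backward equation of the diffusion, $$\tfrac12\,\sigma(x)\,\frac{d^2v}{dx^2}+\mu(x)\,\frac{dv}{dx}-\lambda v=0,$$ where $\mu(x)$ and $\sigma(x)$ are the drift and the infinitesimal variance of $X$. *)

theory Defs
  imports "HOL-Probability.Probability"
begin

(* The process is described by its laws P y, "given X(0) = y", on one common measurable
   space \<Omega>.  Times are reals, of which only t \<ge> 0 matters (t0 = 0); random times are
   ennreal-valued, the value \<infinity> meaning "never". *)

definition natural_filtration :: "'w measure \<Rightarrow> (real \<Rightarrow> 'w \<Rightarrow> real) \<Rightarrow> ennreal \<Rightarrow> 'w measure"
  where "natural_filtration \<Omega> X t =
    sigma (space \<Omega>) {X s -` B \<inter> space \<Omega> | s B. 0 \<le> s \<and> ennreal s \<le> t \<and> B \<in> sets borel}"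

(* X(\<tau> + \<cdot>), as an element of the path space with the product sigma-algebra *)
definition shifted_path :: "(real \<Rightarrow> 'w \<Rightarrow> real) \<Rightarrow> real \<Rightarrow> 'w \<Rightarrow> real \<Rightarrow> real"
  where "shifted_path X \<tau> \<omega> = (\<lambda>s\<in>{0..}. X (\<tau> + s) \<omega>)"

definition hitting_time :: "(real \<Rightarrow> 'w \<Rightarrow> real) \<Rightarrow> real \<Rightarrow> 'w \<Rightarrow> ennreal"
  where "hitting_time X z \<omega> = Inf {ennreal t | t. 0 \<le> t \<and> X t \<omega> = z}"

definition scale_density :: "(real \<Rightarrow> real) \<Rightarrow> (real \<Rightarrow> real) \<Rightarrow> real \<Rightarrow> real \<Rightarrow> real"
  where "scale_density \<mu> \<sigma> c x = exp (- (LBINT z=c..x. 2 * \<mu> z / \<sigma> z))"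

(* \<sigma> is the infinitesimal variance itself, not its square root *)
definition speed_density :: "(real \<Rightarrow> real) \<Rightarrow> (real \<Rightarrow> real) \<Rightarrow> real \<Rightarrow> real \<Rightarrow> real"
  where "speed_density \<mu> \<sigma> c x = 1 / (\<sigma> x * scale_density \<mu> \<sigma> c x)"

(* Feller's boundary classification.  With scale measure S and speed measure M, the end
   point r is natural iff both double integrals
     \<integral> S(between r and \<xi>) dM(\<xi>)   and   \<integral> S(between \<xi> and c) dM(\<xi>)
   over \<xi> between r and an interior point c diverge: the first makes r unattainable from the
   interior, the second excludes an entrance boundary. *)
definition natural_left :: "(real \<Rightarrow> real) \<Rightarrow> (real \<Rightarrow> real) \<Rightarrow> real \<Rightarrow> ereal \<Rightarrow> bool"
  where "natural_left \<mu> \<sigma> c r \<longleftrightarrow>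
    (\<integral>\<^sup>+\<xi>\<in>einterval r c. (\<integral>\<^sup>+\<eta>\<in>einterval r \<xi>. ennreal (scale_density \<mu> \<sigma> c \<eta>) \<partial>lborel)
        * ennreal (speed_density \<mu> \<sigma> c \<xi>) \<partial>lborel) = \<infinity> \<and>
    (\<integral>\<^sup>+\<xi>\<in>einterval r c. (\<integral>\<^sup>+\<eta>\<in>einterval \<xi> c. ennreal (scale_density \<mu> \<sigma> c \<eta>) \<partial>lborel)
        * ennreal (speed_density \<mu> \<sigma> c \<xi>) \<partial>lborel) = \<infinity>"

definition natural_right :: "(real \<Rightarrow> real) \<Rightarrow> (real \<Rightarrow> real) \<Rightarrow> real \<Rightarrow> ereal \<Rightarrow> bool"
  where "natural_right \<mu> \<sigma> c r \<longleftrightarrow>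
    (\<integral>\<^sup>+\<xi>\<in>einterval c r. (\<integral>\<^sup>+\<eta>\<in>einterval \<xi> r. ennreal (scale_density \<mu> \<sigma> c \<eta>) \<partial>lborel)
        * ennreal (speed_density \<mu> \<sigma> c \<xi>) \<partial>lborel) = \<infinity> \<and>
    (\<integral>\<^sup>+\<xi>\<in>einterval c r. (\<integral>\<^sup>+\<eta>\<in>einterval c \<xi>. ennreal (scale_density \<mu> \<sigma> c \<eta>) \<partial>lborel)
        * ennreal (speed_density \<mu> \<sigma> c \<xi>) \<partial>lborel) = \<infinity>"

(* Regular time-homogeneous diffusion on I = (r1, r2), with drift \<mu> and infinitesimal variance
   \<sigma>: a strong Markov process with continuous paths in I whose truncated infinitesimal moments
   are \<mu> and \<sigma> (truncation, because X(h) need not have moments). *)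
locale regular_diffusion =
  fixes \<Omega> :: "'w measure" and P :: "real \<Rightarrow> 'w measure" and X :: "real \<Rightarrow> 'w \<Rightarrow> real"
    and r1 r2 :: ereal and \<mu> \<sigma> :: "real \<Rightarrow> real"
  assumes endpoints: "r1 < r2"
    and kernel: "P \<in> restrict_space borel (einterval r1 r2) \<rightarrow>\<^sub>M prob_algebra \<Omega>"
    and random_variable: "\<And>t. 0 \<le> t \<Longrightarrow> X t \<in> borel_measurable \<Omega>"
    and state_space: "\<And>t \<omega>. 0 \<le> t \<Longrightarrow> \<omega> \<in> space \<Omega> \<Longrightarrow> X t \<omega> \<in> einterval r1 r2"
    and continuous_paths: "\<And>\<omega>. \<omega> \<in> space \<Omega> \<Longrightarrow> continuous_on {0..} (\<lambda>t. X t \<omega>)"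
    and start: "\<And>y. y \<in> einterval r1 r2 \<Longrightarrow> measure (P y) {\<omega> \<in> space \<Omega>. X 0 \<omega> = y} = 1"
    and strong_markov:
      "\<And>T y A B. stopping_time (natural_filtration \<Omega> X) T \<Longrightarrow> y \<in> einterval r1 r2 \<Longrightarrow>
         A \<in> sets (filtration.pre_sigma (space \<Omega>) (natural_filtration \<Omega> X) T) \<Longrightarrow>
         B \<in> sets (Pi\<^sub>M {0..} (\<lambda>_. borel)) \<Longrightarrow>
         emeasure (P y) {\<omega> \<in> A. T \<omega> < \<infinity> \<and> shifted_path X (enn2real (T \<omega>)) \<omega> \<in> B} =
         (\<integral>\<^sup>+\<omega>\<in>{\<omega> \<in> A. T \<omega> < \<infinity>}.
            emeasure (P (X (enn2real (T \<omega>)) \<omega>)) {\<omega>' \<in> space \<Omega>. shifted_path X 0 \<omega>' \<in> B} \<partial>P y)"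
    and regular: "\<And>y z. y \<in> einterval r1 r2 \<Longrightarrow> z \<in> einterval r1 r2 \<Longrightarrow>
         measure (P y) {\<omega> \<in> space \<Omega>. hitting_time X z \<omega> < \<infinity>} > 0"
    and coefficients: "continuous_on (einterval r1 r2) \<mu>" "continuous_on (einterval r1 r2) \<sigma>"
      "\<And>x. x \<in> einterval r1 r2 \<Longrightarrow> \<sigma> x > 0"
    and no_jumps: "\<And>x e. x \<in> einterval r1 r2 \<Longrightarrow> e > 0 \<Longrightarrow>
         ((\<lambda>h. measure (P x) {\<omega> \<in> space \<Omega>. \<bar>X h \<omega> - x\<bar> > e} / h) \<longlongrightarrow> 0) (at_right 0)"
    and drift: "\<And>x e. x \<in> einterval r1 r2 \<Longrightarrow> e > 0 \<Longrightarrow>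
         ((\<lambda>h. (\<integral>\<omega>. (X h \<omega> - x) * indicator {-e..e} (X h \<omega> - x) \<partial>P x) / h) \<longlongrightarrow> \<mu> x)
           (at_right 0)"
    and variance: "\<And>x e. x \<in> einterval r1 r2 \<Longrightarrow> e > 0 \<Longrightarrow>
         ((\<lambda>h. (\<integral>\<omega>. (X h \<omega> - x)\<^sup>2 * indicator {-e..e} (X h \<omega> - x) \<partial>P x) / h) \<longlongrightarrow> \<sigma> x)
           (at_right 0)"
    and natural_boundaries: "\<And>c. c \<in> einterval r1 r2 \<Longrightarrow> natural_left \<mu> \<sigma> c r1"
      "\<And>c. c \<in> einterval r1 r2 \<Longrightarrow> natural_right \<mu> \<sigma> c r2"

definition transition_cdf ::
    "'w measure \<Rightarrow> (real \<Rightarrow> 'w measure) \<Rightarrow> (real \<Rightarrow> 'w \<Rightarrow> real) \<Rightarrow> real \<Rightarrow> real \<Rightarrow> real \<Rightarrow> real"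
  where "transition_cdf \<Omega> P X t x y = measure (P y) {\<omega> \<in> space \<Omega>. X t \<omega> \<le> x}"

(* f t x y = f_{X(t)}(x|y,0).  Values of a density at individual points x only make sense for a
   fixed version.  The last two clauses select the usual one: jointly continuous, with
   f t x y \<rightarrow> \<delta>(x - y) as t \<rightarrow> 0, i.e. vanishing off the diagonal, locally uniformly in x. *)
definition transition_density ::
    "(real \<Rightarrow> 'w measure) \<Rightarrow> (real \<Rightarrow> 'w \<Rightarrow> real) \<Rightarrow> real set \<Rightarrow> (real \<Rightarrow> real \<Rightarrow> real \<Rightarrow> real) \<Rightarrow> bool"
  where "transition_density P X I f \<longleftrightarrow>
    (\<forall>t>0. \<forall>x\<in>I. \<forall>y\<in>I. 0 \<le> f t x y) \<and>
    (\<forall>t>0. \<forall>y\<in>I. distributed (P y) lborel (X t) (\<lambda>x. ennreal (f t x y) * indicator I x)) \<and>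
    continuous_on ({0<..} \<times> I \<times> I) (\<lambda>(t, x, y). f t x y) \<and>
    (\<forall>x\<in>I. \<forall>y\<in>I. x \<noteq> y \<longrightarrow> ((\<lambda>(t, x'). f t x' y) \<longlongrightarrow> 0) (at_right 0 \<times>\<^sub>F nhds x))"

(* M(T \<in> dt, E) = g(t) dt on [0, \<infinity>).  M(T = \<infinity>, E) may be positive, so that g is in general
   only a sub-probability density. *)
definition time_density_on :: "'w measure \<Rightarrow> ('w \<Rightarrow> ennreal) \<Rightarrow> 'w set \<Rightarrow> (real \<Rightarrow> real) \<Rightarrow> bool"
  where "time_density_on M T E g \<longleftrightarrow>
    g \<in> borel_measurable borel \<and> (\<forall>t\<ge>0. 0 \<le> g t) \<and>
    (\<forall>B\<in>sets borel. B \<subseteq> {0..} \<longrightarrow>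
       emeasure M {\<omega> \<in> E. T \<omega> \<in> ennreal ` B} = (\<integral>\<^sup>+t\<in>B. ennreal (g t) \<partial>lborel))"

definition laplace :: "real \<Rightarrow> (real \<Rightarrow> real) \<Rightarrow> real"
  where "laplace lam g = (LBINT t:{0..}. exp (- lam * t) * g t)"

definition solves_backward ::
    "(real \<Rightarrow> real) \<Rightarrow> (real \<Rightarrow> real) \<Rightarrow> real set \<Rightarrow> real \<Rightarrow> (real \<Rightarrow> real) \<Rightarrow> bool"
  where "solves_backward \<mu> \<sigma> I lam v \<longleftrightarrow>
    (\<exists>v' v''. \<forall>x\<in>I. (v has_real_derivative v' x) (at x) \<and> (v' has_real_derivative v'' x) (at x) \<and>
       1/2 * \<sigma> x * v'' x + \<mu> x * v' x - lam * v x = 0)"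

definition fundamental_solutions ::
    "(real \<Rightarrow> real) \<Rightarrow> (real \<Rightarrow> real) \<Rightarrow> real set \<Rightarrow> real \<Rightarrow> (real \<Rightarrow> real) \<Rightarrow> (real \<Rightarrow> real) \<Rightarrow> bool"
  where "fundamental_solutions \<mu> \<sigma> I lam v1 v2 \<longleftrightarrow>
    solves_backward \<mu> \<sigma> I lam v1 \<and> solves_backward \<mu> \<sigma> I lam v2 \<and>
    (\<forall>c1 c2. (\<forall>x\<in>I. c1 * v1 x + c2 * v2 x = 0) \<longrightarrow> c1 = 0 \<and> c2 = 0)"

end

theory Submission
  imports Defs
begin

text \<open>Write \<open>U g y\<close> for the \<open>lam\<close>-resolvent, the expectation under \<open>P y\<close> of the integral of
  \<open>exp (- lam * t) * g (X t)\<close> over \<open>t \<ge> 0\<close>. If \<open>g\<close> vanishes on \<open>(a, b)\<close>, the strong Markov property at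
  the first of the two hitting times gives \<open>U g x0 = Ga * U g a + Gb * U g b\<close>, and if \<open>g\<close> lives beyond \<open>z\<close>
  as seen from \<open>y\<close> it gives \<open>U g y = \<phi> z y * U g z\<close>, where \<open>\<phi> z y\<close> is the Laplace transform of the hitting
  time. Each of the claimed expressions is Cramer's rule for such a pair of equations: with
  \<open>g\<close> the indicators of \<open>x \<le> a\<close> and \<open>x > b\<close> one obtains (2) and, dividing by \<open>U g\<close> at the barrier, (1);
  letting \<open>g\<close> shrink to a point mass at \<open>x1\<close> or \<open>x2\<close> one obtains the first form of (3).

  For the second form, a pointwise maximum principle that needs only the infinitesimal moments at the
  touching point shows that \<open>U g\<close> agrees on \<open>[a, b]\<close> with a combination of \<open>v1\<close> and \<open>v2\<close>. The same
  principle with explicit barriers yields two-sided bounds on \<open>U g\<close> for narrow tents \<open>g\<close>; these make the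
  Laplace transform of the transition density finite and nonzero off the diagonal.\<close>

section \<open>The backward equation\<close>

text \<open>The infinitesimal moments are given only pointwise, with no uniformity in the starting
  point, and no generator domain is available for Dynkin's formula. So \<open>U g\<close> is never
  shown to be differentiable: it is only compared with smooth functions, at points where the
  difference has a local maximum. Such points exist only if \<open>U g\<close> is continuous, and
  this comes from the joint continuity of the transition density: Fatou's lemma gives lower
  semicontinuity, and as \<open>U g + U (1 - g)\<close> is the constant \<open>1 / lam\<close>, the
  same for \<open>1 - g\<close> gives the rest. Comparison at a point also needs \<open>g\<close>
  continuous there, which is why point masses are approached by tents and not by indicators of short
  intervals.

  In (1), (2) and the first form of (3) the denominator is nonzero for one reason: paths are
  continuous, so another point is not reached instantly, its transform \<open>\<phi>\<close> is
  below 1, and the determinant is a nonzero multiple of \<open>\<phi> b a * \<phi> a b - 1\<close>.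
  The coefficients built from \<open>v1\<close> and \<open>v2\<close> are identified with
  \<open>Ga\<close> and \<open>Gb\<close> because both pairs solve the same nonsingular 2x2
  system.\<close>

lemma taylor_second_order:
  fixes w w' :: "real \<Rightarrow> real"
  assumes w: "\<forall>\<^sub>F x in nhds y. (w has_real_derivative w' x) (at x)"
    and w': "(w' has_real_derivative c) (at y)" and "\<eta> > 0"
  shows "\<forall>\<^sub>F x in nhds y. \<bar>w x - w y - w' y * (x - y) - c / 2 * (x - y)\<^sup>2\<bar> \<le> \<eta> * (x - y)\<^sup>2"
proof -
  from w obtain d1 where d1: "d1 > 0" "\<And>x. dist x y < d1 \<Longrightarrow> (w has_real_derivative w' x) (at x)"
    unfolding eventually_nhds_metric by auto
  from w' have "(w' has_derivative (\<lambda>h. h * c)) (at y)"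
    by (simp add: has_field_derivative_def mult_commute_abs)
  then obtain d2 where d2: "d2 > 0"
    "\<And>x. norm (x - y) < d2 \<Longrightarrow> norm (w' x - w' y - (x - y) * c) \<le> \<eta> * norm (x - y)"
    using \<open>\<eta> > 0\<close> unfolding has_derivative_at_alt by blast
  have "\<bar>w x - w y - w' y * (x - y) - c / 2 * (x - y)\<^sup>2\<bar> \<le> \<eta> * (x - y)\<^sup>2"
    if x: "dist x y < min d1 d2" for x
  proof -
    define S where "S = cball y \<bar>x - y\<bar>"
    \<comment> \<open>\<open>r\<close> is the second-order Taylor remainder up to an additive
      constant. Its derivative is the linearisation error of \<open>w'\<close> at \<open>y\<close>,
      so differentiability of \<open>w'\<close> at the single point \<open>y\<close> bounds it on
      \<open>S\<close> by a multiple of \<open>\<bar>x - y\<bar>\<close>; the mean value inequality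
      supplies the second such factor.\<close>
    define r where "r = (\<lambda>z. w z - w' y * (z - y) - c / 2 * (z - y)\<^sup>2)"
    have r: "(r has_real_derivative (w' z - w' y - (z - y) * c)) (at z within S)" if "z \<in> S" for z
    proof -
      have "dist z y < d1" using that x by (auto simp: S_def dist_real_def)
      note wz = d1(2)[OF this]
      have "(r has_real_derivative (w' z - w' y - (z - y) * c)) (at z)"
        unfolding r_def by (rule derivative_eq_intros wz refl)+ (simp add: algebra_simps)
      then show ?thesis by (rule has_field_derivative_at_within)
    qed
    have "norm (r x - r y) \<le> (\<eta> * \<bar>x - y\<bar>) * norm (x - y)"
    proof (rule field_differentiable_bound[where S=S, OF _ r])
      show "norm (w' z - w' y - (z - y) * c) \<le> \<eta> * \<bar>x - y\<bar>" if "z \<in> S" for z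
      proof -
        have "norm (z - y) < d2" "norm (z - y) \<le> \<bar>x - y\<bar>"
          using that x by (auto simp: S_def dist_real_def)
        with d2(2)[of z] \<open>\<eta> > 0\<close> show ?thesis
          by (meson mult_left_mono order_trans less_imp_le)
      qed
    qed (auto simp: S_def dist_real_def)
    then show ?thesis by (simp add: r_def power2_eq_square mult.assoc)
  qed
  then show ?thesis
    unfolding eventually_nhds_metric using d1(1) d2(1) by (intro exI[of _ "min d1 d2"]) auto
qed

lemma compact_bounds:
  fixes \<mu> \<sigma> :: "real \<Rightarrow> real"
  assumes "continuous_on {a..b} \<mu>" "continuous_on {a..b} \<sigma>" "\<And>x. x \<in> {a..b} \<Longrightarrow> \<sigma> x > 0"
  obtains s0 s1 m where "s0 > 0" "s1 > 0" "m \<ge> 0"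
    "\<And>x. x \<in> {a..b} \<Longrightarrow> s0 \<le> \<sigma> x \<and> \<sigma> x \<le> s1 \<and> \<bar>\<mu> x\<bar> \<le> m"
proof (cases "a \<le> b")
  case True
  then have ne: "{a..b} \<noteq> {}" by auto
  from continuous_attains_inf[OF compact_Icc ne assms(2)]
  obtain p where p: "p \<in> {a..b}" "\<And>x. x \<in> {a..b} \<Longrightarrow> \<sigma> p \<le> \<sigma> x" by blast
  from continuous_attains_sup[OF compact_Icc ne assms(2)]
  obtain q where q: "q \<in> {a..b}" "\<And>x. x \<in> {a..b} \<Longrightarrow> \<sigma> x \<le> \<sigma> q" by blast
  have "continuous_on {a..b} (\<lambda>x. \<bar>\<mu> x\<bar>)" using assms(1) by (intro continuous_intros)
  from continuous_attains_sup[OF compact_Icc ne this]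
  obtain r where r: "\<And>x. x \<in> {a..b} \<Longrightarrow> \<bar>\<mu> x\<bar> \<le> \<bar>\<mu> r\<bar>" by blast
  show ?thesis
    by (rule that[of "\<sigma> p" "\<sigma> q" "\<bar>\<mu> r\<bar>"]) (use p q r assms(3) in auto)
qed (auto intro: that[of 1 1 0])

text \<open>Gronwall's argument for the energy \<open>(v t)\<^sup>2 + (v' t)\<^sup>2\<close>: on the
  compact segment between \<open>c\<close> and \<open>x\<close>, \<open>\<sigma>\<close> is bounded
  below, so the equation can be solved for \<open>v''\<close> with bounded coefficients. It serves
  to spread the vanishing of a solution from a subinterval to all of \<open>I\<close>.\<close>

lemma backward_zero_initial_data:
  fixes v v' v'' \<mu> \<sigma> :: "real \<Rightarrow> real"
  assumes I: "is_interval I" and \<mu>: "continuous_on I \<mu>" and \<sigma>: "continuous_on I \<sigma>" "\<And>x. x \<in> I \<Longrightarrow> \<sigma> x > 0"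
    and v: "\<And>x. x \<in> I \<Longrightarrow> (v has_real_derivative v' x) (at x)"
    and v': "\<And>x. x \<in> I \<Longrightarrow> (v' has_real_derivative v'' x) (at x)"
    and ode: "\<And>x. x \<in> I \<Longrightarrow> 1/2 * \<sigma> x * v'' x + \<mu> x * v' x - lam * v x = 0"
    and c: "c \<in> I" "v c = 0" "v' c = 0" and x: "x \<in> I"
  shows "v x = 0"
proof -
  define l u where "l = min c x" and "u = max c x"
  have sub: "{l..u} \<subseteq> I"
  proof
    fix z assume "z \<in> {l..u}"
    moreover have "l \<in> I" "u \<in> I" using c(1) x by (auto simp: l_def u_def min_def max_def)
    ultimately show "z \<in> I" using I unfolding is_interval_1 by fastforce
  qed
  obtain s0 s1 m where b: "s0 > 0" "s1 > 0" "m \<ge> 0"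
    "\<And>x. x \<in> {l..u} \<Longrightarrow> s0 \<le> \<sigma> x \<and> \<sigma> x \<le> s1 \<and> \<bar>\<mu> x\<bar> \<le> m"
  proof (rule compact_bounds[of l u \<mu> \<sigma>])
    show "continuous_on {l..u} \<mu>" "continuous_on {l..u} \<sigma>" using \<mu> \<sigma>(1) sub by (auto intro: continuous_on_subset)
    show "\<sigma> x > 0" if "x \<in> {l..u}" for x using that sub \<sigma>(2) by blast
  qed (rule that)
  \<comment> \<open>Eliminating \<open>v''\<close> leaves \<open>(1 + 2 * lam / \<sigma>) * (2 * v *
    v') - 4 * \<mu> / \<sigma> * v'\<^sup>2\<close> as the derivative of the energy. Both
    \<open>\<bar>2 * v * v'\<bar>\<close> and \<open>v'\<^sup>2\<close> are at most
    \<open>E\<close>, and \<open>\<sigma>\<close> is at least \<open>s0\<close>.\<close>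
  define K where "K = 1 + 2 * \<bar>lam\<bar> / s0 + 4 * m / s0"
  define E where "E = (\<lambda>t. (v t)\<^sup>2 + (v' t)\<^sup>2)"
  define E' where "E' = (\<lambda>t. 2 * v t * v' t + 2 * v' t * v'' t)"
  have dE: "(E has_real_derivative E' t) (at t)" if "t \<in> {l..u}" for t
  proof -
    from that sub have "t \<in> I" by auto
    note d = v[OF this] v'[OF this]
    show ?thesis unfolding E_def E'_def
      by (rule derivative_eq_intros d refl)+ (simp add: algebra_simps)
  qed
  have bE: "\<bar>E' t\<bar> \<le> K * E t" if t: "t \<in> {l..u}" for t
  proof -
    from t sub have tI: "t \<in> I" by auto
    have s: "s0 \<le> \<sigma> t" "\<bar>\<mu> t\<bar> \<le> m" using b(4)[OF t] by auto
    have sp: "\<sigma> t > 0" using s b(1) by simp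
    have v'': "v'' t = 2 * lam / \<sigma> t * v t - 2 * \<mu> t / \<sigma> t * v' t"
      using ode[OF tI] sp by (simp add: field_simps)
    have "E' t = (1 + 2 * lam / \<sigma> t) * (2 * v t * v' t) - 4 * \<mu> t / \<sigma> t * (v' t)\<^sup>2"
      unfolding E'_def v'' by (simp add: algebra_simps power2_eq_square)
    also have "\<bar>\<dots>\<bar> \<le> \<bar>1 + 2 * lam / \<sigma> t\<bar> * \<bar>2 * v t * v' t\<bar> + \<bar>4 * \<mu> t / \<sigma> t\<bar> * (v' t)\<^sup>2"
      by (rule order_trans[OF abs_triangle_ineq4]) (simp add: abs_mult)
    also have "\<dots> \<le> (1 + 2 * \<bar>lam\<bar> / s0) * E t + (4 * m / s0) * E t"
    proof (intro add_mono mult_mono)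
      have "\<bar>1 + 2 * lam / \<sigma> t\<bar> \<le> 1 + 2 * \<bar>lam\<bar> / \<sigma> t"
        using sp by (intro order_trans[OF abs_triangle_ineq]) (simp add: abs_mult)
      also have "\<dots> \<le> 1 + 2 * \<bar>lam\<bar> / s0"
        using s b(1) by (intro add_left_mono divide_left_mono) (auto intro: mult_pos_pos)
      finally show "\<bar>1 + 2 * lam / \<sigma> t\<bar> \<le> 1 + 2 * \<bar>lam\<bar> / s0" .
      show "\<bar>2 * v t * v' t\<bar> \<le> E t"
        unfolding E_def using sum_squares_bound[of "\<bar>v t\<bar>" "\<bar>v' t\<bar>"] by (simp add: abs_mult)
      show "\<bar>4 * \<mu> t / \<sigma> t\<bar> \<le> 4 * m / s0"
        using s b(1,3) sp by (auto simp: abs_mult intro!: frac_le)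
    qed (use b in \<open>auto simp: E_def\<close>)
    also have "\<dots> = K * E t" by (simp add: K_def algebra_simps)
    finally show ?thesis .
  qed
  have Ec: "E c = 0" by (simp add: E_def c)
  have "E x \<le> 0"
  proof (cases "c \<le> x")
    case True
    have "E x * exp (- K * x) \<le> E c * exp (- K * c)"
    proof (rule DERIV_nonpos_imp_nonincreasing[OF True])
      fix t assume "c \<le> t" "t \<le> x"
      then have t: "t \<in> {l..u}" by (auto simp: l_def u_def)
      have "((\<lambda>t. E t * exp (- K * t)) has_real_derivative (E' t - K * E t) * exp (- K * t)) (at t)"
        by (rule derivative_eq_intros dE[OF t] refl)+ (simp add: algebra_simps)
      moreover have "(E' t - K * E t) * exp (- K * t) \<le> 0"
        using bE[OF t] by (intro mult_nonpos_nonneg) auto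
      ultimately show "\<exists>y. ((\<lambda>t. E t * exp (- K * t)) has_real_derivative y) (at t) \<and> y \<le> 0" by blast
    qed
    then have "E x * exp (- K * x) \<le> 0" using Ec by simp
    then show ?thesis by (simp add: mult_le_0_iff)
  next
    case False
    then have xc: "x \<le> c" by simp
    have "E x * exp (K * x) \<le> E c * exp (K * c)"
    proof (rule DERIV_nonneg_imp_nondecreasing[OF xc])
      fix t assume "x \<le> t" "t \<le> c"
      then have t: "t \<in> {l..u}" by (auto simp: l_def u_def)
      have "((\<lambda>t. E t * exp (K * t)) has_real_derivative (E' t + K * E t) * exp (K * t)) (at t)"
        by (rule derivative_eq_intros dE[OF t] refl)+ (simp add: algebra_simps)
      moreover have "(E' t + K * E t) * exp (K * t) \<ge> 0"
        using bE[OF t] by (intro mult_nonneg_nonneg) auto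
      ultimately show "\<exists>y. ((\<lambda>t. E t * exp (K * t)) has_real_derivative y) (at t) \<and> 0 \<le> y" by blast
    qed
    then have "E x * exp (K * x) \<le> 0" using Ec by simp
    then show ?thesis by (simp add: mult_le_0_iff)
  qed
  then have "(v x)\<^sup>2 \<le> 0" unfolding E_def using zero_le_power2[of "v' x"] by linarith
  then show ?thesis by simp
qed

lemma solves_backward_combination:
  assumes "solves_backward \<mu> \<sigma> I lam v1" "solves_backward \<mu> \<sigma> I lam v2"
  shows "solves_backward \<mu> \<sigma> I lam (\<lambda>x. c1 * v1 x + c2 * v2 x)"
proof -
  from assms obtain d1 e1 d2 e2 where
    1: "\<And>x. x \<in> I \<Longrightarrow> (v1 has_real_derivative d1 x) (at x) \<and> (d1 has_real_derivative e1 x) (at x) \<and>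
       1/2 * \<sigma> x * e1 x + \<mu> x * d1 x - lam * v1 x = 0" and
    2: "\<And>x. x \<in> I \<Longrightarrow> (v2 has_real_derivative d2 x) (at x) \<and> (d2 has_real_derivative e2 x) (at x) \<and>
       1/2 * \<sigma> x * e2 x + \<mu> x * d2 x - lam * v2 x = 0"
    unfolding solves_backward_def by metis
  have "((\<lambda>x. c1 * v1 x + c2 * v2 x) has_real_derivative c1 * d1 x + c2 * d2 x) (at x) \<and>
      ((\<lambda>x. c1 * d1 x + c2 * d2 x) has_real_derivative c1 * e1 x + c2 * e2 x) (at x) \<and>
      1/2 * \<sigma> x * (c1 * e1 x + c2 * e2 x) + \<mu> x * (c1 * d1 x + c2 * d2 x)
        - lam * (c1 * v1 x + c2 * v2 x) = 0" if x: "x \<in> I" for x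
  proof (intro conjI)
    have "1/2 * \<sigma> x * (c1 * e1 x + c2 * e2 x) + \<mu> x * (c1 * d1 x + c2 * d2 x)
        - lam * (c1 * v1 x + c2 * v2 x) =
       c1 * (1/2 * \<sigma> x * e1 x + \<mu> x * d1 x - lam * v1 x) + c2 * (1/2 * \<sigma> x * e2 x + \<mu> x * d2 x - lam * v2 x)"
      by (simp add: algebra_simps add_divide_distrib)
    then show "1/2 * \<sigma> x * (c1 * e1 x + c2 * e2 x) + \<mu> x * (c1 * d1 x + c2 * d2 x)
        - lam * (c1 * v1 x + c2 * v2 x) = 0" using 1[OF x] 2[OF x] by simp
  qed (use 1[OF x] 2[OF x] in \<open>auto intro!: derivative_eq_intros\<close>)
  then show ?thesis unfolding solves_backward_def
    by (intro exI[of _ "\<lambda>x. c1 * d1 x + c2 * d2 x"] exI[of _ "\<lambda>x. c1 * e1 x + c2 * e2 x"]) simp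
qed

text \<open>Weak maximum principle. At a positive interior maximum \<open>v'\<close> vanishes, so
  the equation forces \<open>v'' > 0\<close> there, and the Taylor expansion produces a larger value
  nearby.\<close>

lemma solves_backward_nonpos:
  assumes v: "solves_backward \<mu> \<sigma> I lam v" and lam: "lam > 0" and \<sigma>: "\<And>x. x \<in> I \<Longrightarrow> \<sigma> x > 0"
    and sub: "{a..b} \<subseteq> I" and "v a \<le> 0" "v b \<le> 0" and x: "x \<in> {a..b}"
  shows "v x \<le> 0"
proof (rule ccontr)
  assume "\<not> v x \<le> 0"
  from v obtain v' v'' where
    1: "\<And>x. x \<in> I \<Longrightarrow> (v has_real_derivative v' x) (at x) \<and> (v' has_real_derivative v'' x) (at x) \<and>
       1/2 * \<sigma> x * v'' x + \<mu> x * v' x - lam * v x = 0"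
    unfolding solves_backward_def by metis
  have "continuous_on {a..b} v"
    using 1 sub by (meson DERIV_atLeastAtMost_imp_continuous_on atLeastAtMost_iff subsetD)
  with x obtain p where p: "p \<in> {a..b}" "\<And>z. z \<in> {a..b} \<Longrightarrow> v z \<le> v p"
    using continuous_attains_sup[OF compact_Icc, of a b v] by force
  have vp: "v p > 0" using p(2)[OF x] \<open>\<not> v x \<le> 0\<close> by simp
  then have ab: "a < p" "p < b" using p(1) assms(5,6) by (auto simp: less_le)
  then have ev: "\<forall>\<^sub>F z in nhds p. z \<in> {a<..<b}" by (intro eventually_nhds_in_open) auto
  have pI: "p \<in> I" using p sub by auto
  have "v' p = 0"
  proof (rule DERIV_local_max)
    show "(v has_real_derivative v' p) (at p)" using 1[OF pI] by simp
    show "0 < min (p - a) (b - p)" using ab by simp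
    show "\<forall>y. \<bar>p - y\<bar> < min (p - a) (b - p) \<longrightarrow> v y \<le> v p" using p(2) by (auto simp: abs_if split: if_splits)
  qed
  then have v'': "v'' p = 2 * lam * v p / \<sigma> p"
    using 1[OF pI] \<sigma>[OF pI] by (simp add: field_simps)
  then have pos: "v'' p > 0" using vp lam \<sigma>[OF pI] by simp
  \<comment> \<open>An error of a quarter of \<open>v'' p\<close> still leaves half of the quadratic
    term, so \<open>v z\<close> exceeds \<open>v p\<close> for every nearby \<open>z\<close> other
    than \<open>p\<close>.\<close>
  have "\<forall>\<^sub>F z in nhds p. \<bar>v z - v p - v' p * (z - p) - v'' p / 2 * (z - p)\<^sup>2\<bar> \<le> (v'' p / 4) * (z - p)\<^sup>2"
  proof (rule taylor_second_order)
    show "\<forall>\<^sub>F z in nhds p. (v has_real_derivative v' z) (at z)"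
      using ev by eventually_elim (use 1 sub in \<open>meson atLeastAtMost_iff greaterThanLessThan_iff less_imp_le subsetD\<close>)
  qed (use 1[OF pI] pos in auto)
  with ev have "\<forall>\<^sub>F z in nhds p. z \<in> {a<..<b} \<and> \<bar>v z - v p - v'' p / 2 * (z - p)\<^sup>2\<bar> \<le> (v'' p / 4) * (z - p)\<^sup>2"
    by eventually_elim (simp add: \<open>v' p = 0\<close>)
  then obtain d where d: "d > 0" "\<And>z. dist z p < d \<Longrightarrow> z \<in> {a<..<b} \<and> \<bar>v z - v p - v'' p / 2 * (z - p)\<^sup>2\<bar> \<le> (v'' p / 4) * (z - p)\<^sup>2"
    unfolding eventually_nhds_metric by auto
  define z where "z = p + d / 2"
  have "z \<in> {a<..<b} \<and> \<bar>v z - v p - v'' p / 2 * (z - p)\<^sup>2\<bar> \<le> (v'' p / 4) * (z - p)\<^sup>2"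
    using d by (intro d(2)) (auto simp: z_def dist_real_def)
  moreover have "v'' p * (z - p)\<^sup>2 > 0" using pos d(1) by (simp add: z_def)
  ultimately have "v z > v p" "z \<in> {a..b}" by (auto simp: abs_if split: if_splits)
  with p(2) show False by force
qed

text \<open>If the determinant vanished, some nontrivial combination would be zero at both
  \<open>a\<close> and \<open>b\<close>. The maximum principle for it and for its negative makes it
  zero on \<open>{a..b}\<close>; its Cauchy data at the midpoint are then zero, so it vanishes on
  \<open>I\<close>, against linear independence.\<close>

lemma fundamental_solutions_det_nonzero:
  assumes f: "fundamental_solutions \<mu> \<sigma> I lam v1 v2" and lam: "lam > 0"
    and I: "is_interval I" and \<mu>: "continuous_on I \<mu>" and \<sigma>: "continuous_on I \<sigma>" "\<And>x. x \<in> I \<Longrightarrow> \<sigma> x > 0"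
    and ab: "a \<in> I" "b \<in> I" "a < b"
  shows "v1 a * v2 b - v2 a * v1 b \<noteq> 0"
proof
  assume D: "v1 a * v2 b - v2 a * v1 b = 0"
  \<comment> \<open>A kernel vector of the singular matrix, taken orthogonal to a nonzero row; if
    both rows are zero, any vector serves.\<close>
  obtain c1 c2 where c: "c1 \<noteq> 0 \<or> c2 \<noteq> 0" "c1 * v1 a + c2 * v2 a = 0" "c1 * v1 b + c2 * v2 b = 0"
  proof (cases "v1 b \<noteq> 0 \<or> v2 b \<noteq> 0")
    case True
    then show ?thesis using D by (intro that[of "v2 b" "- v1 b"]) (auto simp: algebra_simps)
  next
    case False
    show ?thesis
    proof (cases "v1 a \<noteq> 0 \<or> v2 a \<noteq> 0")
      case True
      then show ?thesis using False by (intro that[of "v2 a" "- v1 a"]) auto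
    next
      case F: False
      then show ?thesis using False by (intro that[of 1 0]) auto
    qed
  qed
  define v where "v = (\<lambda>x. c1 * v1 x + c2 * v2 x)"
  have s: "solves_backward \<mu> \<sigma> I lam v" "solves_backward \<mu> \<sigma> I lam (\<lambda>x. (- c1) * v1 x + (- c2) * v2 x)"
    using f unfolding v_def fundamental_solutions_def by (blast intro: solves_backward_combination)+
  have sub: "{a..b} \<subseteq> I" using ab I unfolding is_interval_1 by fastforce
  have zero: "v x = 0" if "x \<in> {a..b}" for x
  proof -
    have "v x \<le> 0"
      by (rule solves_backward_nonpos[OF s(1) lam \<sigma>(2) sub _ _ that]) (simp_all add: v_def c)
    moreover have "- c1 * v1 x + - c2 * v2 x \<le> 0"
      by (rule solves_backward_nonpos[OF s(2) lam \<sigma>(2) sub _ _ that]) (use c in simp_all)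
    ultimately show ?thesis by (simp add: v_def)
  qed
  from s(1) obtain v' v'' where
    1: "\<And>x. x \<in> I \<Longrightarrow> (v has_real_derivative v' x) (at x) \<and> (v' has_real_derivative v'' x) (at x) \<and>
       1/2 * \<sigma> x * v'' x + \<mu> x * v' x - lam * v x = 0"
    unfolding solves_backward_def by metis
  define m where "m = (a + b) / 2"
  have m: "m \<in> {a<..<b}" "m \<in> I" using ab sub by (auto simp: m_def)
  have "((\<lambda>_. 0) has_real_derivative v' m) (at m)"
  proof (rule has_field_derivative_transform_within_open)
    show "(v has_real_derivative v' m) (at m)" using 1 m by auto
    show "open {a<..<b}" "m \<in> {a<..<b}" using m by auto
  qed (use zero in auto)
  then have "v' m = 0" by (rule DERIV_unique) simp
  have "v x = 0" if "x \<in> I" for x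
  proof (rule backward_zero_initial_data[OF I \<mu> \<sigma>, where v=v and v'=v' and v''=v'' and c=m and lam=lam])
    show "v m = 0" using zero m by auto
    show "m \<in> I" "v' m = 0" "x \<in> I" by fact+
  qed (use 1 in blast)+
  then show False using f c(1) unfolding fundamental_solutions_def v_def by blast
qed

section \<open>Barriers for narrow tents\<close>

definition hat :: "real \<Rightarrow> real"
  where "hat r = max 0 (1 - \<bar>r\<bar>)"

text \<open>Up to the factor 2, \<open>hat\<close> is the second derivative of the following function, which equals
  \<open>\<bar>r\<bar>\<close> for \<open>\<bar>r\<bar> \<ge> 1\<close>.\<close>

definition smooth_abs :: "real \<Rightarrow> real"
  where "smooth_abs r = (\<bar>r + 1\<bar> ^ 3 - 2 * \<bar>r\<bar> ^ 3 + \<bar>r - 1\<bar> ^ 3) / 6"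

text \<open>The tent is half the second difference (with step 1) of \<open>\<bar>r\<bar>\<close>.
  The successive antiderivatives of \<open>\<bar>r\<bar>\<close> are
  \<open>\<bar>r\<bar> * r / 2\<close> and \<open>\<bar>r\<bar> ^ 3 / 6\<close>; the same second
  difference applied to them gives this function and \<open>smooth_abs\<close>.\<close>

definition smooth_sgn :: "real \<Rightarrow> real"
  where "smooth_sgn r = (\<bar>r + 1\<bar> * (r + 1) - 2 * (\<bar>r\<bar> * r) + \<bar>r - 1\<bar> * (r - 1)) / 2"

lemma has_real_derivative_abs: "r \<noteq> 0 \<Longrightarrow> (abs has_real_derivative sgn r) (at (r::real))"
proof (cases "r > 0")
  case True
  show ?thesis
    by (rule has_field_derivative_transform_within_open[where f="\<lambda>x. x" and S="{0<..}"])
       (use True in \<open>auto intro!: derivative_eq_intros\<close>)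
next
  case False
  assume "r \<noteq> 0"
  show ?thesis
    by (rule has_field_derivative_transform_within_open[where f="\<lambda>x. - x" and S="{..<0}"])
       (use False \<open>r \<noteq> 0\<close> in \<open>auto intro!: derivative_eq_intros\<close>)
qed

lemma has_real_derivative_abs_times: "((\<lambda>r::real. \<bar>r\<bar> * r) has_real_derivative 2 * \<bar>r\<bar>) (at r)"
proof (cases "r = 0")
  case True
  have "((\<lambda>h::real. \<bar>h\<bar>) \<longlongrightarrow> \<bar>0\<bar>) (at 0)" by (intro tendsto_intros)
  then have "((\<lambda>h::real. (\<bar>0 + h\<bar> * (0 + h) - \<bar>0\<bar> * 0) / h) \<longlongrightarrow> 0) (at 0)"
    by (subst LIM_equal[where g=abs]) auto
  then show ?thesis using True by (simp add: DERIV_def)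
next
  case False
  note d = DERIV_mult[OF has_real_derivative_abs[OF False] DERIV_ident]
  show ?thesis
    by (rule DERIV_cong[OF d]) (use False in \<open>simp add: sgn_if\<close>)
qed

lemma has_real_derivative_abs_cube: "((\<lambda>r::real. \<bar>r\<bar> ^ 3) has_real_derivative 3 * (\<bar>r\<bar> * r)) (at r)"
proof (cases "r = 0")
  case True
  have "((\<lambda>h::real. \<bar>h\<bar> * h) \<longlongrightarrow> 0) (at 0)" by (auto intro!: tendsto_eq_intros)
  then have "((\<lambda>h::real. (\<bar>0 + h\<bar> ^ 3 - \<bar>0\<bar> ^ 3) / h) \<longlongrightarrow> 0) (at 0)"
    by (subst LIM_equal[where g="\<lambda>h. \<bar>h\<bar> * h"]) (auto simp: power3_eq_cube abs_if)
  then show ?thesis using True by (simp add: DERIV_def)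
next
  case False
  note d = DERIV_power[OF has_real_derivative_abs[OF False], of 3]
  show ?thesis
    by (rule DERIV_cong[OF d]) (use False in \<open>simp add: sgn_if power2_eq_square\<close>)
qed

lemma DERIV_smooth_abs: "(smooth_abs has_real_derivative smooth_sgn r) (at r)"
proof -
  have 1: "((\<lambda>r. \<bar>r + c\<bar> ^ 3) has_real_derivative 3 * (\<bar>r + c\<bar> * (r + c)) * 1) (at r)" for c
    by (rule DERIV_chain2[OF has_real_derivative_abs_cube]) (auto intro!: derivative_eq_intros)
  show ?thesis
    unfolding smooth_abs_def smooth_sgn_def
    by (rule DERIV_cong[OF DERIV_cdivide[OF DERIV_add[OF DERIV_diff[OF 1[of 1]
         DERIV_cmult[OF has_real_derivative_abs_cube]] 1[of "-1", simplified]]]])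
       (simp add: field_simps)
qed

lemma hat_eq: "hat r = (\<bar>r + 1\<bar> - 2 * \<bar>r\<bar> + \<bar>r - 1\<bar>) / 2"
  unfolding hat_def by (auto simp: max_def abs_if)

lemma DERIV_smooth_sgn: "(smooth_sgn has_real_derivative 2 * hat r) (at r)"
proof -
  have 1: "((\<lambda>r. \<bar>r + c\<bar> * (r + c)) has_real_derivative 2 * \<bar>r + c\<bar> * 1) (at r)" for c
    by (rule DERIV_chain2[OF has_real_derivative_abs_times]) (auto intro!: derivative_eq_intros)
  show ?thesis
    unfolding hat_eq smooth_sgn_def
    by (rule DERIV_cong[OF DERIV_cdivide[OF DERIV_add[OF DERIV_diff[OF 1[of 1]
         DERIV_cmult[OF has_real_derivative_abs_times]] 1[of "-1", simplified]]]])
       (simp add: field_simps)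
qed

lemma hat_range: "0 \<le> hat r" "hat r \<le> 1"
  by (auto simp: hat_def)

lemma smooth_abs_outside: "\<bar>r\<bar> \<ge> 1 \<Longrightarrow> smooth_abs r = \<bar>r\<bar>"
  unfolding smooth_abs_def power3_eq_cube
  by (cases "r \<ge> 1") (auto simp: abs_of_nonneg abs_of_nonpos algebra_simps)

lemma smooth_sgn_outside: "\<bar>r\<bar> \<ge> 1 \<Longrightarrow> (smooth_sgn r)\<^sup>2 = 1"
  unfolding smooth_sgn_def power2_eq_square
  by (cases "r \<ge> 1") (auto simp: abs_of_nonneg abs_of_nonpos algebra_simps)

lemma smooth_sgn_bound: "\<bar>smooth_sgn r\<bar> \<le> 1"
proof -
  consider "r \<ge> 1" | "0 \<le> r" "r \<le> 1" | "-1 \<le> r" "r \<le> 0" | "r \<le> -1" by linarith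
  then show ?thesis
  proof cases
    case 2
    have "smooth_sgn r = 2 * r - r * r"
      using 2 by (simp add: smooth_sgn_def field_simps)
    moreover have "0 \<le> r * (2 - r)" "0 \<le> (1 - r) * (1 - r)" using 2 by auto
    ultimately show ?thesis by (simp add: abs_le_iff algebra_simps)
  next
    case 3
    have "smooth_sgn r = 2 * r + r * r"
      using 3 by (simp add: smooth_sgn_def field_simps)
    moreover have "0 \<le> (-r) * (2 + r)" "0 \<le> (1 + r) * (1 + r)" using 3 by (intro mult_nonneg_nonneg; simp)+
    ultimately show ?thesis by (simp add: abs_le_iff algebra_simps)
  qed (use smooth_sgn_outside[of r] in \<open>auto simp: power2_eq_1_iff\<close>)
qed

lemma smooth_abs_bounds: "0 \<le> smooth_abs r" "smooth_abs r \<le> \<bar>r\<bar> + 1"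
proof -
  have *: "0 \<le> smooth_abs r \<and> smooth_abs r \<le> \<bar>r\<bar> + 1"
  proof (cases "\<bar>r\<bar> \<ge> 1")
    case True
    then show ?thesis by (simp add: smooth_abs_outside)
  next
    case False
    have "6 * smooth_abs r = (1 + r) ^ 3 + (1 - r) ^ 3 - 2 * \<bar>r\<bar> ^ 3"
      using False by (simp add: smooth_abs_def add.commute)
    also have "\<dots> = 2 + 6 * \<bar>r\<bar>\<^sup>2 - 2 * \<bar>r\<bar> ^ 3" by (simp add: power3_eq_cube power2_eq_square algebra_simps)
    finally have e: "6 * smooth_abs r = 2 + 6 * \<bar>r\<bar>\<^sup>2 - 2 * \<bar>r\<bar> ^ 3" .
    have "\<bar>r\<bar> ^ 3 \<le> 1" "\<bar>r\<bar>\<^sup>2 \<le> \<bar>r\<bar>" "0 \<le> \<bar>r\<bar> ^ 3"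
      using False power_le_one[of "\<bar>r\<bar>" 3] mult_left_le[of "\<bar>r\<bar>" "\<bar>r\<bar>"] by (auto simp: power2_eq_square)
    then have "0 \<le> 6 * smooth_abs r" "6 * smooth_abs r \<le> 2 + 6 * \<bar>r\<bar>"
      using e zero_le_power2[of "\<bar>r\<bar>"] by linarith+
    then show ?thesis by simp
  qed
  then show "0 \<le> smooth_abs r" "smooth_abs r \<le> \<bar>r\<bar> + 1" by auto
qed

text \<open>The supersolution is a multiple of \<open>D - exp (k * p x)\<close>, where \<open>p\<close> is the rescaled \<open>smooth_abs\<close> plus
  \<open>2 * (x - z)\<close>. The linear term keeps the slope of \<open>p\<close> at least 1, so that for large \<open>k\<close> the drift is
  dominated.\<close>

lemma upper_barrier:
  fixes \<mu> \<sigma> :: "real \<Rightarrow> real"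
  assumes "continuous_on {a..b} \<mu>" "continuous_on {a..b} \<sigma>" "\<And>x. x \<in> {a..b} \<Longrightarrow> \<sigma> x > 0"
  obtains C where "C > 0"
    "\<And>m. m \<ge> 1 \<Longrightarrow> \<exists>w w' w''. \<forall>x\<in>{a..b}. (w has_real_derivative w' x) (at x) \<and>
       (w' has_real_derivative w'' x) (at x) \<and> 0 \<le> w x \<and> m * w x \<le> C \<and>
       1/2 * \<sigma> x * w'' x + \<mu> x * w' x \<le> - hat (m * (x - z))"
proof -
  obtain s0 s1 M where b: "s0 > 0" "s1 > 0" "M \<ge> 0"
    "\<And>x. x \<in> {a..b} \<Longrightarrow> s0 \<le> \<sigma> x \<and> \<sigma> x \<le> s1 \<and> \<bar>\<mu> x\<bar> \<le> M"
    using compact_bounds[OF assms] by metis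
  \<comment> \<open>As \<open>p' \<ge> 1\<close>, this \<open>k\<close> makes
    \<open>1/2 * \<sigma> * k * p'\<close> at least the drift bound \<open>M\<close>.
    \<open>R\<close> bounds \<open>\<bar>x - z\<bar>\<close> on the interval wherever
    \<open>z\<close> lies, so \<open>p\<close> stays between \<open>- 2 * R\<close> and
    \<open>3 * R + 1\<close>: the upper bound gives the \<open>D\<close> that keeps \<open>w\<close>
    nonnegative, the lower one the \<open>c\<close> that compensates the smallest value of the
    exponential.\<close>
  define k where "k = 2 * M / s0 + 1"
  have k: "k > 0" "s0 * k \<ge> 2 * M" using b by (auto simp: k_def field_simps intro: add_nonneg_pos)
  define R where "R = \<bar>a - z\<bar> + \<bar>b - z\<bar>"
  define D where "D = exp (k * (3 * R + 1))"
  define c where "c = exp (2 * k * R) / (s0 * k)"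
  have c: "c > 0" using b k by (simp add: c_def)
  show ?thesis
  proof (rule that[of "c * D"])
    show "c * D > 0" using c by (simp add: D_def)
    fix m :: real assume m: "m \<ge> 1"
    define p where "p = (\<lambda>x. smooth_abs (m * (x - z)) / m + 2 * (x - z))"
    define p' where "p' = (\<lambda>x. smooth_sgn (m * (x - z)) + 2)"
    define p'' where "p'' = (\<lambda>x. 2 * m * hat (m * (x - z)))"
    have dp: "(p has_real_derivative p' x) (at x)" for x
      unfolding p_def p'_def using m
      by (auto intro!: derivative_eq_intros DERIV_chain2[OF DERIV_smooth_abs])
    have dp': "(p' has_real_derivative p'' x) (at x)" for x
      unfolding p'_def p''_def using m
      by (auto intro!: derivative_eq_intros DERIV_chain2[OF DERIV_smooth_sgn])
    \<comment> \<open>The curvature \<open>p''\<close> is \<open>2 * m\<close> times the tent. The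
      prefactor \<open>c / m\<close> brings this back to unit height, which is why
      \<open>m * w\<close> is bounded independently of \<open>m\<close>.\<close>
    define w where "w = (\<lambda>x. c / m * (D - exp (k * p x)))"
    define w' where "w' = (\<lambda>x. - (c / m * (exp (k * p x) * (k * p' x))))"
    define w'' where "w'' = (\<lambda>x. - (c / m * (exp (k * p x) * (k * p' x) * (k * p' x) + exp (k * p x) * (k * p'' x))))"
    have dw: "(w has_real_derivative w' x) (at x)" for x
      unfolding w_def w'_def by (rule derivative_eq_intros dp refl)+ simp
    have dw': "(w' has_real_derivative w'' x) (at x)" for x
      unfolding w'_def w''_def by (rule derivative_eq_intros dp dp' refl)+ (simp add: algebra_simps)
    have "0 \<le> w x \<and> m * w x \<le> c * D \<and> 1/2 * \<sigma> x * w'' x + \<mu> x * w' x \<le> - hat (m * (x - z))"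
      if x: "x \<in> {a..b}" for x
    proof -
      have xz: "\<bar>x - z\<bar> \<le> R" using x by (auto simp: R_def)
      have "smooth_abs (m * (x - z)) / m \<le> (\<bar>m * (x - z)\<bar> + 1) / m"
        using smooth_abs_bounds m by (intro divide_right_mono) auto
      also have "\<dots> = \<bar>x - z\<bar> + 1 / m" using m by (simp add: abs_mult add_divide_distrib)
      also have "\<dots> \<le> R + 1" using xz m by (simp add: add_mono)
      finally have pu: "p x \<le> 3 * R + 1" using xz by (simp add: p_def)
      have "smooth_abs (m * (x - z)) / m \<ge> 0" using smooth_abs_bounds m by simp
      then have pl: "p x \<ge> - 2 * R" using xz by (simp add: p_def)
      have D: "exp (k * p x) \<le> D" unfolding D_def using pu k by simp
      have 1: "0 \<le> w x" using D c m by (simp add: w_def)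
      have "m * w x = c * D - c * exp (k * p x)" using m by (simp add: w_def algebra_simps)
      then have 2: "m * w x \<le> c * D" using c by simp
      have p'1: "p' x \<ge> 1" using smooth_sgn_bound[of "m * (x - z)"] by (simp add: p'_def abs_le_iff)
      have s: "s0 \<le> \<sigma> x" "\<bar>\<mu> x\<bar> \<le> M" using b(4)[OF x] by auto
      define E where "E = exp (k * p x)"
      define h where "h = hat (m * (x - z))"
      have h: "h \<ge> 0" by (simp add: h_def hat_range)
      have E: "E > 0" "E \<ge> exp (- (2 * k * R))" unfolding E_def using pl k(1) mult_left_mono[of "- 2 * R" "p x" k] by auto
      have "1/2 * \<sigma> x * w'' x + \<mu> x * w' x
         = - (c / m * E) * (k * p' x * (1/2 * \<sigma> x * (k * p' x) + \<mu> x) + \<sigma> x * k * (m * h))"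
        unfolding w'_def w''_def E_def[symmetric] p''_def h_def[symmetric] by (simp add: algebra_simps)
      also have "\<dots> \<le> - (c / m * E) * (0 + s0 * k * (m * h))"
      proof (intro mult_left_mono_neg add_mono)
        have "2 * M \<le> s0 * k * 1" using k by simp
        also have "\<dots> \<le> \<sigma> x * k * p' x" using s b k p'1 by (intro mult_mono) auto
        finally have "0 \<le> 1/2 * \<sigma> x * (k * p' x) + \<mu> x" using s(2) by (simp add: abs_le_iff algebra_simps)
        then show "0 \<le> k * p' x * (1/2 * \<sigma> x * (k * p' x) + \<mu> x)" using k p'1 by simp
        show "s0 * k * (m * h) \<le> \<sigma> x * k * (m * h)" using s k m h by (intro mult_right_mono) auto
        show "- (c / m * E) \<le> 0" using c m E by simp
      qed
      also have "\<dots> = - (c * E * s0 * k * h)" using m by simp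
      also have "\<dots> \<le> - h"
      proof -
        have "1 = c * exp (- (2 * k * R)) * s0 * k" using b k by (simp add: c_def exp_minus)
        also have "\<dots> \<le> c * E * s0 * k" using E c b k by (intro mult_right_mono mult_left_mono) auto
        finally have "1 * h \<le> c * E * s0 * k * h" using h by (rule mult_right_mono)
        then show ?thesis by simp
      qed
      finally show ?thesis using 1 2 unfolding h_def by simp
    qed
    with dw dw' show "\<exists>w w' w''. \<forall>x\<in>{a..b}. (w has_real_derivative w' x) (at x) \<and>
       (w' has_real_derivative w'' x) (at x) \<and> 0 \<le> w x \<and> m * w x \<le> c * D \<and>
       1/2 * \<sigma> x * w'' x + \<mu> x * w' x \<le> - hat (m * (x - z))"
      by (intro exI[of _ w] exI[of _ w'] exI[of _ w'']) auto
  qed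
qed

text \<open>For large \<open>k\<close>, \<open>exp (- k * \<bar>x - z\<bar>)\<close> is a subsolution off its peak; rounding the peak on a scale half the
  width of the tent lets the tent absorb the negative curvature there.\<close>

lemma lower_barrier:
  fixes \<mu> \<sigma> :: "real \<Rightarrow> real"
  assumes "continuous_on {z-\<rho>..z+\<rho>} \<mu>" "continuous_on {z-\<rho>..z+\<rho>} \<sigma>" "\<And>x. x \<in> {z-\<rho>..z+\<rho>} \<Longrightarrow> \<sigma> x > 0"
    and \<rho>: "\<rho> > 0" and lam: "lam > 0"
  obtains c M where "c > 0" "M \<ge> 1"
    "\<And>m. m \<ge> M \<Longrightarrow> \<exists>w w' w''. w (z - \<rho>) \<le> 0 \<and> w (z + \<rho>) \<le> 0 \<and>
       (\<forall>x\<in>{z-\<rho>..z+\<rho>}. (w has_real_derivative w' x) (at x) \<and>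
       (w' has_real_derivative w'' x) (at x) \<and> (\<bar>x - z\<bar> \<le> \<rho> / 4 \<longrightarrow> c \<le> m * w x) \<and>
       lam * w x \<le> hat (m * (x - z)) + (1/2 * \<sigma> x * w'' x + \<mu> x * w' x))"
proof -
  obtain s0 s1 B where b: "s0 > 0" "s1 > 0" "B \<ge> 0"
    "\<And>x. x \<in> {z-\<rho>..z+\<rho>} \<Longrightarrow> s0 \<le> \<sigma> x \<and> \<sigma> x \<le> s1 \<and> \<bar>\<mu> x\<bar> \<le> B"
    using compact_bounds[OF assms(1-3)] by metis
  \<comment> \<open>Away from the rounded peak the slope of \<open>p\<close> has modulus 1, so the
    subsolution inequality reduces to \<open>1/2 * s0 * k\<^sup>2 \<ge> B * k + lam\<close>, which
    this choice guarantees.\<close>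
  define k where "k = 2 * (B + lam) / s0 + 1"
  have k1: "k \<ge> 1" using b lam by (simp add: k_def)
  have "s0 * k \<ge> 2 * (B + lam)" using b by (simp add: k_def field_simps)
  then have "k * (2 * (B + lam)) \<le> k * (s0 * k)" using k1 by (intro mult_left_mono) auto
  moreover have "1 * lam \<le> k * lam" using k1 lam by (intro mult_right_mono) auto
  ultimately have k2: "1/2 * s0 * k\<^sup>2 \<ge> B * k + lam" by (simp add: power2_eq_square algebra_simps)
  \<comment> \<open>\<open>C * m\<close> bounds all that is lost on the rounded peak: the curvature
    costs at most \<open>s1 * k * N\<close> with \<open>N = 2 * m\<close>, and
    \<open>B * k + lam\<close> is absorbed because \<open>m \<ge> 1\<close>.\<close>
  define C where "C = 2 * s1 * k + B * k + lam"
  have C: "C > 0" using b k1 lam unfolding C_def by (intro add_nonneg_pos add_nonneg_nonneg) auto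
  \<comment> \<open>The value of \<open>m * w\<close> where \<open>p\<close> equals
    \<open>\<rho> / 2\<close>. For \<open>m \<ge> M\<close> the rounding adds at most
    \<open>\<rho> / 4\<close> to \<open>p\<close>, so \<open>p\<close> stays below that level on
    \<open>\<bar>x - z\<bar> \<le> \<rho> / 4\<close>; the ends of the interval then lie outside the
    rounding zone, where \<open>p\<close> is exactly \<open>\<rho>\<close> and \<open>w\<close> is
    zero.\<close>
  define c where "c = (exp (- (k * (\<rho> / 2))) - exp (- (k * \<rho>))) / (2 * C)"
  have c: "c > 0" using k1 \<rho> C by (simp add: c_def)
  define M where "M = max 1 (4 / \<rho>)"
  show ?thesis
  proof (rule that[OF c, of M])
    show "M \<ge> 1" by (simp add: M_def)
    fix m assume m: "m \<ge> M"
    then have m1: "m \<ge> 1" and m2: "m * \<rho> \<ge> 4" using \<rho> by (auto simp: M_def field_simps)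
    define N where "N = 2 * m"
    have N: "N > 0" using m1 by (simp add: N_def)
    define p where "p = (\<lambda>x. smooth_abs (N * (x - z)) / N)"
    define p' where "p' = (\<lambda>x. smooth_sgn (N * (x - z)))"
    define p'' where "p'' = (\<lambda>x. 2 * N * hat (N * (x - z)))"
    have dp: "(p has_real_derivative p' x) (at x)" for x
      unfolding p_def p'_def using N
      by (auto intro!: derivative_eq_intros DERIV_chain2[OF DERIV_smooth_abs])
    have dp': "(p' has_real_derivative p'' x) (at x)" for x
      unfolding p'_def p''_def
      by (rule DERIV_cong[OF DERIV_chain2[OF DERIV_smooth_sgn]]) (auto intro!: derivative_eq_intros)
    \<comment> \<open>Scaled so that the worst loss \<open>\<kappa> * C * m\<close> is 1/2, a lower
      bound for the tent on the rounded peak.\<close>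
    define \<kappa> where "\<kappa> = 1 / (2 * C * m)"
    have \<kappa>: "\<kappa> > 0" using C m1 by (simp add: \<kappa>_def)
    define w where "w = (\<lambda>x. \<kappa> * (exp (- (k * p x)) - exp (- (k * \<rho>))))"
    define w' where "w' = (\<lambda>x. - (\<kappa> * (exp (- (k * p x)) * (k * p' x))))"
    define w'' where "w'' = (\<lambda>x. \<kappa> * (exp (- (k * p x)) * (k * p' x) * (k * p' x) - exp (- (k * p x)) * (k * p'' x)))"
    have dw: "(w has_real_derivative w' x) (at x)" for x
      unfolding w_def w'_def by (rule derivative_eq_intros dp refl)+ simp
    have dw': "(w' has_real_derivative w'' x) (at x)" for x
      unfolding w'_def w''_def by (rule derivative_eq_intros dp dp' refl)+ (simp add: algebra_simps)
    have N\<rho>: "N * \<rho> \<ge> 1" using m2 by (simp add: N_def)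
    then have "p (z - \<rho>) = \<rho>" "p (z + \<rho>) = \<rho>"
      using N \<rho> by (auto simp: p_def smooth_abs_outside abs_mult)
    then have bd: "w (z - \<rho>) \<le> 0" "w (z + \<rho>) \<le> 0" by (auto simp: w_def)
    have "(\<bar>x - z\<bar> \<le> \<rho> / 4 \<longrightarrow> c \<le> m * w x) \<and>
       lam * w x \<le> hat (m * (x - z)) + (1/2 * \<sigma> x * w'' x + \<mu> x * w' x)"
      if x: "x \<in> {z-\<rho>..z+\<rho>}" for x
    proof (intro conjI impI)
      assume xz: "\<bar>x - z\<bar> \<le> \<rho> / 4"
      have "p x \<le> (\<bar>N * (x - z)\<bar> + 1) / N"
        unfolding p_def using smooth_abs_bounds N by (intro divide_right_mono) auto
      also have "\<dots> = \<bar>x - z\<bar> + 1 / N" using N by (simp add: abs_mult add_divide_distrib)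
      also have "1 / N \<le> \<rho> / 4" using m2 N by (simp add: N_def field_simps)
      finally have "p x \<le> \<rho> / 2" using xz by simp
      then have "exp (- (k * (\<rho> / 2))) \<le> exp (- (k * p x))" using k1 mult_left_mono[of "p x" "\<rho> / 2" k] by simp
      then have "c \<le> (exp (- (k * p x)) - exp (- (k * \<rho>))) / (2 * C)"
        unfolding c_def using C by (intro divide_right_mono) auto
      also have "\<dots> = m * w x" using m1 by (simp add: w_def \<kappa>_def)
      finally show "c \<le> m * w x" .
    next
      have s: "s0 \<le> \<sigma> x" "\<sigma> x \<le> s1" "\<bar>\<mu> x\<bar> \<le> B" using b(4)[OF x] by auto
      define E where "E = exp (- (k * p x))"
      have "p x \<ge> 0" using smooth_abs_bounds N by (simp add: p_def)
      then have E: "E > 0" "E \<le> 1" unfolding E_def using k1 by auto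
      define Q where "Q = 1/2 * \<sigma> x * k\<^sup>2 * (p' x)\<^sup>2 - 1/2 * \<sigma> x * k * p'' x - \<mu> x * k * p' x - lam"
      have e: "1/2 * \<sigma> x * w'' x + \<mu> x * w' x - lam * w x = \<kappa> * (E * Q + lam * exp (- (k * \<rho>)))"
        unfolding w_def w'_def w''_def E_def[symmetric] Q_def by (simp add: algebra_simps power2_eq_square)
      have pb: "\<bar>p' x\<bar> \<le> 1" unfolding p'_def by (rule smooth_sgn_bound)
      have "\<bar>\<mu> x * k * p' x\<bar> \<le> B * k * 1"
        unfolding abs_mult using s pb k1 b by (intro mult_mono) auto
      then have \<mu>b: "\<mu> x * k * p' x \<le> B * k" by simp
      have "\<kappa> * (E * Q) \<ge> - hat (m * (x - z))"
      proof (cases "\<bar>N * (x - z)\<bar> \<ge> 1")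
        case True
        then have "(p' x)\<^sup>2 = 1" "p'' x = 0"
          using smooth_sgn_outside[of "N * (x - z)"] by (auto simp: p'_def p''_def hat_def)
        moreover have "s0 * k\<^sup>2 \<le> \<sigma> x * k\<^sup>2" using s by (intro mult_right_mono) auto
        ultimately have "Q \<ge> 0" using k2 \<mu>b by (simp add: Q_def)
        then show ?thesis using \<kappa> E hat_range(1)[of "m * (x - z)"]
          by (smt (verit) mult_nonneg_nonneg)
      next
        case False
        then have "\<bar>m * (x - z)\<bar> \<le> 1/2" by (simp add: N_def abs_mult)
        then have h: "hat (m * (x - z)) \<ge> 1/2" by (simp add: hat_def)
        have "p'' x \<le> 2 * N" using hat_range(2)[of "N * (x - z)"] N by (simp add: p''_def)
        then have "\<sigma> x * k * p'' x \<le> s1 * k * (2 * N)"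
          using s b k1 N hat_range(1) by (intro mult_mono) (auto simp: p''_def)
        moreover have "0 \<le> \<sigma> x * k\<^sup>2 * (p' x)\<^sup>2" using s b by auto
        ultimately have "Q \<ge> - (s1 * k * N) - B * k - lam" using \<mu>b by (simp add: Q_def)
        moreover have "s1 * k * N + B * k + lam \<le> C * m"
        proof -
          have "(B * k + lam) * 1 \<le> (B * k + lam) * m" using m1 b k1 lam by (intro mult_left_mono) auto
          then show ?thesis by (simp add: C_def N_def algebra_simps)
        qed
        ultimately have "Q \<ge> - (C * m)" by simp
        then have "E * Q \<ge> E * (- (C * m))" using E by (intro mult_left_mono) auto
        also have "E * (- (C * m)) \<ge> - (C * m)" using E C m1 by (simp add: mult_left_le_one_le)
        finally have "E * Q \<ge> - (C * m)" by simp
        then have "\<kappa> * (E * Q) \<ge> \<kappa> * (- (C * m))" using \<kappa> by (intro mult_left_mono) auto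
        also have "\<kappa> * (- (C * m)) = - 1/2" using C m1 by (simp add: \<kappa>_def)
        finally show ?thesis using h by simp
      qed
      moreover have "\<kappa> * (lam * exp (- (k * \<rho>))) \<ge> 0" using \<kappa> lam by simp
      ultimately show "lam * w x \<le> hat (m * (x - z)) + (1/2 * \<sigma> x * w'' x + \<mu> x * w' x)"
        using e by (simp add: distrib_left)
    qed
    with bd dw dw' show "\<exists>w w' w''. w (z - \<rho>) \<le> 0 \<and> w (z + \<rho>) \<le> 0 \<and>
       (\<forall>x\<in>{z-\<rho>..z+\<rho>}. (w has_real_derivative w' x) (at x) \<and>
       (w' has_real_derivative w'' x) (at x) \<and> (\<bar>x - z\<bar> \<le> \<rho> / 4 \<longrightarrow> c \<le> m * w x) \<and>
       lam * w x \<le> hat (m * (x - z)) + (1/2 * \<sigma> x * w'' x + \<mu> x * w' x))"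
      by (intro exI[of _ w] exI[of _ w'] exI[of _ w'']) auto
  qed
qed

section \<open>Hitting times\<close>

text \<open>The case distinction is essential: \<open>enn2real \<infinity>\<close> is 0, so the
  plain formula would give paths that never hit the weight 1 in place of 0.\<close>

definition discount :: "real \<Rightarrow> ennreal \<Rightarrow> ennreal"
  where "discount lam \<tau> = (if \<tau> = \<infinity> then 0 else ennreal (exp (- lam * enn2real \<tau>)))"

lemma discount_measurable [measurable]: "discount lam \<in> borel_measurable borel"
  unfolding discount_def [abs_def] by measurable

lemma discount_infinity [simp]: "discount lam \<infinity> = 0" "discount lam top = 0"
  by (simp_all add: discount_def)

lemma discount_le_1: "lam > 0 \<Longrightarrow> discount lam \<tau> \<le> 1"
  by (simp add: discount_def ennreal_le_1)

context regular_diffusion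
begin

abbreviation (input) "I \<equiv> einterval r1 r2"

abbreviation (input) "H \<equiv> hitting_time X"

lemma P_prob_algebra: "y \<in> I \<Longrightarrow> P y \<in> space (prob_algebra \<Omega>)"
  using measurable_space[OF kernel, of y] by (simp add: space_restrict_space)

lemma prob_space_P: "y \<in> I \<Longrightarrow> prob_space (P y)"
  and sets_P: "y \<in> I \<Longrightarrow> sets (P y) = sets \<Omega>"
  using P_prob_algebra by (auto simp: space_prob_algebra)

lemma space_P: "y \<in> I \<Longrightarrow> space (P y) = space \<Omega>"
  using sets_P sets_eq_imp_space_eq by blast

lemma measurable_P: "y \<in> I \<Longrightarrow> measurable (P y) N = measurable \<Omega> N"
  using sets_P by (intro measurable_cong_sets) auto

lemma AE_start: assumes "y \<in> I" shows "AE \<omega> in P y. X 0 \<omega> = y"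
proof -
  interpret prob_space "P y" using prob_space_P assms .
  have [measurable]: "X 0 \<in> borel_measurable (P y)" using random_variable[of 0] by (simp add: measurable_P[OF assms])
  have "AE \<omega> in P y. \<omega> \<in> {\<omega> \<in> space \<Omega>. X 0 \<omega> = y}"
  proof (rule AE_prob_1)
    show "prob {\<omega> \<in> space \<Omega>. X 0 \<omega> = y} = 1" using start assms by simp
  qed
  then show ?thesis by eventually_elim simp
qed

text \<open>Negative times are irrelevant: \<open>Y\<close> is \<open>X\<close> made jointly measurable in all real times.\<close>

definition Y :: "real \<Rightarrow> 'w \<Rightarrow> real"
  where "Y t \<omega> = X (max 0 t) \<omega>"

lemma Y_eq: "t \<ge> 0 \<Longrightarrow> Y t \<omega> = X t \<omega>"
  by (simp add: Y_def max_def)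

lemma Y_in_I: "\<omega> \<in> space \<Omega> \<Longrightarrow> Y t \<omega> \<in> I"
  by (simp add: Y_def state_space)

lemma continuous_Y: "\<omega> \<in> space \<Omega> \<Longrightarrow> continuous_on UNIV (\<lambda>t. Y t \<omega>)"
  unfolding Y_def
  by (rule continuous_on_compose2[OF continuous_paths]) (auto intro!: continuous_intros)

lemma isCont_Y: "\<omega> \<in> space \<Omega> \<Longrightarrow> isCont (\<lambda>t. Y t \<omega>) t"
  using continuous_Y continuous_on_eq_continuous_at open_UNIV by blast

text \<open>Rounding time down to a grid of mesh \<open>1 / Suc n\<close> leaves countably many
  random variables glued along measurable time slices; path continuity makes these approximations
  converge pointwise.\<close>

lemma Y_measurable_pair [measurable]: "(\<lambda>(t, \<omega>). Y t \<omega>) \<in> borel_measurable (borel \<Otimes>\<^sub>M \<Omega>)"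
proof (rule borel_measurable_LIMSEQ_real)
  define u where "u = (\<lambda>n (p::real \<times> 'w). Y (real_of_int \<lfloor>real (Suc n) * fst p\<rfloor> / real (Suc n)) (snd p))"
  show "u n \<in> borel_measurable (borel \<Otimes>\<^sub>M \<Omega>)" for n
    unfolding u_def
  proof (rule measurable_compose_countable[where f="\<lambda>i p. Y (real_of_int i / real (Suc n)) (snd p)"])
    show "(\<lambda>p. Y (real_of_int i / real (Suc n)) (snd p)) \<in> borel_measurable (borel \<Otimes>\<^sub>M \<Omega>)" for i
      unfolding Y_def by (rule measurable_compose[OF measurable_snd random_variable]) simp
  qed measurable
  fix p :: "real \<times> 'w" assume p: "p \<in> space (borel \<Otimes>\<^sub>M \<Omega>)"
  then have \<omega>: "snd p \<in> space \<Omega>" by (auto simp: space_pair_measure)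
  have "norm (real_of_int \<lfloor>real (Suc n) * fst p\<rfloor> / real (Suc n) - fst p) < 1 / real (Suc n)" for n
  proof -
    have "\<bar>real_of_int \<lfloor>real (Suc n) * fst p\<rfloor> - real (Suc n) * fst p\<bar> / real (Suc n) < 1 / real (Suc n)"
      by (intro divide_strict_right_mono) linarith+
    also have "\<bar>real_of_int \<lfloor>real (Suc n) * fst p\<rfloor> - real (Suc n) * fst p\<bar> / real (Suc n) =
      \<bar>(real_of_int \<lfloor>real (Suc n) * fst p\<rfloor> - real (Suc n) * fst p) / real (Suc n)\<bar>"
      by (simp only: abs_divide abs_of_nat)
    finally show ?thesis by (simp add: diff_divide_distrib del: of_nat_Suc)
  qed
  note LIM_zero_cancel[OF LIMSEQ_norm_0[OF this]]
  then show "(\<lambda>n. u n p) \<longlonglongrightarrow> (case p of (t, \<omega>) \<Rightarrow> Y t \<omega>)"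
    unfolding u_def split_beta by (rule isCont_tendsto_compose[OF isCont_Y[OF \<omega>]])
qed

lemma Y_measurable [measurable (raw)]:
  assumes "T \<in> borel_measurable M" "g \<in> measurable M \<Omega>"
  shows "(\<lambda>x. Y (T x) (g x)) \<in> borel_measurable M"
  using measurable_compose[OF measurable_Pair[OF assms] Y_measurable_pair] by simp

section \<open>The natural filtration, and hitting times as stopping times\<close>

lemma space_natural_filtration: "space (natural_filtration \<Omega> X t) = space \<Omega>"
  unfolding natural_filtration_def by (simp add: space_measure_of_conv)

lemma sets_natural_filtration:
  "sets (natural_filtration \<Omega> X t) =
    sigma_sets (space \<Omega>) {X s -` B \<inter> space \<Omega> | s B. 0 \<le> s \<and> ennreal s \<le> t \<and> B \<in> sets borel}"
  unfolding natural_filtration_def by (intro sets_measure_of) auto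

lemma filtration_natural: "filtration (space \<Omega>) (natural_filtration \<Omega> X)"
proof
  fix s t :: ennreal assume "s \<le> t"
  then show "sets (natural_filtration \<Omega> X s) \<subseteq> sets (natural_filtration \<Omega> X t)"
    unfolding sets_natural_filtration by (intro sigma_sets_mono') (auto intro: order_trans)
qed (rule space_natural_filtration)

lemma sets_natural_filtration_subset: "sets (natural_filtration \<Omega> X t) \<subseteq> sets \<Omega>"
  unfolding sets_natural_filtration
  by (intro sets.sigma_sets_subset) (auto intro: measurable_sets[OF random_variable])

lemma X_measurable_natural_filtration:
  assumes "0 \<le> s" "ennreal s \<le> t"
  shows "X s \<in> borel_measurable (natural_filtration \<Omega> X t)"
proof (rule measurableI)
  fix B :: "real set" assume "B \<in> sets borel"
  with assms show "X s -` B \<inter> space (natural_filtration \<Omega> X t) \<in> sets (natural_filtration \<Omega> X t)"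
    unfolding space_natural_filtration sets_natural_filtration by (intro sigma_sets.Basic) auto
qed auto

text \<open>The level set of a continuous path is closed, so the infimum in
  \<open>hitting_time\<close> is attained: at a finite hitting time the path is at \<open>z\<close>
  exactly.\<close>

lemma hitting_time_cases:
  assumes "\<omega> \<in> space \<Omega>"
  obtains (never) "H z \<omega> = \<infinity>" "\<And>t. t \<ge> 0 \<Longrightarrow> Y t \<omega> \<noteq> z"
  | (at) \<tau> where "\<tau> \<ge> 0" "H z \<omega> = ennreal \<tau>" "Y \<tau> \<omega> = z" "\<And>t. 0 \<le> t \<Longrightarrow> t < \<tau> \<Longrightarrow> Y t \<omega> \<noteq> z"
proof (cases "\<exists>t\<ge>0. Y t \<omega> = z")
  case False
  then have "{ennreal t | t. 0 \<le> t \<and> X t \<omega> = z} = {}" by (auto simp: Y_eq)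
  then show ?thesis using False never by (auto simp: hitting_time_def)
next
  case True
  define S where "S = {t. 0 \<le> t \<and> Y t \<omega> = z}"
  have S: "S \<noteq> {}" "bdd_below S" using True by (auto simp: S_def intro: bdd_belowI[of _ 0])
  have "closed {t\<in>UNIV. Y t \<omega> = z}"
    using continuous_Y[OF assms] by (intro continuous_closed_preimage_constant) auto
  then have "closed S" unfolding S_def by (intro closed_Collect_conj closed_Collect_le) (auto intro!: continuous_intros)
  then have "Inf S \<in> S" using closed_contains_Inf S by blast
  moreover have "H z \<omega> = ennreal (Inf S)"
    unfolding hitting_time_def
  proof (rule antisym)
    show "Inf {ennreal t | t. 0 \<le> t \<and> X t \<omega> = z} \<le> ennreal (Inf S)"
      using \<open>Inf S \<in> S\<close> by (intro Inf_lower) (auto simp: S_def Y_eq)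
    show "ennreal (Inf S) \<le> Inf {ennreal t | t. 0 \<le> t \<and> X t \<omega> = z}"
      by (intro Inf_greatest) (auto simp: S_def Y_eq intro!: ennreal_leI cInf_lower S(2)[unfolded S_def])
  qed
  moreover have "Y t \<omega> \<noteq> z" if "0 \<le> t" "t < Inf S" for t
    using that cInf_lower[OF _ S(2), of t] by (auto simp: S_def)
  ultimately show ?thesis using at by (auto simp: S_def)
qed

text \<open>A countable description using only times in \<open>[0, \<tau>]\<close>, which makes
  \<open>H z\<close> a stopping time of the raw natural filtration. Sampling at rational multiples
  of \<open>\<tau>\<close> keeps the final time \<open>\<tau>\<close> among the samples, which is
  needed for a path that first hits at \<open>\<tau>\<close>. Conversely, the distance to
  \<open>z\<close> attains its minimum on the compact interval, and arbitrarily small samples force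
  that minimum to be 0.\<close>

lemma hitting_time_le_iff:
  assumes \<omega>: "\<omega> \<in> space \<Omega>" and \<tau>: "\<tau> \<ge> 0"
  shows "H z \<omega> \<le> ennreal \<tau> \<longleftrightarrow>
    (\<forall>n. \<exists>q::rat. 0 \<le> q \<and> q \<le> 1 \<and> \<bar>X (real_of_rat q * \<tau>) \<omega> - z\<bar> < 1 / real (Suc n))"
    (is "?L \<longleftrightarrow> ?R")
proof
  assume ?L
  then obtain s where s: "0 \<le> s" "s \<le> \<tau>" "Y s \<omega> = z"
    by (cases rule: hitting_time_cases[OF \<omega>, of z]) (auto simp: top_unique \<tau>)
  show ?R
  proof
    fix n
    have "\<forall>\<^sub>F t in nhds s. dist (Y t \<omega>) z < 1 / real (Suc n)"
      using tendstoD[OF isCont_Y[OF \<omega>, of s, unfolded isCont_def], of "1 / real (Suc n)"] s(3)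
      unfolding eventually_nhds_conv_at by simp
    then obtain d where d: "d > 0" "\<And>t. dist t s < d \<Longrightarrow> dist (Y t \<omega>) z < 1 / real (Suc n)"
      unfolding eventually_nhds_metric by auto
    have "\<exists>q::rat. 0 \<le> q \<and> q \<le> 1 \<and> dist (real_of_rat q * \<tau>) s < d"
    proof (cases "s = \<tau>")
      case True
      then show ?thesis using d by (intro exI[of _ 1]) auto
    next
      case False
      then have \<tau>0: "\<tau> > 0" and r: "s / \<tau> < 1" "0 \<le> s / \<tau>" using s by auto
      have "s / \<tau> < min 1 (s / \<tau> + d / \<tau>)" using r d(1) \<tau>0 by simp
      from of_rat_dense[OF this] obtain q where q: "s / \<tau> < real_of_rat q" "real_of_rat q < min 1 (s / \<tau> + d / \<tau>)" by blast
      have "0 \<le> real_of_rat q" "real_of_rat q \<le> 1" using q r(2) by linarith+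
      then have "0 \<le> q" "q \<le> 1" by simp_all
      moreover have "s < real_of_rat q * \<tau>" "real_of_rat q * \<tau> < s + d"
        using q \<tau>0 by (auto simp: field_simps)
      ultimately show ?thesis by (intro exI[of _ q]) (auto simp: dist_real_def)
    qed
    then obtain q :: rat where q: "0 \<le> q" "q \<le> 1" "dist (real_of_rat q * \<tau>) s < d" by auto
    have "real_of_rat q * \<tau> \<ge> 0" using q \<tau> by simp
    then have "\<bar>X (real_of_rat q * \<tau>) \<omega> - z\<bar> < 1 / real (Suc n)"
      using d(2)[OF q(3)] by (simp add: Y_eq dist_real_def)
    with q show "\<exists>q::rat. 0 \<le> q \<and> q \<le> 1 \<and> \<bar>X (real_of_rat q * \<tau>) \<omega> - z\<bar> < 1 / real (Suc n)" by auto
  qed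
next
  assume R: ?R
  have "continuous_on {0..\<tau>} (\<lambda>t. \<bar>Y t \<omega> - z\<bar>)"
    using continuous_on_subset[OF continuous_Y[OF \<omega>]] by (intro continuous_intros) auto
  then obtain s where s: "s \<in> {0..\<tau>}" "\<And>t. t \<in> {0..\<tau>} \<Longrightarrow> \<bar>Y s \<omega> - z\<bar> \<le> \<bar>Y t \<omega> - z\<bar>"
    using continuous_attains_inf[of "{0..\<tau>}" "\<lambda>t. \<bar>Y t \<omega> - z\<bar>"] \<tau> by auto
  have "\<bar>Y s \<omega> - z\<bar> < 1 / real (Suc n)" for n
  proof -
    from R obtain q :: rat where q: "0 \<le> q" "q \<le> 1" "\<bar>X (real_of_rat q * \<tau>) \<omega> - z\<bar> < 1 / real (Suc n)" by blast
    have "real_of_rat q * \<tau> \<ge> 0" "real_of_rat q * \<tau> \<le> \<tau>" using q \<tau> by (auto intro: mult_left_le_one_le)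
    then show ?thesis using q(3) s(2)[of "real_of_rat q * \<tau>"] by (simp add: Y_eq)
  qed
  then have "Y s \<omega> = z"
    using reals_Archimedean[of "\<bar>Y s \<omega> - z\<bar>"] by (simp add: inverse_eq_divide) (meson not_less_iff_gr_or_eq)
  then have "H z \<omega> \<le> ennreal s"
    unfolding hitting_time_def using s by (intro Inf_lower) (auto simp: Y_eq)
  also have "\<dots> \<le> ennreal \<tau>" using s by (intro ennreal_leI) auto
  finally show ?L .
qed

lemma stopping_time_hitting_time: "stopping_time (natural_filtration \<Omega> X) (H z)"
proof
  fix t :: ennreal
  show "Measurable.pred (natural_filtration \<Omega> X t) (\<lambda>\<omega>. H z \<omega> \<le> t)"
  proof (cases t)
    case (real \<tau>)
    have "Measurable.pred (natural_filtration \<Omega> X t) (\<lambda>\<omega>. \<forall>n. \<exists>q::rat. 0 \<le> q \<and> q \<le> 1 \<and>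
      \<bar>X (real_of_rat q * \<tau>) \<omega> - z\<bar> < 1 / real (Suc n))"
    proof (intro pred_intros_countable)
      fix n and q :: rat
      show "Measurable.pred (natural_filtration \<Omega> X t) (\<lambda>\<omega>. 0 \<le> q \<and> q \<le> 1 \<and>
        \<bar>X (real_of_rat q * \<tau>) \<omega> - z\<bar> < 1 / real (Suc n))"
      proof (cases "0 \<le> q \<and> q \<le> 1")
        case True
        have [measurable]: "X (real_of_rat q * \<tau>) \<in> borel_measurable (natural_filtration \<Omega> X t)"
          using True real by (intro X_measurable_natural_filtration)
            (auto intro!: ennreal_leI mult_left_le_one_le)
        show ?thesis by measurable
      next
        case False
        then have "(\<lambda>\<omega>. 0 \<le> q \<and> q \<le> 1 \<and> \<bar>X (real_of_rat q * \<tau>) \<omega> - z\<bar> < 1 / real (Suc n)) = (\<lambda>_. False)"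
          by auto
        then show ?thesis by simp
      qed
    qed
    then show ?thesis
    proof (rule measurable_cong[THEN iffD2, rotated])
      fix \<omega> assume "\<omega> \<in> space (natural_filtration \<Omega> X t)"
      then have "\<omega> \<in> space \<Omega>" by (simp add: space_natural_filtration)
      from hitting_time_le_iff[OF this real(1), of z] real(2)
      show "(H z \<omega> \<le> t) = (\<forall>n. \<exists>q::rat. 0 \<le> q \<and> q \<le> 1 \<and>
        \<bar>X (real_of_rat q * \<tau>) \<omega> - z\<bar> < 1 / real (Suc n))" by simp
    qed
  qed simp
qed

lemma hitting_time_measurable [measurable]: "H z \<in> borel_measurable \<Omega>"
  by (rule measurable_stopping_time[OF stopping_time_hitting_time sets_natural_filtration_subset space_natural_filtration])

definition prehit :: "real \<Rightarrow> 'w measure"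
  where "prehit z = filtration.pre_sigma (space \<Omega>) (natural_filtration \<Omega> X) (H z)"

lemma space_prehit: "space (prehit z) = space \<Omega>"
  unfolding prehit_def by (rule filtration.space_pre_sigma[OF filtration_natural])

lemma sets_prehit_subset: "sets (prehit z) \<subseteq> sets \<Omega>"
proof
  fix A assume "A \<in> sets (prehit z)"
  then have "{\<omega> \<in> A. H z \<omega> \<le> \<infinity>} \<in> sets (natural_filtration \<Omega> X \<infinity>)"
    unfolding prehit_def by (rule filtration.sets_pre_sigmaD[OF filtration_natural stopping_time_hitting_time])
  then show "A \<in> sets \<Omega>" using sets_natural_filtration_subset by auto
qed

lemma hitting_time_prehit [measurable]: "H z \<in> borel_measurable (prehit z)"
  unfolding prehit_def by (rule filtration.measurable_stopping_time_pre_sigma[OF filtration_natural stopping_time_hitting_time])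

lemma hitting_time_less_prehit: "{\<omega> \<in> space \<Omega>. H a \<omega> < H b \<omega>} \<in> sets (prehit a)"
  using filtration.stopping_time_less[OF filtration_natural stopping_time_hitting_time[of a] stopping_time_hitting_time[of b]]
  unfolding prehit_def pred_def by (simp add: filtration.space_pre_sigma[OF filtration_natural])

lemma hitting_time_finite_prehit: "{\<omega> \<in> space \<Omega>. H a \<omega> < \<infinity>} \<in> sets (prehit a)"
proof -
  have "{\<omega> \<in> space (prehit a). H a \<omega> < \<infinity>} \<in> sets (prehit a)" by measurable
  then show ?thesis by (simp add: space_prehit)
qed

end

section \<open>Strong Markov property\<close>

lemma nn_integral_shift:
  fixes f :: "real \<Rightarrow> ennreal"
  assumes [measurable]: "f \<in> borel_measurable borel"
  shows "(\<integral>\<^sup>+t\<in>{c..}. f t \<partial>lborel) = (\<integral>\<^sup>+t\<in>{0..}. f (c + t) \<partial>lborel)"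
proof -
  have "(\<integral>\<^sup>+t\<in>{c..}. f t \<partial>lborel) = (\<integral>\<^sup>+t. f (c + t) * indicator {c..} (c + t) \<partial>lborel)"
    by (subst nn_integral_real_affine[where c=1 and t=c]) auto
  also have "\<dots> = (\<integral>\<^sup>+t\<in>{0..}. f (c + t) \<partial>lborel)"
    by (intro nn_integral_cong) (auto split: split_indicator)
  finally show ?thesis .
qed

context regular_diffusion
begin

lemma strong_markov_coordinate:
  assumes T: "stopping_time (natural_filtration \<Omega> X) T" and y: "y \<in> I"
    and A: "A \<in> sets (filtration.pre_sigma (space \<Omega>) (natural_filtration \<Omega> X) T)"
    and t: "0 \<le> t" and C: "C \<in> sets borel"
  shows "emeasure (P y) {\<omega> \<in> A. T \<omega> < \<infinity> \<and> Y (enn2real (T \<omega>) + t) \<omega> \<in> C} =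
    (\<integral>\<^sup>+\<omega>\<in>{\<omega> \<in> A. T \<omega> < \<infinity>}. emeasure (P (Y (enn2real (T \<omega>)) \<omega>)) {\<omega>' \<in> space \<Omega>. Y t \<omega>' \<in> C} \<partial>P y)"
proof -
  define B where "B = {p \<in> space (Pi\<^sub>M {0..} (\<lambda>_. borel :: real measure)). p t \<in> C}"
  have "(\<lambda>p. p t) \<in> measurable (Pi\<^sub>M {0..} (\<lambda>_. borel :: real measure)) borel"
    using t by (intro measurable_component_singleton) auto
  from measurable_sets[OF this C] have B: "B \<in> sets (Pi\<^sub>M {0..} (\<lambda>_. borel))"
    unfolding B_def by (simp add: vimage_def Int_def conj_commute)
  have "shifted_path X s \<omega> \<in> B \<longleftrightarrow> Y (s + t) \<omega> \<in> C" if "s \<ge> 0" for s \<omega>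
    using t that by (auto simp: B_def shifted_path_def space_PiM Y_eq)
  with strong_markov[OF T y A B] show ?thesis by (simp add: Y_eq)
qed

text \<open>On \<open>A\<close> the path sits at \<open>z\<close> at time \<open>H z\<close>, so the
  law of the future in the strong Markov property is the constant \<open>P z\<close> and the
  integral factorises.\<close>

lemma strong_markov_hitting:
  assumes y: "y \<in> I" and z: "z \<in> I" and A: "A \<in> sets (prehit z)"
    and fin: "\<And>\<omega>. \<omega> \<in> A \<Longrightarrow> H z \<omega> < \<infinity>"
    and t: "0 \<le> t" and C: "C \<in> sets borel"
  shows "emeasure (P y) {\<omega> \<in> A. Y (enn2real (H z \<omega>) + t) \<omega> \<in> C} =
    emeasure (P y) A * emeasure (P z) {\<omega> \<in> space \<Omega>. Y t \<omega> \<in> C}"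
proof -
  let ?T = "H z"
  have A_sub: "A \<subseteq> space \<Omega>" using sets_prehit_subset A sets.sets_into_space by blast
  have at: "Y (enn2real (?T \<omega>)) \<omega> = z" if "\<omega> \<in> A" for \<omega>
  proof -
    have \<omega>: "\<omega> \<in> space \<Omega>" using that A_sub by auto
    show ?thesis using fin[OF that] by (cases rule: hitting_time_cases[OF \<omega>, of z]) auto
  qed
  have A_fin: "{\<omega> \<in> A. ?T \<omega> < \<infinity>} = A" using fin by auto
  have "emeasure (P y) {\<omega> \<in> A. Y (enn2real (?T \<omega>) + t) \<omega> \<in> C} =
    emeasure (P y) {\<omega> \<in> A. ?T \<omega> < \<infinity> \<and> Y (enn2real (?T \<omega>) + t) \<omega> \<in> C}"
    using fin by (intro arg_cong[where f="emeasure (P y)"]) auto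
  also have "\<dots> = (\<integral>\<^sup>+\<omega>. emeasure (P z) {\<omega> \<in> space \<Omega>. Y t \<omega> \<in> C} * indicator A \<omega> \<partial>P y)"
    unfolding strong_markov_coordinate[OF stopping_time_hitting_time y A[unfolded prehit_def] t C] A_fin
    by (intro nn_integral_cong) (simp add: at split: split_indicator)
  also have "\<dots> = emeasure (P y) A * emeasure (P z) {\<omega> \<in> space \<Omega>. Y t \<omega> \<in> C}"
    using A sets_prehit_subset sets_P[OF y] by (subst nn_integral_cmult_indicator) (auto simp: mult.commute)
  finally show ?thesis .
qed

lemma Y_measurable_P [measurable]: "y \<in> I \<Longrightarrow> Y t \<in> borel_measurable (P y)"
  by (subst measurable_P) measurable

text \<open>Under \<open>P y\<close> restricted to \<open>A\<close>, the joint law of the hitting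
  time and of the position \<open>t\<close> later is a product measure. It is enough to check this
  on rectangles, and the integral of a product of functions then splits by Fubini.\<close>

lemma strong_markov_hitting_nn_integral:
  assumes y: "y \<in> I" and z: "z \<in> I" and A: "A \<in> sets (prehit z)"
    and fin: "\<And>\<omega>. \<omega> \<in> A \<Longrightarrow> H z \<omega> < \<infinity>"
    and t: "0 \<le> t" and [measurable]: "g \<in> borel_measurable borel"
  shows "(\<integral>\<^sup>+\<omega>\<in>A. discount lam (H z \<omega>) * g (Y (enn2real (H z \<omega>) + t) \<omega>) \<partial>P y) =
    (\<integral>\<^sup>+\<omega>\<in>A. discount lam (H z \<omega>) \<partial>P y) * (\<integral>\<^sup>+\<omega>. g (Y t \<omega>) \<partial>P z)"
proof -
  let ?T = "H z"
  interpret y: prob_space "P y" using prob_space_P[OF y] .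
  interpret z: prob_space "P z" using prob_space_P[OF z] .
  have [simp, measurable_cong]: "sets (P y) = sets \<Omega>" "sets (P z) = sets \<Omega>" using sets_P y z by auto
  have [measurable]: "A \<in> sets \<Omega>" using A sets_prehit_subset by auto
  then have A_sub: "A \<subseteq> space \<Omega>" by (rule sets.sets_into_space)
  define N where "N = density (P y) (indicator A)"
  have [simp, measurable_cong]: "sets N = sets \<Omega>" by (simp add: N_def)
  have [simp]: "space N = space \<Omega>" by (simp add: N_def space_P[OF y])
  have emN: "emeasure N S = emeasure (P y) (A \<inter> S)" if "S \<in> sets \<Omega>" for S
    unfolding N_def using that by (simp add: emeasure_density nn_integral_set_ennreal[symmetric] flip: indicator_inter_arith)
  define S where "S = (\<lambda>\<omega>. Y (enn2real (?T \<omega>) + t) \<omega>)"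
  have [measurable]: "S \<in> borel_measurable \<Omega>" unfolding S_def by measurable
  define M1 where "M1 = distr N borel ?T"
  define M2 where "M2 = distr (P z) borel (Y t)"
  define M where "M = distr N (borel \<Otimes>\<^sub>M borel) (\<lambda>\<omega>. (?T \<omega>, S \<omega>))"
  have finN: "finite_measure N"
    by (rule finite_measureI) (simp add: emN y.emeasure_finite)
  interpret M1: finite_measure M1
    unfolding M1_def by (rule finite_measure.finite_measure_distr[OF finN]) measurable
  interpret M2: prob_space M2
    unfolding M2_def by (rule z.prob_space_distr) measurable
  have eq: "M1 \<Otimes>\<^sub>M M2 = M"
  proof (rule pair_measure_eqI)
    show "sigma_finite_measure M1" "sigma_finite_measure M2" by unfold_locales
    show "sets (M1 \<Otimes>\<^sub>M M2) = sets M" by (simp add: M1_def M2_def M_def cong: sets_pair_measure_cong)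
  next
    fix C D assume "C \<in> sets M1" "D \<in> sets M2"
    then have [measurable]: "C \<in> sets borel" "D \<in> sets borel" by (auto simp: M1_def M2_def)
    \<comment> \<open>Restricting \<open>A\<close> by a condition on \<open>H z\<close> stays inside
      \<open>prehit z\<close>, so the factorisation for events already contains the independence
      from the hitting time.\<close>
    define A' where "A' = A \<inter> (?T -` C \<inter> space (prehit z))"
    have A': "A' \<in> sets (prehit z)"
      unfolding A'_def by (intro sets.Int A measurable_sets[OF hitting_time_prehit]) measurable
    have "emeasure M (C \<times> D) = emeasure N {\<omega> \<in> space \<Omega>. ?T \<omega> \<in> C \<and> S \<omega> \<in> D}"
      unfolding M_def by (subst emeasure_distr) (auto intro!: arg_cong[where f="emeasure N"])
    also have "\<dots> = emeasure (P y) {\<omega> \<in> A'. S \<omega> \<in> D}"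
      using A_sub by (subst emN, measurable) (auto simp: A'_def space_prehit intro!: arg_cong[where f="emeasure (P y)"])
    also have "\<dots> = emeasure (P y) A' * emeasure (P z) {\<omega> \<in> space \<Omega>. Y t \<omega> \<in> D}"
      unfolding S_def by (rule strong_markov_hitting[OF y z A' _ t]) (use fin in \<open>auto simp: A'_def\<close>)
    also have "emeasure (P y) A' = emeasure N {\<omega> \<in> space \<Omega>. ?T \<omega> \<in> C}"
      using A_sub by (subst emN, measurable) (auto simp: A'_def space_prehit intro!: arg_cong[where f="emeasure (P y)"])
    also have "\<dots> = emeasure M1 C"
      unfolding M1_def by (subst emeasure_distr) (auto intro!: arg_cong[where f="emeasure N"])
    also have "emeasure (P z) {\<omega> \<in> space \<Omega>. Y t \<omega> \<in> D} = emeasure M2 D"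
      unfolding M2_def by (subst emeasure_distr) (auto simp: space_P[OF z] intro!: arg_cong[where f="emeasure (P z)"])
    finally show "emeasure M1 C * emeasure M2 D = emeasure M (C \<times> D)" by simp
  qed
  have "(\<integral>\<^sup>+\<omega>\<in>A. discount lam (?T \<omega>) * g (S \<omega>) \<partial>P y) = (\<integral>\<^sup>+\<omega>. discount lam (?T \<omega>) * g (S \<omega>) \<partial>N)"
    unfolding N_def by (subst nn_integral_density) (auto simp: mult.commute)
  also have "\<dots> = (\<integral>\<^sup>+p. discount lam (fst p) * g (snd p) \<partial>M)"
    unfolding M_def by (subst nn_integral_distr) auto
  also have "\<dots> = (\<integral>\<^sup>+s. \<integral>\<^sup>+x. discount lam s * g x \<partial>M2 \<partial>M1)"
    unfolding eq[symmetric] by (subst M2.nn_integral_fst[symmetric]) (auto simp: M1_def M2_def)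
  also have "\<dots> = (\<integral>\<^sup>+s. discount lam s \<partial>M1) * (\<integral>\<^sup>+x. g x \<partial>M2)"
    by (simp add: nn_integral_cmult nn_integral_multc M1_def M2_def)
  also have "(\<integral>\<^sup>+x. g x \<partial>M2) = (\<integral>\<^sup>+\<omega>. g (Y t \<omega>) \<partial>P z)"
    unfolding M2_def by (subst nn_integral_distr) auto
  also have "(\<integral>\<^sup>+s. discount lam s \<partial>M1) = (\<integral>\<^sup>+\<omega>. discount lam (?T \<omega>) \<partial>N)"
    unfolding M1_def by (subst nn_integral_distr) auto
  also have "\<dots> = (\<integral>\<^sup>+\<omega>\<in>A. discount lam (?T \<omega>) \<partial>P y)"
    unfolding N_def by (subst nn_integral_density) (auto simp: mult.commute)
  finally show ?thesis unfolding S_def .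
qed

text \<open>The conversion to \<open>ennreal\<close> counts only the positive part of
  \<open>g\<close>, so with \<open>lam > 0\<close> an upper bound on \<open>g\<close> already makes
  this finite.\<close>

definition occupation :: "real \<Rightarrow> (real \<Rightarrow> real) \<Rightarrow> 'w \<Rightarrow> ennreal"
  where "occupation lam g \<omega> = (\<integral>\<^sup>+t\<in>{0..}. ennreal (exp (- lam * t) * g (Y t \<omega>)) \<partial>lborel)"

definition resolvent_nn :: "real \<Rightarrow> (real \<Rightarrow> real) \<Rightarrow> real \<Rightarrow> ennreal"
  where "resolvent_nn lam g y = (\<integral>\<^sup>+\<omega>. occupation lam g \<omega> \<partial>P y)"

lemma occupation_measurable [measurable]:
  assumes [measurable]: "g \<in> borel_measurable borel"
  shows "occupation lam g \<in> borel_measurable \<Omega>"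
  unfolding occupation_def [abs_def] by measurable

lemma occupation_eq_0: "(\<And>t. t \<ge> 0 \<Longrightarrow> g (Y t \<omega>) = 0) \<Longrightarrow> occupation lam g \<omega> = 0"
proof -
  assume [simp]: "\<And>t. t \<ge> 0 \<Longrightarrow> g (Y t \<omega>) = 0"
  have "occupation lam g \<omega> = (\<integral>\<^sup>+t. 0 \<partial>(lborel :: real measure))"
    unfolding occupation_def by (intro nn_integral_cong) (simp split: split_indicator)
  then show ?thesis by simp
qed

text \<open>Stated for a general \<open>M\<close> because it is applied both to \<open>P y\<close>
  and to the mixture of the laws \<open>P (Y h \<omega>)\<close> over the position at a fixed
  time.\<close>

lemma nn_integral_occupation:
  assumes M: "sigma_finite_measure M" and sets [measurable_cong]: "sets M = sets \<Omega>"
    and [measurable]: "g \<in> borel_measurable borel"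
  shows "(\<integral>\<^sup>+\<omega>. occupation lam g \<omega> \<partial>M) =
    (\<integral>\<^sup>+t\<in>{0..}. (\<integral>\<^sup>+\<omega>. ennreal (exp (- lam * t) * g (Y t \<omega>)) \<partial>M) \<partial>lborel)"
proof -
  interpret sigma_finite_measure M by fact
  interpret pair_sigma_finite lborel M ..
  have "(\<integral>\<^sup>+\<omega>. occupation lam g \<omega> \<partial>M) =
    (\<integral>\<^sup>+t. (\<integral>\<^sup>+\<omega>. ennreal (exp (- lam * t) * g (Y t \<omega>)) * indicator {0..} t \<partial>M) \<partial>lborel)"
    unfolding occupation_def by (rule Fubini') measurable
  also have "\<dots> = (\<integral>\<^sup>+t\<in>{0..}. (\<integral>\<^sup>+\<omega>. ennreal (exp (- lam * t) * g (Y t \<omega>)) \<partial>M) \<partial>lborel)"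
    by (intro nn_integral_cong) (simp split: split_indicator)
  finally show ?thesis .
qed

lemma resolvent_nn_eq:
  assumes "y \<in> I" and "g \<in> borel_measurable borel"
  shows "resolvent_nn lam g y =
    (\<integral>\<^sup>+t\<in>{0..}. (\<integral>\<^sup>+\<omega>. ennreal (exp (- lam * t) * g (Y t \<omega>)) \<partial>P y) \<partial>lborel)"
  unfolding resolvent_nn_def
  by (intro nn_integral_occupation prob_space_imp_sigma_finite prob_space_P sets_P assms)

lemma occupation_from:
  assumes \<omega>: "\<omega> \<in> space \<Omega>" and [measurable]: "g \<in> borel_measurable borel" and T: "T < \<infinity>"
    and z: "\<And>t. 0 \<le> t \<Longrightarrow> ennreal t < T \<Longrightarrow> g (Y t \<omega>) = 0"
  shows "occupation lam g \<omega> =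
    (\<integral>\<^sup>+t\<in>{0..}. discount lam T * ennreal (exp (- lam * t) * g (Y (enn2real T + t) \<omega>)) \<partial>lborel)"
proof -
  from T obtain \<tau> where \<tau>: "\<tau> \<ge> 0" "T = ennreal \<tau>" by (cases T) auto
  have [measurable]: "(\<lambda>t. Y t \<omega>) \<in> borel_measurable borel"
    using \<omega> by (intro borel_measurable_continuous_onI continuous_Y)
  have "occupation lam g \<omega> = (\<integral>\<^sup>+t\<in>{\<tau>..}. ennreal (exp (- lam * t) * g (Y t \<omega>)) \<partial>lborel)"
    unfolding occupation_def using \<tau> z
    by (intro nn_integral_cong) (auto split: split_indicator simp: ennreal_less_iff)
  also have "\<dots> = (\<integral>\<^sup>+t\<in>{0..}. ennreal (exp (- lam * (\<tau> + t)) * g (Y (\<tau> + t) \<omega>)) \<partial>lborel)"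
    by (rule nn_integral_shift) measurable
  also have "\<dots> = (\<integral>\<^sup>+t\<in>{0..}. discount lam T * ennreal (exp (- lam * t) * g (Y (enn2real T + t) \<omega>)) \<partial>lborel)"
    using \<tau> by (intro nn_integral_cong)
      (simp add: discount_def ennreal_mult'[symmetric] exp_add[symmetric] mult.assoc[symmetric] algebra_simps)
  finally show ?thesis .
qed

text \<open>Before the hitting time \<open>g\<close> sees nothing, so a time shift pulls out the
  discount. Exchanging time integral and expectation then reduces the claim to single times after
  hitting. The vanishing is required only for paths starting at \<open>y\<close>, which is almost
  every path under \<open>P y\<close>.\<close>

lemma occupation_strong_markov:
  assumes y: "y \<in> I" and z: "z \<in> I" and A: "A \<in> sets (prehit z)"
    and fin: "\<And>\<omega>. \<omega> \<in> A \<Longrightarrow> H z \<omega> < \<infinity>"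
    and [measurable]: "g \<in> borel_measurable borel"
    and zero: "\<And>\<omega> t. \<omega> \<in> A \<Longrightarrow> X 0 \<omega> = y \<Longrightarrow> 0 \<le> t \<Longrightarrow> ennreal t < H z \<omega> \<Longrightarrow> g (Y t \<omega>) = 0"
  shows "(\<integral>\<^sup>+\<omega>\<in>A. occupation lam g \<omega> \<partial>P y) =
    (\<integral>\<^sup>+\<omega>\<in>A. discount lam (H z \<omega>) \<partial>P y) * resolvent_nn lam g z"
proof -
  let ?T = "H z"
  interpret y: prob_space "P y" using prob_space_P[OF y] .
  interpret pair_sigma_finite lborel "P y" ..
  have [simp, measurable_cong]: "sets (P y) = sets \<Omega>" "sets (P z) = sets \<Omega>" using sets_P y z by auto
  have [measurable]: "A \<in> sets \<Omega>" using A sets_prehit_subset by auto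
  then have A_sub: "A \<subseteq> space \<Omega>" by (rule sets.sets_into_space)
  have "(\<integral>\<^sup>+\<omega>\<in>A. occupation lam g \<omega> \<partial>P y) =
    (\<integral>\<^sup>+\<omega>\<in>A. (\<integral>\<^sup>+t\<in>{0..}. discount lam (?T \<omega>) * ennreal (exp (- lam * t) * g (Y (enn2real (?T \<omega>) + t) \<omega>)) \<partial>lborel) \<partial>P y)"
  proof (intro nn_integral_cong_AE)
    show "AE \<omega> in P y. occupation lam g \<omega> * indicator A \<omega> =
      (\<integral>\<^sup>+t\<in>{0..}. discount lam (?T \<omega>) * ennreal (exp (- lam * t) * g (Y (enn2real (?T \<omega>) + t) \<omega>)) \<partial>lborel) * indicator A \<omega>"
      using AE_start[OF y]
    proof eventually_elim
      case (elim \<omega>)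
      show ?case
      proof (cases "\<omega> \<in> A")
        case True
        then show ?thesis
          using occupation_from[OF _ assms(5) fin[OF True] zero[OF True elim], of lam] A_sub by auto
      qed simp
    qed
  qed
  also have "\<dots> = (\<integral>\<^sup>+\<omega>. (\<integral>\<^sup>+t. discount lam (?T \<omega>) * ennreal (exp (- lam * t) * g (Y (enn2real (?T \<omega>) + t) \<omega>))
      * indicator {0..} t * indicator A \<omega> \<partial>lborel) \<partial>P y)"
    using A_sub by (intro nn_integral_cong) (auto split: split_indicator)
  also have "\<dots> = (\<integral>\<^sup>+t. (\<integral>\<^sup>+\<omega>. discount lam (?T \<omega>) * ennreal (exp (- lam * t) * g (Y (enn2real (?T \<omega>) + t) \<omega>))
      * indicator {0..} t * indicator A \<omega> \<partial>P y) \<partial>lborel)"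
    by (rule Fubini') measurable
  also have "\<dots> = (\<integral>\<^sup>+t\<in>{0..}. (\<integral>\<^sup>+\<omega>\<in>A. discount lam (?T \<omega>) *
      ennreal (exp (- lam * t) * g (Y (enn2real (?T \<omega>) + t) \<omega>)) \<partial>P y) \<partial>lborel)"
    by (intro nn_integral_cong) (simp split: split_indicator)
  also have "\<dots> = (\<integral>\<^sup>+t\<in>{0..}. (\<integral>\<^sup>+\<omega>\<in>A. discount lam (?T \<omega>) \<partial>P y) *
      (\<integral>\<^sup>+\<omega>. ennreal (exp (- lam * t) * g (Y t \<omega>)) \<partial>P z) \<partial>lborel)"
  proof (intro nn_integral_cong)
    fix t
    show "(\<integral>\<^sup>+\<omega>\<in>A. discount lam (?T \<omega>) * ennreal (exp (- lam * t) * g (Y (enn2real (?T \<omega>) + t) \<omega>)) \<partial>P y) * indicator {0..} t =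
      (\<integral>\<^sup>+\<omega>\<in>A. discount lam (?T \<omega>) \<partial>P y) * (\<integral>\<^sup>+\<omega>. ennreal (exp (- lam * t) * g (Y t \<omega>)) \<partial>P z) * indicator {0..} t"
    proof (cases "t \<ge> 0")
      case True
      have m: "(\<lambda>x. ennreal (exp (- lam * t) * g x)) \<in> borel_measurable borel" by measurable
      show ?thesis
        using strong_markov_hitting_nn_integral[OF y z A fin True m, of lam] by simp
    qed simp
  qed
  also have "\<dots> = (\<integral>\<^sup>+\<omega>\<in>A. discount lam (?T \<omega>) \<partial>P y) * resolvent_nn lam g z"
  proof -
    interpret z: prob_space "P z" using prob_space_P[OF z] .
    show ?thesis unfolding resolvent_nn_eq[OF z assms(5)]
      by (subst nn_integral_cmult[symmetric]) (auto intro!: nn_integral_cong simp: mult.assoc)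
  qed
  finally show ?thesis .
qed

section \<open>First-passage decompositions of the resolvent\<close>

definition hitting_discount :: "real \<Rightarrow> real \<Rightarrow> real \<Rightarrow> ennreal"
  where "hitting_discount lam z y = (\<integral>\<^sup>+\<omega>. discount lam (H z \<omega>) \<partial>P y)"

lemma path_meets:
  assumes \<omega>: "\<omega> \<in> space \<Omega>" and t: "0 \<le> t" and z: "z \<in> closed_segment (X 0 \<omega>) (Y t \<omega>)"
  shows "H z \<omega> \<le> ennreal t"
proof -
  have "connected ((\<lambda>t. Y t \<omega>) ` {0..t})"
    by (intro connected_continuous_image continuous_on_subset[OF continuous_Y[OF \<omega>]]) auto
  moreover have "X 0 \<omega> \<in> (\<lambda>t. Y t \<omega>) ` {0..t}" "Y t \<omega> \<in> (\<lambda>t. Y t \<omega>) ` {0..t}"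
    using t by (auto simp: Y_eq[of 0, symmetric])
  ultimately have "closed_segment (X 0 \<omega>) (Y t \<omega>) \<subseteq> (\<lambda>t. Y t \<omega>) ` {0..t}"
    by (metis closed_segment_subset is_interval_connected_1 is_interval_convex_1)
  with z obtain s where "s \<in> {0..t}" "Y s \<omega> = z" by blast
  then have "H z \<omega> \<le> ennreal s"
    unfolding hitting_time_def by (intro Inf_lower) (auto simp: Y_eq)
  also have "\<dots> \<le> ennreal t" using \<open>s \<in> {0..t}\<close> by (intro ennreal_leI) auto
  finally show ?thesis .
qed

lemma resolvent_nn_through:
  assumes y: "y \<in> I" and z: "z \<in> I" and [measurable]: "g \<in> borel_measurable borel"
    and sep: "\<And>x. x \<in> I \<Longrightarrow> g x \<noteq> 0 \<Longrightarrow> z \<in> closed_segment y x"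
  shows "resolvent_nn lam g y = hitting_discount lam z y * resolvent_nn lam g z"
proof -
  let ?T = "H z"
  have [simp, measurable_cong]: "sets (P y) = sets \<Omega>" using sets_P y by auto
  define A where "A = {\<omega> \<in> space \<Omega>. ?T \<omega> < \<infinity>}"
  have A: "A \<in> sets (prehit z)" unfolding A_def by (rule hitting_time_finite_prehit)
  have [measurable]: "A \<in> sets \<Omega>" using A sets_prehit_subset by auto
  have le: "?T \<omega> \<le> ennreal t" if "\<omega> \<in> space \<Omega>" "X 0 \<omega> = y" "t \<ge> 0" "g (Y t \<omega>) \<noteq> 0" for \<omega> t
    using that sep[OF Y_in_I[OF that(1)] that(4)] by (intro path_meets) auto
  have "resolvent_nn lam g y = (\<integral>\<^sup>+\<omega>\<in>A. occupation lam g \<omega> \<partial>P y)"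
    unfolding resolvent_nn_def
  proof (intro nn_integral_cong_AE)
    show "AE \<omega> in P y. occupation lam g \<omega> = occupation lam g \<omega> * indicator A \<omega>"
      using AE_start[OF y] AE_space
    proof eventually_elim
      case (elim \<omega>)
      then have \<omega>: "\<omega> \<in> space \<Omega>" by (simp add: space_P[OF y])
      show ?case
      proof (cases "\<omega> \<in> A")
        case False
        then have "g (Y t \<omega>) = 0" if "t \<ge> 0" for t
          using le[OF \<omega> elim(1) that] \<omega> le_less_trans[of "?T \<omega>" "ennreal t" \<infinity>] by (auto simp: A_def)
        then have "occupation lam g \<omega> = 0" by (rule occupation_eq_0)
        then show ?thesis using False by simp
      qed simp
    qed
  qed
  also have "\<dots> = (\<integral>\<^sup>+\<omega>\<in>A. discount lam (?T \<omega>) \<partial>P y) * resolvent_nn lam g z"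
  proof (rule occupation_strong_markov[OF y z A])
    fix \<omega> t assume "\<omega> \<in> A" "X 0 \<omega> = y" "0 \<le> t" "ennreal t < ?T \<omega>"
    then show "g (Y t \<omega>) = 0"
      by (intro ccontr[of "g (Y t \<omega>) = 0"]) (use le[of \<omega> t] leD in \<open>auto simp: A_def\<close>)
  qed (auto simp: A_def)
  \<comment> \<open>Adding the paths that never reach \<open>z\<close> changes nothing, since their
    discount is 0.\<close>
  also have "(\<integral>\<^sup>+\<omega>\<in>A. discount lam (?T \<omega>) \<partial>P y) = hitting_discount lam z y"
    unfolding hitting_discount_def
    by (intro nn_integral_cong) (auto simp: A_def space_P[OF y] top.not_eq_extremum[symmetric] split: split_indicator)
  finally show ?thesis .
qed

lemma resolvent_nn_two_barriers:
  assumes a: "a \<in> I" and b: "b \<in> I" and ab: "a < x" "x < b" and [measurable]: "g \<in> borel_measurable borel"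
    and zero: "\<And>u. a < u \<Longrightarrow> u < b \<Longrightarrow> g u = 0"
  shows "resolvent_nn lam g x =
    (\<integral>\<^sup>+\<omega>\<in>{\<omega> \<in> space \<Omega>. H a \<omega> < H b \<omega>}. discount lam (H a \<omega>) \<partial>P x) * resolvent_nn lam g a +
    (\<integral>\<^sup>+\<omega>\<in>{\<omega> \<in> space \<Omega>. H a \<omega> > H b \<omega>}. discount lam (H b \<omega>) \<partial>P x) * resolvent_nn lam g b"
proof -
  let ?a = "H a" and ?b = "H b"
  define A where "A = {\<omega> \<in> space \<Omega>. ?a \<omega> < ?b \<omega>}"
  define B where "B = {\<omega> \<in> space \<Omega>. ?b \<omega> < ?a \<omega>}"
  have x: "x \<in> I" using a b ab by (auto simp: einterval_def intro: less_trans ereal_less(2))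
      (metis ereal_less_eq(3) less_eq_real_def order.strict_trans1 order.strict_trans2)+
  have [simp, measurable_cong]: "sets (P x) = sets \<Omega>" using sets_P x by auto
  have A: "A \<in> sets (prehit a)" and B: "B \<in> sets (prehit b)"
    unfolding A_def B_def by (rule hitting_time_less_prehit)+
  have [measurable]: "A \<in> sets \<Omega>" "B \<in> sets \<Omega>" using A B sets_prehit_subset by auto
  have le: "min (?a \<omega>) (?b \<omega>) \<le> ennreal t" if "\<omega> \<in> space \<Omega>" "X 0 \<omega> = x" "t \<ge> 0" "g (Y t \<omega>) \<noteq> 0" for \<omega> t
  proof -
    consider "Y t \<omega> \<le> a" | "Y t \<omega> \<ge> b" using zero[of "Y t \<omega>"] \<open>g (Y t \<omega>) \<noteq> 0\<close> by force
    then show ?thesis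
    proof cases
      case 1
      then have "?a \<omega> \<le> ennreal t" using that ab by (intro path_meets) (auto simp: closed_segment_eq_real_ivl)
      then show ?thesis by (simp add: min_le_iff_disj)
    next
      case 2
      then have "?b \<omega> \<le> ennreal t" using that ab by (intro path_meets) (auto simp: closed_segment_eq_real_ivl)
      then show ?thesis by (simp add: min_le_iff_disj)
    qed
  qed
  have "resolvent_nn lam g x = (\<integral>\<^sup>+\<omega>. occupation lam g \<omega> * indicator A \<omega> + occupation lam g \<omega> * indicator B \<omega> \<partial>P x)"
    unfolding resolvent_nn_def
  proof (intro nn_integral_cong_AE)
    show "AE \<omega> in P x. occupation lam g \<omega> = occupation lam g \<omega> * indicator A \<omega> + occupation lam g \<omega> * indicator B \<omega>"
      using AE_start[OF x] AE_space
    proof eventually_elim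
      case (elim \<omega>)
      then have \<omega>: "\<omega> \<in> space \<Omega>" by (simp add: space_P[OF x])
      consider "?a \<omega> < ?b \<omega>" | "?b \<omega> < ?a \<omega>" | "?a \<omega> = ?b \<omega>" by force
      then show ?case
      proof cases
        \<comment> \<open>A path cannot be at \<open>a\<close> and \<open>b\<close> at once, so
          equal hitting times are both infinite. Such a path never leaves the open interval and
          contributes nothing.\<close>
        case 3
        have inf: "?a \<omega> = \<infinity>"
        proof (rule hitting_time_cases[OF \<omega>, of a])
          fix \<tau> assume \<tau>: "\<tau> \<ge> 0" "?a \<omega> = ennreal \<tau>" "Y \<tau> \<omega> = a"
          show ?thesis
          proof (rule hitting_time_cases[OF \<omega>, of b])
            fix \<tau>' assume "\<tau>' \<ge> 0" "?b \<omega> = ennreal \<tau>'" "Y \<tau>' \<omega> = b"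
            then show ?thesis using 3 \<tau> ab by simp
          qed (use 3 in auto)
        qed
        then have "g (Y t \<omega>) = 0" if "t \<ge> 0" for t
          using le[OF \<omega> elim(1) that] 3 by (auto simp: top_unique)
        then have "occupation lam g \<omega> = 0" by (rule occupation_eq_0)
        then show ?thesis by simp
      qed (use \<omega> in \<open>auto simp: A_def B_def\<close>)
    qed
  qed
  also have "\<dots> = (\<integral>\<^sup>+\<omega>\<in>A. occupation lam g \<omega> \<partial>P x) + (\<integral>\<^sup>+\<omega>\<in>B. occupation lam g \<omega> \<partial>P x)"
    by (rule nn_integral_add) measurable
  also have "(\<integral>\<^sup>+\<omega>\<in>A. occupation lam g \<omega> \<partial>P x) = (\<integral>\<^sup>+\<omega>\<in>A. discount lam (?a \<omega>) \<partial>P x) * resolvent_nn lam g a"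
  proof (rule occupation_strong_markov[OF x a A])
    fix \<omega> t assume "\<omega> \<in> A" "X 0 \<omega> = x" "0 \<le> t" "ennreal t < ?a \<omega>"
    then show "g (Y t \<omega>) = 0"
      by (intro ccontr[of "g (Y t \<omega>) = 0"]) (use le[of \<omega> t] leD in \<open>force simp: A_def min_def split: if_splits\<close>)
  qed (auto simp: A_def intro: order.strict_trans2)
  also have "(\<integral>\<^sup>+\<omega>\<in>B. occupation lam g \<omega> \<partial>P x) = (\<integral>\<^sup>+\<omega>\<in>B. discount lam (?b \<omega>) \<partial>P x) * resolvent_nn lam g b"
  proof (rule occupation_strong_markov[OF x b B])
    fix \<omega> t assume "\<omega> \<in> B" "X 0 \<omega> = x" "0 \<le> t" "ennreal t < ?b \<omega>"
    then show "g (Y t \<omega>) = 0"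
      by (intro ccontr[of "g (Y t \<omega>) = 0"]) (use le[of \<omega> t] leD in \<open>force simp: B_def min_def split: if_splits\<close>)
  qed (auto simp: B_def intro: order.strict_trans2)
  finally show ?thesis unfolding A_def B_def .
qed

end

section \<open>Resolvent\<close>

lemma nn_integral_exp_Ici:
  assumes "lam > 0"
  shows "(\<integral>\<^sup>+t\<in>{0..}. ennreal (exp (- lam * t)) \<partial>lborel) = ennreal (1 / lam)"
proof -
  interpret prob_space "density lborel (exponential_density lam)"
    using assms by (rule prob_space_exponential_density)
  have "1 = (\<integral>\<^sup>+t. ennreal (exponential_density lam t) \<partial>lborel)"
    using emeasure_space_1 by (simp add: emeasure_density)
  also have "\<dots> = (\<integral>\<^sup>+t. ennreal lam * (ennreal (exp (- lam * t)) * indicator {0..} t) \<partial>lborel)"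
    using assms by (intro nn_integral_cong)
      (auto simp: exponential_density_def ennreal_mult mult.commute split: split_indicator)
  also have "\<dots> = ennreal lam * (\<integral>\<^sup>+t\<in>{0..}. ennreal (exp (- lam * t)) \<partial>lborel)"
    by (intro nn_integral_cmult) measurable
  finally have e: "ennreal lam * (\<integral>\<^sup>+t\<in>{0..}. ennreal (exp (- lam * t)) \<partial>lborel) = 1" by simp
  have "ennreal (1 / lam) * (ennreal lam * (\<integral>\<^sup>+t\<in>{0..}. ennreal (exp (- lam * t)) \<partial>lborel)) =
    (\<integral>\<^sup>+t\<in>{0..}. ennreal (exp (- lam * t)) \<partial>lborel)"
    using assms by (simp add: mult.assoc[symmetric] ennreal_mult[symmetric])
  then show ?thesis using e by simp
qed

lemma tendsto_one_minus_exp_divide: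
  "((\<lambda>h. (1 - exp (- lam * h)) / h) \<longlongrightarrow> (lam::real)) (at_right 0)"
proof -
  have "((\<lambda>h. - exp (- lam * h)) has_real_derivative lam) (at 0)"
    by (auto intro!: derivative_eq_intros)
  then have "((\<lambda>h. (1 - exp (- lam * h)) / h) \<longlongrightarrow> lam) (at 0)" by (simp add: DERIV_def)
  then show ?thesis by (rule tendsto_mono[rotated]) (simp add: at_le)
qed

context regular_diffusion
begin

definition resolvent :: "real \<Rightarrow> (real \<Rightarrow> real) \<Rightarrow> real \<Rightarrow> real"
  where "resolvent lam g y = enn2real (resolvent_nn lam g y)"

lemma occupation_le:
  assumes "lam > 0" "\<And>x. g x \<le> 1"
  shows "occupation lam g \<omega> \<le> ennreal (1 / lam)"
proof -
  have "occupation lam g \<omega> \<le> (\<integral>\<^sup>+t\<in>{0..}. ennreal (exp (- lam * t)) \<partial>lborel)"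
    unfolding occupation_def using assms(2)
    by (intro nn_integral_mono) (auto split: split_indicator intro!: ennreal_leI mult_left_le)
  then show ?thesis using nn_integral_exp_Ici assms(1) by simp
qed

lemma resolvent_nn_le:
  assumes "lam > 0" "y \<in> I" "\<And>x. g x \<le> 1"
  shows "resolvent_nn lam g y \<le> ennreal (1 / lam)"
proof -
  interpret prob_space "P y" using prob_space_P assms by simp
  have "resolvent_nn lam g y \<le> (\<integral>\<^sup>+\<omega>. ennreal (1 / lam) \<partial>P y)"
    unfolding resolvent_nn_def by (intro nn_integral_mono occupation_le assms)
  then show ?thesis by (simp add: emeasure_space_1)
qed

lemma ennreal_resolvent:
  assumes "lam > 0" "y \<in> I" "\<And>x. g x \<le> 1"
  shows "ennreal (resolvent lam g y) = resolvent_nn lam g y"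
  unfolding resolvent_def
  by (intro ennreal_enn2real le_less_trans[OF resolvent_nn_le[of lam y g, OF assms]]) simp

lemma resolvent_nonneg: "0 \<le> resolvent lam g y"
  by (simp add: resolvent_def)

lemma resolvent_le:
  assumes "lam > 0" "y \<in> I" "\<And>x. g x \<le> 1"
  shows "resolvent lam g y \<le> 1 / lam"
  using resolvent_nn_le[of lam y g, OF assms] assms(1)
  unfolding ennreal_resolvent[of lam y g, OF assms, symmetric] by (simp add: ennreal_le_iff)

text \<open>The total discounted time is \<open>1 / lam\<close>. Through this reflection a one-sided
  estimate for \<open>1 - g\<close> becomes the opposite estimate for \<open>g\<close>, and the
  transform of the distribution function at \<open>b\<close> turns into the resolvent of the half
  line beyond \<open>b\<close>.\<close>

lemma resolvent_complement:
  assumes lam: "lam > 0" and y: "y \<in> I" and g [measurable]: "g \<in> borel_measurable borel"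
    and g01: "\<And>x. 0 \<le> g x" "\<And>x. g x \<le> 1"
  shows "resolvent lam (\<lambda>x. 1 - g x) y = 1 / lam - resolvent lam g y"
proof -
  interpret prob_space "P y" using prob_space_P y .
  have [simp, measurable_cong]: "sets (P y) = sets \<Omega>" using sets_P y by auto
  have "occupation lam g \<omega> + occupation lam (\<lambda>x. 1 - g x) \<omega> = ennreal (1 / lam)" if \<omega>: "\<omega> \<in> space \<Omega>" for \<omega>
  proof -
    have [measurable]: "(\<lambda>t. Y t \<omega>) \<in> borel_measurable borel"
      using \<omega> by (intro borel_measurable_continuous_onI continuous_Y)
    have "occupation lam g \<omega> + occupation lam (\<lambda>x. 1 - g x) \<omega> =
      (\<integral>\<^sup>+t. ennreal (exp (- lam * t) * g (Y t \<omega>)) * indicator {0..} t +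
         ennreal (exp (- lam * t) * (1 - g (Y t \<omega>))) * indicator {0..} t \<partial>lborel)"
      unfolding occupation_def by (rule nn_integral_add[symmetric]) measurable
    also have "\<dots> = (\<integral>\<^sup>+t\<in>{0..}. ennreal (exp (- lam * t)) \<partial>lborel)"
      using g01 by (intro nn_integral_cong)
        (auto simp: ennreal_plus[symmetric] algebra_simps simp del: ennreal_plus split: split_indicator)
    finally show ?thesis using nn_integral_exp_Ici lam by simp
  qed
  then have "(\<integral>\<^sup>+\<omega>. occupation lam g \<omega> + occupation lam (\<lambda>x. 1 - g x) \<omega> \<partial>P y) = (\<integral>\<^sup>+\<omega>. ennreal (1 / lam) \<partial>P y)"
    by (intro nn_integral_cong) (simp add: space_P[OF y])
  then have "resolvent_nn lam g y + resolvent_nn lam (\<lambda>x. 1 - g x) y = ennreal (1 / lam)"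
    unfolding resolvent_nn_def by (subst (asm) nn_integral_add) (auto simp: emeasure_space_1)
  then have "ennreal (resolvent lam g y + resolvent lam (\<lambda>x. 1 - g x) y) = ennreal (1 / lam)"
    using lam y g01 by (subst ennreal_plus) (auto simp: ennreal_resolvent resolvent_nonneg)
  then have "resolvent lam g y + resolvent lam (\<lambda>x. 1 - g x) y = 1 / lam"
    using lam by (subst (asm) ennreal_inj) (auto simp: resolvent_nonneg)
  then show ?thesis by simp
qed

text \<open>The simple Markov property, as the strong one at a constant stopping time.\<close>

lemma markov_emeasure:
  assumes y: "y \<in> I" and h: "0 \<le> h" and t: "0 \<le> t" and C: "C \<in> sets borel"
  shows "emeasure (P y) {\<omega> \<in> space \<Omega>. Y (h + t) \<omega> \<in> C} =
    (\<integral>\<^sup>+\<omega>. emeasure (P (Y h \<omega>)) {\<omega>' \<in> space \<Omega>. Y t \<omega>' \<in> C} \<partial>P y)"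
proof -
  interpret filtration "space \<Omega>" "natural_filtration \<Omega> X" by (rule filtration_natural)
  have top: "space \<Omega> \<in> sets (pre_sigma (\<lambda>_. ennreal h))"
    using sets.top[of "pre_sigma (\<lambda>_. ennreal h)"] by (simp add: space_pre_sigma)
  have "emeasure (P y) {\<omega> \<in> space \<Omega>. Y (h + t) \<omega> \<in> C} = (\<integral>\<^sup>+\<omega>\<in>space \<Omega>. emeasure (P (Y h \<omega>)) {\<omega>' \<in> space \<Omega>. Y t \<omega>' \<in> C} \<partial>P y)"
    using strong_markov_coordinate[OF stopping_time_const y top t C] h by simp
  also have "\<dots> = (\<integral>\<^sup>+\<omega>. emeasure (P (Y h \<omega>)) {\<omega>' \<in> space \<Omega>. Y t \<omega>' \<in> C} \<partial>P y)"
    by (intro nn_integral_cong) (simp add: space_P[OF y])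
  finally show ?thesis .
qed

lemma P_Y_measurable: "(\<lambda>\<omega>. P (Y h \<omega>)) \<in> \<Omega> \<rightarrow>\<^sub>M prob_algebra \<Omega>"
proof (rule measurable_compose[OF _ kernel])
  show "Y h \<in> \<Omega> \<rightarrow>\<^sub>M restrict_space borel I"
    by (rule measurable_restrict_space2) (auto intro: Y_in_I)
qed

lemma resolvent_nn_Y_measurable [measurable]:
  assumes [measurable]: "g \<in> borel_measurable borel"
  shows "(\<lambda>\<omega>. resolvent_nn lam g (Y h \<omega>)) \<in> borel_measurable \<Omega>"
  unfolding resolvent_nn_def
  by (rule nn_integral_measurable_subprob_algebra2[OF _ measurable_prob_algebraD[OF P_Y_measurable]]) measurable

text \<open>The left side is the expected occupation under the mixture \<open>Q\<close> of the laws
  \<open>P (Y h \<omega>)\<close>. By the Markov property \<open>Q\<close> has at each time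
  \<open>t\<close> the one-dimensional law that \<open>P y\<close> has at \<open>h + t\<close>, and
  the occupation integral depends on one-dimensional laws only.\<close>

lemma markov_resolvent_nn:
  assumes y: "y \<in> I" and h: "0 \<le> h" and [measurable]: "g \<in> borel_measurable borel"
  shows "(\<integral>\<^sup>+\<omega>. resolvent_nn lam g (Y h \<omega>) \<partial>P y) =
    (\<integral>\<^sup>+t\<in>{0..}. (\<integral>\<^sup>+\<omega>. ennreal (exp (- lam * t) * g (Y (h + t) \<omega>)) \<partial>P y) \<partial>lborel)"
proof -
  interpret y: prob_space "P y" using prob_space_P y .
  have [simp, measurable_cong]: "sets (P y) = sets \<Omega>" using sets_P y by auto
  define Q where "Q = P y \<bind> (\<lambda>\<omega>. P (Y h \<omega>))"
  have K: "(\<lambda>\<omega>. P (Y h \<omega>)) \<in> P y \<rightarrow>\<^sub>M prob_algebra \<Omega>"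
    using P_Y_measurable by (simp add: measurable_P[OF y])
  note K' = measurable_prob_algebraD[OF K]
  have [simp, measurable_cong]: "sets Q = sets \<Omega>"
    unfolding Q_def using K' y.not_empty by (rule sets_bind_measurable)
  interpret Q: prob_space Q
    unfolding Q_def
    by (rule y.prob_space_bind[OF AE_I2 K']) (simp add: prob_space_P Y_in_I space_P[OF y])
  have distr: "distr Q borel (Y t) = distr (P y) borel (Y (h + t))" if t: "t \<ge> 0" for t
  proof (rule measure_eqI)
    fix C assume "C \<in> sets (distr Q borel (Y t))"
    then have [measurable]: "C \<in> sets borel" by simp
    have "emeasure (distr Q borel (Y t)) C = emeasure Q {\<omega> \<in> space \<Omega>. Y t \<omega> \<in> C}"
      by (subst emeasure_distr) (auto intro!: arg_cong[where f="emeasure Q"] dest: sets_eq_imp_space_eq[OF \<open>sets Q = sets \<Omega>\<close>, THEN equalityD1, THEN subsetD] simp: sets_eq_imp_space_eq[OF \<open>sets Q = sets \<Omega>\<close>])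
    also have "\<dots> = (\<integral>\<^sup>+\<omega>. emeasure (P (Y h \<omega>)) {\<omega>' \<in> space \<Omega>. Y t \<omega>' \<in> C} \<partial>P y)"
      unfolding Q_def by (rule emeasure_bind[OF y.not_empty K']) measurable
    also have "\<dots> = emeasure (P y) {\<omega> \<in> space \<Omega>. Y (h + t) \<omega> \<in> C}"
      by (rule markov_emeasure[OF y h t, symmetric]) measurable
    also have "\<dots> = emeasure (distr (P y) borel (Y (h + t))) C"
      by (subst emeasure_distr) (auto intro!: arg_cong[where f="emeasure (P y)"] simp: space_P[OF y])
    finally show "emeasure (distr Q borel (Y t)) C = emeasure (distr (P y) borel (Y (h + t))) C" .
  qed simp
  have "(\<integral>\<^sup>+\<omega>. resolvent_nn lam g (Y h \<omega>) \<partial>P y) = (\<integral>\<^sup>+\<omega>. occupation lam g \<omega> \<partial>Q)"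
    unfolding Q_def resolvent_nn_def by (rule nn_integral_bind[OF _ K', symmetric]) measurable
  also have "\<dots> = (\<integral>\<^sup>+t\<in>{0..}. (\<integral>\<^sup>+\<omega>. ennreal (exp (- lam * t) * g (Y t \<omega>)) \<partial>Q) \<partial>lborel)"
    by (rule nn_integral_occupation) (auto intro: Q.sigma_finite_measure_axioms)
  also have "\<dots> = (\<integral>\<^sup>+t\<in>{0..}. (\<integral>\<^sup>+\<omega>. ennreal (exp (- lam * t) * g (Y (h + t) \<omega>)) \<partial>P y) \<partial>lborel)"
  proof (intro nn_integral_cong)
    fix t
    have "(\<integral>\<^sup>+\<omega>. ennreal (exp (- lam * t) * g (Y t \<omega>)) \<partial>Q) = (\<integral>\<^sup>+x. ennreal (exp (- lam * t) * g x) \<partial>distr Q borel (Y t))"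
      by (subst nn_integral_distr) auto
    moreover have "(\<integral>\<^sup>+\<omega>. ennreal (exp (- lam * t) * g (Y (h + t) \<omega>)) \<partial>P y) = (\<integral>\<^sup>+x. ennreal (exp (- lam * t) * g x) \<partial>distr (P y) borel (Y (h + t)))"
      by (subst nn_integral_distr) auto
    ultimately show "(\<integral>\<^sup>+\<omega>. ennreal (exp (- lam * t) * g (Y t \<omega>)) \<partial>Q) * indicator {0..} t =
      (\<integral>\<^sup>+\<omega>. ennreal (exp (- lam * t) * g (Y (h + t) \<omega>)) \<partial>P y) * indicator {0..} t"
      using distr[of t] by (simp split: split_indicator)
  qed
  finally show ?thesis .
qed

text \<open>Splitting the time integral at \<open>h\<close>: the part before contributes at most
  \<open>h * G\<close>, the part after is the discounted resolvent from the new position. Only this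
  direction is proved; the opposite bounds come from \<open>resolvent_complement\<close>.\<close>

lemma resolvent_step:
  assumes lam: "lam > 0" and y: "y \<in> I" and h: "0 \<le> h" and g [measurable]: "g \<in> borel_measurable borel"
    and g01: "\<And>x. 0 \<le> g x" "\<And>x. g x \<le> 1"
    and G: "\<And>t. 0 \<le> t \<Longrightarrow> t < h \<Longrightarrow> (\<integral>\<omega>. g (Y t \<omega>) \<partial>P y) \<le> G" "G \<ge> 0"
  shows "resolvent lam g y \<le> h * G + exp (- lam * h) * (\<integral>\<omega>. resolvent lam g (Y h \<omega>) \<partial>P y)"
proof -
  interpret y: prob_space "P y" using prob_space_P y .
  have [simp, measurable_cong]: "sets (P y) = sets \<Omega>" using sets_P y by auto
  let ?e = "\<lambda>t. \<integral>\<^sup>+\<omega>. ennreal (exp (- lam * t) * g (Y t \<omega>)) \<partial>P y"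
  have eG: "?e t \<le> ennreal G" if t: "0 \<le> t" "t < h" for t
  proof -
    have "?e t \<le> (\<integral>\<^sup>+\<omega>. ennreal (g (Y t \<omega>)) \<partial>P y)"
      using g01 t lam by (intro nn_integral_mono ennreal_leI mult_left_le_one_le) auto
    also have "\<dots> = ennreal (\<integral>\<omega>. g (Y t \<omega>) \<partial>P y)"
      using g01 by (intro nn_integral_eq_integral y.integrable_const_bound[where B=1]) auto
    also have "\<dots> \<le> ennreal G" using G t by (intro ennreal_leI) auto
    finally show ?thesis .
  qed
  have "resolvent_nn lam g y = (\<integral>\<^sup>+t. ?e t * indicator {0..<h} t + ?e t * indicator {h..} t \<partial>lborel)"
    unfolding resolvent_nn_eq[OF y g] using h by (intro nn_integral_cong) (auto split: split_indicator)
  also have "\<dots> = (\<integral>\<^sup>+t\<in>{0..<h}. ?e t \<partial>lborel) + (\<integral>\<^sup>+t\<in>{h..}. ?e t \<partial>lborel)"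
    by (rule nn_integral_add) measurable
  also have "(\<integral>\<^sup>+t\<in>{0..<h}. ?e t \<partial>lborel) \<le> (\<integral>\<^sup>+t. ennreal G * indicator {0..<h} t \<partial>lborel)"
    using eG by (intro nn_integral_mono) (auto split: split_indicator)
  also have "\<dots> = ennreal (h * G)"
    using h G(2) by (subst nn_integral_cmult_indicator) (auto simp: ennreal_mult mult.commute)
  also have "(\<integral>\<^sup>+t\<in>{h..}. ?e t \<partial>lborel) = (\<integral>\<^sup>+t\<in>{0..}. ?e (h + t) \<partial>lborel)"
    by (rule nn_integral_shift) measurable
  also have "\<dots> = (\<integral>\<^sup>+t. ennreal (exp (- lam * h)) * ((\<integral>\<^sup>+\<omega>. ennreal (exp (- lam * t) * g (Y (h + t) \<omega>)) \<partial>P y) * indicator {0..} t) \<partial>lborel)"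
  proof (intro nn_integral_cong)
    fix t
    have "?e (h + t) = (\<integral>\<^sup>+\<omega>. ennreal (exp (- lam * h)) * ennreal (exp (- lam * t) * g (Y (h + t) \<omega>)) \<partial>P y)"
      using g01 by (intro nn_integral_cong)
        (simp add: ennreal_mult[symmetric] mult.assoc[symmetric] exp_add[symmetric] algebra_simps)
    also have "\<dots> = ennreal (exp (- lam * h)) * (\<integral>\<^sup>+\<omega>. ennreal (exp (- lam * t) * g (Y (h + t) \<omega>)) \<partial>P y)"
      by (rule nn_integral_cmult) measurable
    finally show "?e (h + t) * indicator {0..} t = ennreal (exp (- lam * h)) *
      ((\<integral>\<^sup>+\<omega>. ennreal (exp (- lam * t) * g (Y (h + t) \<omega>)) \<partial>P y) * indicator {0..} t)" by (simp add: mult.assoc)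
  qed
  also have "\<dots> = ennreal (exp (- lam * h)) * (\<integral>\<^sup>+\<omega>. resolvent_nn lam g (Y h \<omega>) \<partial>P y)"
    unfolding markov_resolvent_nn[OF y h g] by (rule nn_integral_cmult) measurable
  also have "(\<integral>\<^sup>+\<omega>. resolvent_nn lam g (Y h \<omega>) \<partial>P y) = (\<integral>\<^sup>+\<omega>. ennreal (resolvent lam g (Y h \<omega>)) \<partial>P y)"
    using lam g01 by (intro nn_integral_cong) (auto simp: ennreal_resolvent space_P[OF y] Y_in_I)
  also have "\<dots> = ennreal (\<integral>\<omega>. resolvent lam g (Y h \<omega>) \<partial>P y)"
  proof (intro nn_integral_eq_integral y.integrable_const_bound[where B="1 / lam"])
    show "(\<lambda>\<omega>. resolvent lam g (Y h \<omega>)) \<in> borel_measurable (P y)"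
      unfolding resolvent_def by measurable
  qed (use lam g01 in \<open>auto intro!: AE_I2 resolvent_le Y_in_I simp: resolvent_nonneg space_P[OF y]\<close>)
  finally have le: "resolvent_nn lam g y \<le>
    ennreal (h * G) + ennreal (exp (- lam * h)) * ennreal (\<integral>\<omega>. resolvent lam g (Y h \<omega>) \<partial>P y)"
    by (simp add: add_right_mono)
  define E where "E = (\<integral>\<omega>. resolvent lam g (Y h \<omega>) \<partial>P y)"
  have "E \<ge> 0" unfolding E_def by (intro Bochner_Integration.integral_nonneg resolvent_nonneg)
  then have nn: "exp (- lam * h) * E \<ge> 0" "h * G \<ge> 0" using h G(2) by auto
  have "ennreal (resolvent lam g y) \<le> ennreal (h * G + exp (- lam * h) * E)"
    using le ennreal_plus[OF nn(2,1)] ennreal_mult[OF _ \<open>E \<ge> 0\<close>, of "exp (- lam * h)"] lam y g01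
    by (simp add: ennreal_resolvent E_def)
  then show ?thesis
    using nn unfolding E_def by (subst (asm) ennreal_le_iff) auto
qed

end

section \<open>Maximum principle\<close>

context regular_diffusion
begin

text \<open>For small \<open>t\<close> a displacement beyond \<open>e / 2\<close> has probability
  below \<open>t\<close>, as \<open>no_jumps\<close> even makes it of smaller order. On that event
  \<open>g\<close> is at most 1, elsewhere continuity keeps it below
  \<open>g y + \<epsilon> / 2\<close>.\<close>

lemma expectation_le_near_start:
  fixes g :: "real \<Rightarrow> real"
  assumes y: "y \<in> I" and g [measurable]: "g \<in> borel_measurable borel"
    and g01: "\<And>x. 0 \<le> g x" "\<And>x. g x \<le> 1" and cont: "isCont g y" and \<epsilon>: "\<epsilon> > 0"
  shows "\<exists>\<delta>>0. \<forall>t. 0 \<le> t \<longrightarrow> t < \<delta> \<longrightarrow> (\<integral>\<omega>. g (Y t \<omega>) \<partial>P y) \<le> g y + \<epsilon>"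
proof -
  interpret y: prob_space "P y" using prob_space_P y .
  have [simp, measurable_cong]: "sets (P y) = sets \<Omega>" using sets_P y by auto
  obtain e where e: "e > 0" "\<And>x. dist x y < e \<Longrightarrow> dist (g x) (g y) < \<epsilon> / 2"
    using cont \<epsilon> unfolding continuous_at_eps_delta by (metis half_gt_zero)
  have "\<forall>\<^sub>F h in at_right 0. measure (P y) {\<omega> \<in> space \<Omega>. \<bar>X h \<omega> - y\<bar> > e / 2} / h < 1"
    using order_tendstoD(2)[OF no_jumps[OF y, of "e / 2"], of 1] e by simp
  then obtain d where d: "d > 0" "\<And>h. 0 < h \<Longrightarrow> h < d \<Longrightarrow> measure (P y) {\<omega> \<in> space \<Omega>. \<bar>X h \<omega> - y\<bar> > e / 2} / h < 1"
    unfolding eventually_at_right_field by auto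
  show ?thesis
  proof (intro exI[of _ "min d (\<epsilon> / 2)"] conjI allI impI)
    fix t assume t: "0 \<le> t" "t < min d (\<epsilon> / 2)"
    define A where "A = {\<omega> \<in> space \<Omega>. \<bar>Y t \<omega> - y\<bar> > e / 2}"
    have mA [measurable]: "A \<in> sets (P y)" unfolding A_def by measurable
    have iA: "integrable (P y) (indicator A :: 'w \<Rightarrow> real)"
      by (intro y.integrable_const_bound[where B=1]) auto
    have pA: "y.prob A \<le> t"
    \<comment> \<open>\<open>no_jumps\<close> speaks of positive times only; at time 0 the starting
      condition takes its place.\<close>
    proof (cases "t = 0")
      case True
      have "AE \<omega> in P y. \<omega> \<notin> A"
        using AE_start[OF y] by eventually_elim (use e True in \<open>auto simp: A_def Y_eq\<close>)
      then have "y.prob A = 0" using y.prob_eq_0[OF mA] by simp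
      then show ?thesis using t by simp
    next
      case False
      then have "measure (P y) {\<omega> \<in> space \<Omega>. \<bar>X t \<omega> - y\<bar> > e / 2} / t < 1" using t d(2) by auto
      then show ?thesis using False t by (simp add: A_def Y_eq field_simps)
    qed
    have "(\<integral>\<omega>. g (Y t \<omega>) \<partial>P y) \<le> (\<integral>\<omega>. (g y + \<epsilon> / 2) + indicator A \<omega> \<partial>P y)"
    proof (intro integral_mono)
      show "integrable (P y) (\<lambda>\<omega>. g (Y t \<omega>))" using g01 by (intro y.integrable_const_bound[where B=1]) auto
      fix \<omega> assume "\<omega> \<in> space (P y)"
      then have \<omega>: "\<omega> \<in> space \<Omega>" by (simp add: space_P[OF y])
      show "g (Y t \<omega>) \<le> g y + \<epsilon> / 2 + indicator A \<omega>"
      proof (cases "\<omega> \<in> A")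
        case True
        then show ?thesis using g01(1)[of y] g01(2)[of "Y t \<omega>"] \<epsilon> by simp
      next
        case False
        then have "dist (g (Y t \<omega>)) (g y) < \<epsilon> / 2" using \<omega> e(1) by (intro e(2)) (auto simp: A_def dist_real_def)
        then have "g (Y t \<omega>) - g y < \<epsilon> / 2" unfolding dist_real_def by linarith
        then show ?thesis using False by simp
      qed
    qed (use iA in auto)
    also have "\<dots> = g y + \<epsilon> / 2 + y.prob A"
      using iA sets.Int_space_eq2[OF mA] by (subst Bochner_Integration.integral_add) (auto simp: y.prob_space)
    also have "\<dots> \<le> g y + \<epsilon>" using pA t by simp
    finally show "(\<integral>\<omega>. g (Y t \<omega>) \<partial>P y) \<le> g y + \<epsilon>" .
  qed (use d \<epsilon> in auto)
qed

text \<open>The resolvent solves \<open>(lam - L) u = g\<close> in the viscosity sense: only the pointwise limits of the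
  infinitesimal moments at the touching point enter, so no uniformity in them is required.\<close>

lemma resolvent_touching_above:
  assumes lam: "lam > 0" and y: "y \<in> I" and g [measurable]: "g \<in> borel_measurable borel"
    and g01: "\<And>x. 0 \<le> g x" "\<And>x. g x \<le> 1" and cont: "isCont g y"
    and w: "\<forall>\<^sub>F x in nhds y. (w has_real_derivative w' x) (at x)" "(w' has_real_derivative w'') (at y)"
    and touch: "\<forall>\<^sub>F x in nhds y. resolvent lam g x - w x \<le> resolvent lam g y - w y"
  shows "lam * resolvent lam g y \<le> g y + (1/2 * \<sigma> y * w'' + \<mu> y * w' y)"
proof -
  interpret y: prob_space "P y" using prob_space_P y .
  have [simp, measurable_cong]: "sets (P y) = sets \<Omega>" using sets_P y by auto
  define u where "u = resolvent lam g"
  have u0: "0 \<le> u x" for x by (simp add: u_def resolvent_nonneg)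
  have u1: "x \<in> I \<Longrightarrow> u x \<le> 1 / lam" for x unfolding u_def using lam g01 by (intro resolvent_le)
  have \<sigma>: "\<sigma> y > 0" using coefficients y by auto
  \<comment> \<open>The slack \<open>\<eta>\<close> is spent twice: on the expectation of
    \<open>g\<close> at small times, and on the Taylor error, whose contribution is multiplied by
    the variance \<open>\<sigma> y\<close>.\<close>
  have main: "lam * u y \<le> g y + (1/2 * \<sigma> y * w'' + \<mu> y * w' y) + \<eta> * (1 + \<sigma> y)" if \<eta>: "\<eta> > 0" for \<eta>
  proof -
    have "\<forall>\<^sub>F x in nhds y. u x \<le> u y + w' y * (x - y) + (w'' / 2 + \<eta>) * (x - y)\<^sup>2"
      using touch taylor_second_order[OF w \<eta>] unfolding u_def
      by eventually_elim (simp add: algebra_simps abs_le_iff)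
    then obtain e' where e': "e' > 0" "\<And>x. dist x y < e' \<Longrightarrow> u x \<le> u y + w' y * (x - y) + (w'' / 2 + \<eta>) * (x - y)\<^sup>2"
      unfolding eventually_nhds_metric by auto
    define e where "e = e' / 2"
    have e: "e > 0" "\<And>x. \<bar>x - y\<bar> \<le> e \<Longrightarrow> u x \<le> u y + w' y * (x - y) + (w'' / 2 + \<eta>) * (x - y)\<^sup>2"
      using e' by (auto simp: e_def dist_real_def)
    obtain \<delta> where \<delta>: "\<delta> > 0" "\<And>t. 0 \<le> t \<Longrightarrow> t < \<delta> \<Longrightarrow> (\<integral>\<omega>. g (Y t \<omega>) \<partial>P y) \<le> g y + \<eta>"
      using expectation_le_near_start[OF y g g01 cont \<eta>] by auto
    define p where "p = (\<lambda>h. measure (P y) {\<omega> \<in> space \<Omega>. \<bar>X h \<omega> - y\<bar> > e})"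
    define m1 where "m1 = (\<lambda>h. (\<integral>\<omega>. (X h \<omega> - y) * indicator {-e..e} (X h \<omega> - y) \<partial>P y))"
    define m2 where "m2 = (\<lambda>h. (\<integral>\<omega>. (X h \<omega> - y)\<^sup>2 * indicator {-e..e} (X h \<omega> - y) \<partial>P y))"
    have step: "u y * ((1 - exp (- lam * h)) / h) \<le>
      (g y + \<eta>) + exp (- lam * h) * (w' y * (m1 h / h) + (w'' / 2 + \<eta>) * (m2 h / h) + 1 / lam * (p h / h))"
      if h: "0 < h" "h < \<delta>" for h
    proof -
      define A where "A = {\<omega> \<in> space \<Omega>. \<bar>Y h \<omega> - y\<bar> > e}"
      have mA [measurable]: "A \<in> sets (P y)" unfolding A_def by measurable
      have iA: "integrable (P y) (indicator A :: 'w \<Rightarrow> real)"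
        by (intro y.integrable_const_bound[where B=1]) auto
      have pA: "p h = y.prob A" unfolding p_def A_def using h by (simp add: Y_eq)
      define D where "D = (\<lambda>\<omega>. Y h \<omega> - y)"
      have [measurable]: "D \<in> borel_measurable (P y)" unfolding D_def using y by measurable
      let ?i = "\<lambda>\<omega>. indicator {-e..e} (D \<omega>) :: real"
      have i1: "integrable (P y) (\<lambda>\<omega>. D \<omega> * ?i \<omega>)"
        using e(1) by (intro y.integrable_const_bound[where B=e]) (auto split: split_indicator)
      have i2: "integrable (P y) (\<lambda>\<omega>. (D \<omega>)\<^sup>2 * ?i \<omega>)"
      proof (intro y.integrable_const_bound[where B="e\<^sup>2"] AE_I2)
        show "norm ((D \<omega>)\<^sup>2 * ?i \<omega>) \<le> e\<^sup>2" for \<omega>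
          using e(1) by (auto split: split_indicator simp: abs_le_square_iff[symmetric])
      qed auto
      have m: "m1 h = (\<integral>\<omega>. D \<omega> * ?i \<omega> \<partial>P y)" "m2 h = (\<integral>\<omega>. (D \<omega>)\<^sup>2 * ?i \<omega> \<partial>P y)"
        unfolding m1_def m2_def D_def using h by (simp_all add: Y_eq)
      \<comment> \<open>Within distance \<open>e\<close> of \<open>y\<close> the quadratic majorant
        from the touching condition applies, and its expectation consists of truncated moments.
        Beyond that distance only the crude bound \<open>1 / lam\<close> is known, but the
        probability is of smaller order than \<open>h\<close>.\<close>
      have "(\<integral>\<omega>. u (Y h \<omega>) \<partial>P y) \<le> (\<integral>\<omega>. u y + (w' y * (D \<omega> * ?i \<omega>) + (w'' / 2 + \<eta>) * ((D \<omega>)\<^sup>2 * ?i \<omega>)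
          + 1 / lam * indicator A \<omega>) \<partial>P y)"
      proof (intro integral_mono)
        show "integrable (P y) (\<lambda>\<omega>. u (Y h \<omega>))"
        proof (rule y.integrable_const_bound[where B="1 / lam"])
          show "(\<lambda>\<omega>. u (Y h \<omega>)) \<in> borel_measurable (P y)"
            unfolding u_def resolvent_def by measurable
        qed (auto intro!: AE_I2 u1 Y_in_I simp: u0 space_P[OF y])
        show "integrable (P y) (\<lambda>\<omega>. u y + (w' y * (D \<omega> * ?i \<omega>) + (w'' / 2 + \<eta>) * ((D \<omega>)\<^sup>2 * ?i \<omega>)
          + 1 / lam * indicator A \<omega>))"
          using i1 i2 iA by (intro Bochner_Integration.integrable_add integrable_mult_right) auto
        fix \<omega> assume "\<omega> \<in> space (P y)"
        then have \<omega>: "\<omega> \<in> space \<Omega>" by (simp add: space_P[OF y])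
        show "u (Y h \<omega>) \<le> u y + (w' y * (D \<omega> * ?i \<omega>) + (w'' / 2 + \<eta>) * ((D \<omega>)\<^sup>2 * ?i \<omega>)
          + 1 / lam * indicator A \<omega>)"
        proof (cases "\<omega> \<in> A")
          case True
          then have "D \<omega> \<notin> {-e..e}" by (auto simp: A_def D_def)
          then show ?thesis using True u1[OF Y_in_I[OF \<omega>], of h] u0[of y] by simp
        next
          case False
          then have "\<bar>D \<omega>\<bar> \<le> e" using \<omega> by (auto simp: A_def D_def)
          then have "D \<omega> \<in> {-e..e}" by auto
          then show ?thesis using False e(2)[of "Y h \<omega>"] \<open>\<bar>D \<omega>\<bar> \<le> e\<close> by (simp add: D_def add.assoc)
        qed
      qed
      also have "\<dots> = u y + (w' y * m1 h + (w'' / 2 + \<eta>) * m2 h + 1 / lam * p h)"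
        unfolding m pA using i1 i2 iA sets.Int_space_eq2[OF mA] by (simp add: y.prob_space)
      finally have le: "(\<integral>\<omega>. u (Y h \<omega>) \<partial>P y) \<le> u y + (w' y * m1 h + (w'' / 2 + \<eta>) * m2 h + 1 / lam * p h)" .
      have "u y \<le> h * (g y + \<eta>) + exp (- lam * h) * (\<integral>\<omega>. u (Y h \<omega>) \<partial>P y)"
        unfolding u_def using h \<delta>(2) g01(1)[of y] \<eta> by (intro resolvent_step lam y g g01) auto
      also have "\<dots> \<le> h * (g y + \<eta>) + exp (- lam * h) * (u y + (w' y * m1 h + (w'' / 2 + \<eta>) * m2 h + 1 / lam * p h))"
        by (intro add_left_mono mult_left_mono le) auto
      finally have "u y * (1 - exp (- lam * h)) \<le> h * (g y + \<eta>) + exp (- lam * h) * (w' y * m1 h + (w'' / 2 + \<eta>) * m2 h + 1 / lam * p h)"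
        by (simp add: algebra_simps)
      then have "u y * (1 - exp (- lam * h)) / h \<le> (h * (g y + \<eta>) + exp (- lam * h) * (w' y * m1 h + (w'' / 2 + \<eta>) * m2 h + 1 / lam * p h)) / h"
        using h by (intro divide_right_mono) auto
      also have "\<dots> = (g y + \<eta>) + exp (- lam * h) * (w' y * (m1 h / h) + (w'' / 2 + \<eta>) * (m2 h / h) + 1 / lam * (p h / h))"
        using h by (simp add: add_divide_distrib distrib_left)
      finally show ?thesis by simp
    qed
    have "u y * lam \<le> (g y + \<eta>) + exp (- lam * 0) * (w' y * \<mu> y + (w'' / 2 + \<eta>) * \<sigma> y + 1 / lam * 0)"
    proof (rule tendsto_le[OF trivial_limit_at_right_real])
      show "((\<lambda>h. u y * ((1 - exp (- lam * h)) / h)) \<longlongrightarrow> u y * lam) (at_right 0)"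
        by (intro tendsto_intros tendsto_one_minus_exp_divide)
      show "((\<lambda>h. (g y + \<eta>) + exp (- lam * h) * (w' y * (m1 h / h) + (w'' / 2 + \<eta>) * (m2 h / h) + 1 / lam * (p h / h)))
        \<longlongrightarrow> (g y + \<eta>) + exp (- lam * 0) * (w' y * \<mu> y + (w'' / 2 + \<eta>) * \<sigma> y + 1 / lam * 0)) (at_right 0)"
        unfolding m1_def m2_def p_def
        by (intro tendsto_intros drift[OF y e(1)] variance[OF y e(1)] no_jumps[OF y e(1)])
      show "\<forall>\<^sub>F h in at_right 0. u y * ((1 - exp (- lam * h)) / h) \<le>
        (g y + \<eta>) + exp (- lam * h) * (w' y * (m1 h / h) + (w'' / 2 + \<eta>) * (m2 h / h) + 1 / lam * (p h / h))"
        unfolding eventually_at_right_field using step \<delta>(1) by auto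
    qed
    then show ?thesis by (simp add: algebra_simps)
  qed
  show ?thesis
  proof (rule field_le_epsilon)
    fix \<epsilon> :: real assume "\<epsilon> > 0"
    then have "\<epsilon> / (1 + \<sigma> y) > 0" using \<sigma> by simp
    from main[OF this] show "lam * resolvent lam g y \<le> g y + (1/2 * \<sigma> y * w'' + \<mu> y * w' y) + \<epsilon>"
      using \<sigma> by (simp add: u_def)
  qed
qed

lemma resolvent_le_supersolution:
  assumes lam: "lam > 0" and sub: "{\<alpha>..\<beta>} \<subseteq> I" and g: "g \<in> borel_measurable borel"
    and g01: "\<And>x. 0 \<le> g x" "\<And>x. g x \<le> 1"
    and u: "continuous_on {\<alpha>..\<beta>} (resolvent lam g)"
    and w: "\<And>x. x \<in> {\<alpha>..\<beta>} \<Longrightarrow> (w has_real_derivative w' x) (at x)"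
      "\<And>x. x \<in> {\<alpha>..\<beta>} \<Longrightarrow> (w' has_real_derivative w'' x) (at x)"
    and super: "\<And>x. \<alpha> < x \<Longrightarrow> x < \<beta> \<Longrightarrow> isCont g x"
      "\<And>x. \<alpha> < x \<Longrightarrow> x < \<beta> \<Longrightarrow> g x + (1/2 * \<sigma> x * w'' x + \<mu> x * w' x) \<le> lam * w x"
    and bd: "resolvent lam g \<alpha> \<le> w \<alpha>" "resolvent lam g \<beta> \<le> w \<beta>"
    and x: "x \<in> {\<alpha>..\<beta>}"
  shows "resolvent lam g x \<le> w x"
proof (rule ccontr)
  assume neg: "\<not> ?thesis"
  define d where "d = (\<lambda>x. resolvent lam g x - w x)"
  have "continuous_on {\<alpha>..\<beta>} w"
    using w(1) by (meson DERIV_atLeastAtMost_imp_continuous_on atLeastAtMost_iff)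
  then have "continuous_on {\<alpha>..\<beta>} d" unfolding d_def using u by (intro continuous_intros)
  with x obtain p where p: "p \<in> {\<alpha>..\<beta>}" "\<And>z. z \<in> {\<alpha>..\<beta>} \<Longrightarrow> d z \<le> d p"
    using continuous_attains_sup[OF compact_Icc, of \<alpha> \<beta> d] by force
  have dp: "d p > 0" using p(2)[OF x] neg by (simp add: d_def)
  then have ab: "\<alpha> < p" "p < \<beta>" using p(1) bd by (auto simp: less_le d_def)
  then have ev: "\<forall>\<^sub>F z in nhds p. z \<in> {\<alpha><..<\<beta>}" by (intro eventually_nhds_in_open) auto
  have "lam * resolvent lam g p \<le> g p + (1/2 * \<sigma> p * w'' p + \<mu> p * w' p)"
  proof (rule resolvent_touching_above[OF lam _ g g01 super(1)[OF ab]])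
    show "p \<in> I" using p sub by auto
    show "\<forall>\<^sub>F x in nhds p. (w has_real_derivative w' x) (at x)"
      using ev by eventually_elim (use w(1) in auto)
    show "(w' has_real_derivative w'' p) (at p)" using w(2) p by auto
    show "\<forall>\<^sub>F x in nhds p. resolvent lam g x - w x \<le> resolvent lam g p - w p"
      using ev by eventually_elim (use p(2) in \<open>auto simp: d_def\<close>)
  qed
  also have "\<dots> \<le> lam * w p" by (rule super(2)[OF ab])
  finally show False using dp lam by (simp add: d_def)
qed

text \<open>The comparison for supersolutions, applied to \<open>1 - g\<close> and
  \<open>1 / lam - w\<close>.\<close>

lemma resolvent_ge_subsolution:
  assumes lam: "lam > 0" and sub: "{\<alpha>..\<beta>} \<subseteq> I" and g: "g \<in> borel_measurable borel"
    and g01: "\<And>x. 0 \<le> g x" "\<And>x. g x \<le> 1"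
    and u: "continuous_on {\<alpha>..\<beta>} (resolvent lam g)"
    and w: "\<And>x. x \<in> {\<alpha>..\<beta>} \<Longrightarrow> (w has_real_derivative w' x) (at x)"
      "\<And>x. x \<in> {\<alpha>..\<beta>} \<Longrightarrow> (w' has_real_derivative w'' x) (at x)"
    and cont: "\<And>x. \<alpha> < x \<Longrightarrow> x < \<beta> \<Longrightarrow> isCont g x"
      and super: "\<And>x. \<alpha> < x \<Longrightarrow> x < \<beta> \<Longrightarrow> lam * w x \<le> g x + (1/2 * \<sigma> x * w'' x + \<mu> x * w' x)"
    and bd: "w \<alpha> \<le> resolvent lam g \<alpha>" "w \<beta> \<le> resolvent lam g \<beta>"
    and x: "x \<in> {\<alpha>..\<beta>}"
  shows "w x \<le> resolvent lam g x"
proof -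
  have c: "resolvent lam (\<lambda>x. 1 - g x) z = 1 / lam - resolvent lam g z" if "z \<in> {\<alpha>..\<beta>}" for z
    using that sub by (intro resolvent_complement[OF lam _ g g01]) auto
  have ab: "\<alpha> \<in> {\<alpha>..\<beta>}" "\<beta> \<in> {\<alpha>..\<beta>}" using x by auto
  have "resolvent lam (\<lambda>x. 1 - g x) x \<le> 1 / lam - w x"
  proof (rule resolvent_le_supersolution[OF lam sub, where w="\<lambda>x. 1 / lam - w x" and w'="\<lambda>x. - w' x" and w''="\<lambda>x. - w'' x"])
    show "(\<lambda>x. 1 - g x) \<in> borel_measurable borel" using g by measurable
    have "continuous_on {\<alpha>..\<beta>} (\<lambda>z. 1 / lam - resolvent lam g z)" using u by (intro continuous_intros)
    then show "continuous_on {\<alpha>..\<beta>} (resolvent lam (\<lambda>x. 1 - g x))"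
      by (rule continuous_on_cong[THEN iffD1, rotated 2]) (use c in auto)
    show "((\<lambda>x. 1 / lam - w x) has_real_derivative - w' z) (at z)" if "z \<in> {\<alpha>..\<beta>}" for z
      using w(1)[OF that] by (auto intro!: derivative_eq_intros)
    show "((\<lambda>x. - w' x) has_real_derivative - w'' z) (at z)" if "z \<in> {\<alpha>..\<beta>}" for z
      using w(2)[OF that] by (auto intro!: derivative_eq_intros)
    show "isCont (\<lambda>x. 1 - g x) z" if "\<alpha> < z" "z < \<beta>" for z
      using cont[OF that] by (intro continuous_intros)
    show "1 - g z + (1/2 * \<sigma> z * - w'' z + \<mu> z * - w' z) \<le> lam * (1 / lam - w z)" if "\<alpha> < z" "z < \<beta>" for z
      using super[OF that] lam by (simp add: right_diff_distrib)
  qed (use g01 bd x c[OF ab(1)] c[OF ab(2)] in auto)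
  then show ?thesis using c[OF x] by simp
qed

end

section \<open>Continuity of the resolvent in the starting point\<close>

locale diffusion_with_density = regular_diffusion +
  fixes f :: "real \<Rightarrow> real \<Rightarrow> real \<Rightarrow> real"
  assumes density: "transition_density P X (einterval r1 r2) f"
begin

lemma f_nonneg: "t > 0 \<Longrightarrow> x \<in> I \<Longrightarrow> y \<in> I \<Longrightarrow> 0 \<le> f t x y"
  and f_distributed: "t > 0 \<Longrightarrow> y \<in> I \<Longrightarrow> distributed (P y) lborel (X t) (\<lambda>x. ennreal (f t x y) * indicator I x)"
  and f_continuous: "continuous_on ({0<..} \<times> I \<times> I) (\<lambda>(t, x, y). f t x y)"
  and f_vanish: "x \<in> I \<Longrightarrow> y \<in> I \<Longrightarrow> x \<noteq> y \<Longrightarrow> ((\<lambda>(t, x'). f t x' y) \<longlongrightarrow> 0) (at_right 0 \<times>\<^sub>F nhds x)"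
  using density unfolding transition_density_def by auto

lemma f_measurable [measurable]:
  assumes "y \<in> I"
  shows "(\<lambda>(t, x). ennreal (f t x y) * indicator ({0<..} \<times> I) (t, x)) \<in> borel_measurable (borel \<Otimes>\<^sub>M borel)"
proof -
  have "continuous_on ({0<..} \<times> I) (\<lambda>p. (\<lambda>(t, x, y). f t x y) (fst p, snd p, y))"
    using assms by (intro continuous_on_compose2[OF f_continuous]) (auto intro!: continuous_intros)
  moreover have "{0<..} \<times> I \<in> sets (borel :: (real \<times> real) measure)"
    by (intro borel_open open_Times) auto
  ultimately have "(\<lambda>p. indicator ({0<..} \<times> I) p *\<^sub>R f (fst p) (snd p) y) \<in> borel_measurable borel"
    by (intro borel_measurable_continuous_on_indicator) auto
  then have "(\<lambda>p. ennreal (indicator ({0<..} \<times> I) p *\<^sub>R f (fst p) (snd p) y)) \<in> borel_measurable borel"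
    by (rule measurable_compose[OF _ measurable_ennreal])
  moreover have "(\<lambda>(t, x). ennreal (f t x y) * indicator ({0<..} \<times> I) (t, x)) =
    (\<lambda>p. ennreal (indicator ({0<..} \<times> I) p *\<^sub>R f (fst p) (snd p) y))"
    by (auto simp: fun_eq_iff split: split_indicator)
  ultimately show ?thesis unfolding borel_prod by simp
qed

lemma expectation_density:
  assumes "y \<in> I" "t > 0" and [measurable]: "g \<in> borel_measurable borel"
  shows "(\<integral>\<^sup>+\<omega>. g (Y t \<omega>) \<partial>P y) = (\<integral>\<^sup>+x\<in>I. g x * ennreal (f t x y) \<partial>lborel)"
proof -
  have "(\<integral>\<^sup>+\<omega>. g (Y t \<omega>) \<partial>P y) = (\<integral>\<^sup>+\<omega>. g (X t \<omega>) \<partial>P y)" using assms by (simp add: Y_eq)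
  also have "\<dots> = (\<integral>\<^sup>+x. (ennreal (f t x y) * indicator I x) * g x \<partial>lborel)"
    by (rule distributed_nn_integral[OF f_distributed, symmetric]) (use assms in auto)
  also have "\<dots> = (\<integral>\<^sup>+x\<in>I. g x * ennreal (f t x y) \<partial>lborel)"
    by (intro nn_integral_cong) (simp add: mult_ac)
  finally show ?thesis .
qed

lemma resolvent_nn_density:
  assumes y: "y \<in> I" and [measurable]: "g \<in> borel_measurable borel" and g0: "\<And>x. 0 \<le> g x"
  shows "resolvent_nn lam g y = (\<integral>\<^sup>+p. ennreal (exp (- lam * fst p) * g (snd p)) *
    (ennreal (f (fst p) (snd p) y) * indicator ({0<..} \<times> I) p) \<partial>(lborel \<Otimes>\<^sub>M lborel))"
proof -
  have [measurable]: "(\<lambda>p. ennreal (f (fst p) (snd p) y) * indicator ({0<..} \<times> I) p) \<in> borel_measurable (borel \<Otimes>\<^sub>M borel)"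
    using f_measurable[OF y] by (simp add: split_beta')
  have "resolvent_nn lam g y = (\<integral>\<^sup>+t\<in>{0..}. (\<integral>\<^sup>+\<omega>. ennreal (exp (- lam * t) * g (Y t \<omega>)) \<partial>P y) \<partial>lborel)"
    by (rule resolvent_nn_eq) (use y in auto)
  also have "\<dots> = (\<integral>\<^sup>+t. (\<integral>\<^sup>+x. ennreal (exp (- lam * t) * g x) * (ennreal (f t x y) * indicator ({0<..} \<times> I) (t, x)) \<partial>lborel) \<partial>lborel)"
  proof (intro nn_integral_cong_AE)
    show "AE t in lborel. (\<integral>\<^sup>+\<omega>. ennreal (exp (- lam * t) * g (Y t \<omega>)) \<partial>P y) * indicator {0..} t =
      (\<integral>\<^sup>+x. ennreal (exp (- lam * t) * g x) * (ennreal (f t x y) * indicator ({0<..} \<times> I) (t, x)) \<partial>lborel)"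
      using AE_lborel_singleton[of 0]
    proof eventually_elim
      case (elim t)
      show ?case
      proof (cases "t > 0")
        case True
        then show ?thesis
          by (subst expectation_density[OF y True, of "\<lambda>x. ennreal (exp (- lam * t) * g x)"])
             (auto intro!: nn_integral_cong split: split_indicator)
      qed (use elim in auto)
    qed
  qed
  also have "\<dots> = (\<integral>\<^sup>+p. ennreal (exp (- lam * fst p) * g (snd p)) *
    (ennreal (f (fst p) (snd p) y) * indicator ({0<..} \<times> I) p) \<partial>(lborel \<Otimes>\<^sub>M lborel))"
    by (subst lborel.nn_integral_fst[symmetric]) (auto simp: split_beta')
  finally show ?thesis .
qed

text \<open>Lower semicontinuity in the starting point: for fixed time and target the density is
  continuous in its last argument, and Fatou's lemma applies to the nonnegative integrand.\<close>

lemma resolvent_nn_liminf: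
  assumes y: "y \<in> I" "\<And>n. s n \<in> I" "s \<longlonglongrightarrow> y" and g [measurable]: "g \<in> borel_measurable borel" and g0: "\<And>x. 0 \<le> g x"
  shows "resolvent_nn lam g y \<le> liminf (\<lambda>n. resolvent_nn lam g (s n))"
proof -
  have [measurable]: "(\<lambda>p. ennreal (f (fst p) (snd p) z) * indicator ({0<..} \<times> I) p) \<in> borel_measurable (borel \<Otimes>\<^sub>M borel)" if "z \<in> I" for z
    using f_measurable[OF that] by (simp add: split_beta')
  let ?k = "\<lambda>z p. ennreal (exp (- lam * fst p) * g (snd p)) * (ennreal (f (fst p) (snd p) z) * indicator ({0<..} \<times> I) p)"
  have lim: "(\<lambda>n. ?k (s n) p) \<longlonglongrightarrow> ?k y p" for p
  proof (cases "p \<in> {0<..} \<times> I")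
    case True
    have "(\<lambda>n. (\<lambda>(t, x, y). f t x y) (fst p, snd p, s n)) \<longlonglongrightarrow> (\<lambda>(t, x, y). f t x y) (fst p, snd p, y)"
      using True y by (intro continuous_on_tendsto_compose[OF f_continuous] tendsto_intros) auto
    then have "(\<lambda>n. ennreal (exp (- lam * fst p) * g (snd p)) * ennreal (f (fst p) (snd p) (s n)))
      \<longlonglongrightarrow> ennreal (exp (- lam * fst p) * g (snd p)) * ennreal (f (fst p) (snd p) y)"
      by (intro ennreal_tendsto_cmult tendsto_ennrealI) auto
    then show ?thesis using True by simp
  qed simp
  have "resolvent_nn lam g y = (\<integral>\<^sup>+p. liminf (\<lambda>n. ?k (s n) p) \<partial>(lborel \<Otimes>\<^sub>M lborel))"
    unfolding resolvent_nn_density[OF y(1) g g0]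
    by (intro nn_integral_cong lim_imp_Liminf[symmetric] lim) simp
  also have "\<dots> \<le> liminf (\<lambda>n. integral\<^sup>N (lborel \<Otimes>\<^sub>M lborel) (?k (s n)))"
    by (rule nn_integral_liminf) (use y in measurable)
  finally show ?thesis unfolding resolvent_nn_density[OF y(2) g g0] .
qed

text \<open>The resolvents of \<open>g\<close> and \<open>1 - g\<close> are both lower
  semicontinuous and add up to a constant, so each is also upper semicontinuous.\<close>

lemma continuous_on_resolvent:
  assumes lam: "lam > 0" and g [measurable]: "g \<in> borel_measurable borel" and g01: "\<And>x. 0 \<le> g x" "\<And>x. g x \<le> 1"
  shows "continuous_on I (resolvent lam g)"
proof (subst continuous_on_sequentially, intro allI ballI impI)
  fix s y assume y: "y \<in> I" and s: "(\<forall>n. s n \<in> I) \<and> s \<longlonglongrightarrow> y"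
  have lower: "\<forall>\<^sub>F n in sequentially. c < resolvent lam h (s n)"
    if c: "c < resolvent lam h y" and h: "h \<in> borel_measurable borel" "\<And>x. 0 \<le> h x" "\<And>x. h x \<le> 1" for c h
  proof (cases "c < 0")
    case True
    then show ?thesis by (auto intro: always_eventually less_le_trans resolvent_nonneg)
  next
    case False
    have "ennreal c < resolvent_nn lam h y"
      using c False ennreal_resolvent[of lam y h] lam y h by (metis ennreal_lessI le_less_trans not_le)
    also have "\<dots> \<le> liminf (\<lambda>n. resolvent_nn lam h (s n))"
      using s y h by (intro resolvent_nn_liminf) auto
    finally have "\<forall>\<^sub>F n in sequentially. ennreal c < resolvent_nn lam h (s n)" by (rule less_LiminfD)
    then show ?thesis
    proof eventually_elim
      case (elim n)
      then show ?case using ennreal_resolvent[of lam "s n" h] lam s h False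
        by (metis ennreal_less_iff not_le)
    qed
  qed
  have "(\<lambda>n. resolvent lam g (s n)) \<longlonglongrightarrow> resolvent lam g y"
  proof (rule order_tendstoI)
    show "\<forall>\<^sub>F n in sequentially. c < resolvent lam g (s n)" if "c < resolvent lam g y" for c
      using lower[OF that g g01] .
    fix c assume c: "resolvent lam g y < c"
    have "\<forall>\<^sub>F n in sequentially. 1 / lam - c < resolvent lam (\<lambda>x. 1 - g x) (s n)"
      using c g01 by (intro lower) (auto simp: resolvent_complement[OF lam y g g01])
    then show "\<forall>\<^sub>F n in sequentially. resolvent lam g (s n) < c"
      using s by (auto simp: resolvent_complement[OF lam _ g g01])
  qed
  then show "(resolvent lam g \<circ> s) \<longlonglongrightarrow> resolvent lam g y" by (simp add: o_def)
qed

end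

section \<open>Laplace transforms\<close>

text \<open>The value of \<open>h\<close> at time 0 is arbitrary but sits on a null set. No
  finiteness is assumed: in the infinite case the Bochner integral and \<open>enn2real\<close> both
  default to 0.\<close>

lemma laplace_eq_nn_integral:
  assumes [measurable]: "(\<lambda>t. indicator {0<..} t * h t) \<in> borel_measurable borel" and nn: "\<And>t. t > 0 \<Longrightarrow> 0 \<le> h t"
  shows "laplace lam h = enn2real (\<integral>\<^sup>+t\<in>{0<..}. ennreal (exp (- lam * t) * h t) \<partial>lborel)"
proof -
  let ?k = "\<lambda>t. exp (- lam * t) * (indicator {0<..} t * h t)"
  have "(\<lambda>t. indicator {0..} t *\<^sub>R (exp (- lam * t) * h t)) = (\<lambda>t. ?k t + indicator {0} t * h 0)"
    by (auto simp: fun_eq_iff split: split_indicator)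
  then have "laplace lam h = (\<integral>t. ?k t + indicator {0} t * h 0 \<partial>lborel)"
    unfolding laplace_def set_lebesgue_integral_def by simp
  also have "\<dots> = (\<integral>t. ?k t \<partial>lborel)"
    using AE_lborel_singleton[of 0] by (intro integral_cong_AE) (auto elim!: eventually_mono)
  also have "\<dots> = enn2real (\<integral>\<^sup>+t. ennreal (?k t) \<partial>lborel)"
    using nn by (intro integral_eq_nn_integral) (auto split: split_indicator)
  also have "(\<integral>\<^sup>+t. ennreal (?k t) \<partial>lborel) = (\<integral>\<^sup>+t\<in>{0<..}. ennreal (exp (- lam * t) * h t) \<partial>lborel)"
    by (intro nn_integral_cong) (auto split: split_indicator)
  finally show ?thesis .
qed

lemma time_density_on_laplace:
  assumes td: "time_density_on M T E g" and [measurable]: "T \<in> borel_measurable M" "E \<in> sets M"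
  shows "laplace lam g = enn2real (\<integral>\<^sup>+\<omega>\<in>E. discount lam (T \<omega>) \<partial>M)"
proof -
  from td have [measurable]: "g \<in> borel_measurable borel" and g0: "\<And>t. t \<ge> 0 \<Longrightarrow> 0 \<le> g t"
    and td': "\<And>B. B \<in> sets borel \<Longrightarrow> B \<subseteq> {0..} \<Longrightarrow>
      emeasure M {\<omega> \<in> E. T \<omega> \<in> ennreal ` B} = (\<integral>\<^sup>+t\<in>B. ennreal (g t) \<partial>lborel)"
    unfolding time_density_on_def by auto
  have E_sub: "E \<subseteq> space M" using assms(3) by (rule sets.sets_into_space)
  \<comment> \<open>Infinite times must be removed before pushing forward by
    \<open>enn2real\<close>, which would otherwise place their mass at 0. They carry no discount, so
    the integral is unaffected.\<close>
  define F where "F = {\<omega> \<in> E. T \<omega> < \<infinity>}"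
  have "F = E \<inter> {\<omega> \<in> space M. T \<omega> < \<infinity>}" using E_sub by (auto simp: F_def)
  then have [measurable]: "F \<in> sets M" by simp
  have eq: "distr (density M (indicator F)) borel (\<lambda>\<omega>. enn2real (T \<omega>)) = density lborel (\<lambda>t. ennreal (g t) * indicator {0..} t)"
  proof (rule measure_eqI)
    fix B assume "B \<in> sets (distr (density M (indicator F)) borel (\<lambda>\<omega>. enn2real (T \<omega>)))"
    then have [measurable]: "B \<in> sets borel" by simp
    have "emeasure (distr (density M (indicator F)) borel (\<lambda>\<omega>. enn2real (T \<omega>))) B =
      emeasure (density M (indicator F)) ((\<lambda>\<omega>. enn2real (T \<omega>)) -` B \<inter> space M)"
      by (subst emeasure_distr) auto
    also have "\<dots> = emeasure M (F \<inter> ((\<lambda>\<omega>. enn2real (T \<omega>)) -` B \<inter> space M))"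
      by (subst emeasure_density) (auto simp flip: indicator_inter_arith)
    also have "F \<inter> ((\<lambda>\<omega>. enn2real (T \<omega>)) -` B \<inter> space M) = {\<omega> \<in> E. T \<omega> \<in> ennreal ` (B \<inter> {0..})}"
    proof -
      have "(\<tau> < \<infinity> \<and> enn2real \<tau> \<in> B) \<longleftrightarrow> \<tau> \<in> ennreal ` (B \<inter> {0..})" for \<tau>
        by (cases \<tau>) (auto simp: image_iff)
      then show ?thesis using E_sub by (auto simp: F_def)
    qed
    also have "emeasure M \<dots> = (\<integral>\<^sup>+t\<in>B \<inter> {0..}. ennreal (g t) \<partial>lborel)" by (intro td') auto
    also have "\<dots> = emeasure (density lborel (\<lambda>t. ennreal (g t) * indicator {0..} t)) B"
      by (subst emeasure_density) (auto intro!: nn_integral_cong split: split_indicator)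
    finally show "emeasure (distr (density M (indicator F)) borel (\<lambda>\<omega>. enn2real (T \<omega>))) B =
      emeasure (density lborel (\<lambda>t. ennreal (g t) * indicator {0..} t)) B" .
  qed simp
  have "(\<integral>\<^sup>+\<omega>\<in>E. discount lam (T \<omega>) \<partial>M) = (\<integral>\<^sup>+\<omega>. indicator F \<omega> * ennreal (exp (- lam * enn2real (T \<omega>))) \<partial>M)"
    using E_sub by (intro nn_integral_cong) (auto simp: F_def discount_def less_top split: split_indicator)
  also have "\<dots> = (\<integral>\<^sup>+\<omega>. ennreal (exp (- lam * enn2real (T \<omega>))) \<partial>density M (indicator F))"
    by (subst nn_integral_density) auto
  also have "\<dots> = (\<integral>\<^sup>+t. ennreal (exp (- lam * t)) \<partial>distr (density M (indicator F)) borel (\<lambda>\<omega>. enn2real (T \<omega>)))"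
    by (subst nn_integral_distr) auto
  also have "\<dots> = (\<integral>\<^sup>+t. (ennreal (g t) * indicator {0..} t) * ennreal (exp (- lam * t)) \<partial>lborel)"
    unfolding eq by (subst nn_integral_density) auto
  also have "\<dots> = (\<integral>\<^sup>+t\<in>{0<..}. ennreal (exp (- lam * t) * g t) \<partial>lborel)"
  proof (intro nn_integral_cong_AE)
    show "AE t in lborel. ennreal (g t) * indicator {0..} t * ennreal (exp (- lam * t)) =
      ennreal (exp (- lam * t) * g t) * indicator {0<..} t"
      using AE_lborel_singleton[of 0]
      by eventually_elim (auto simp: g0 ennreal_mult[symmetric] mult.commute split: split_indicator)
  qed
  finally show ?thesis using g0 by (subst laplace_eq_nn_integral) auto
qed

context regular_diffusion
begin

definition hitting_laplace :: "real \<Rightarrow> real \<Rightarrow> real \<Rightarrow> real"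
  where "hitting_laplace lam z y = enn2real (hitting_discount lam z y)"

lemma resolvent_through:
  assumes "y \<in> I" "z \<in> I" "g \<in> borel_measurable borel"
    and "\<And>x. x \<in> I \<Longrightarrow> g x \<noteq> 0 \<Longrightarrow> z \<in> closed_segment y x"
  shows "resolvent lam g y = hitting_laplace lam z y * resolvent lam g z"
  using resolvent_nn_through[OF assms, of lam] by (simp add: resolvent_def hitting_laplace_def enn2real_mult)

lemma hitting_time_measurable_P [measurable]: "y \<in> I \<Longrightarrow> H z \<in> borel_measurable (P y)"
  by (subst measurable_P) measurable

text \<open>A path starting at \<open>y \<noteq> z\<close> has a strictly positive hitting time of
  \<open>z\<close>, so the discount is almost surely below 1. This strictness yields the
  nonvanishing denominators and the contraction factor in the upper bound for tents.\<close>

lemma hitting_discount_less_1: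
  assumes lam: "lam > 0" and y: "y \<in> I" and "y \<noteq> z"
  shows "hitting_discount lam z y < 1"
proof -
  interpret y: prob_space "P y" using prob_space_P y .
  have lt: "AE \<omega> in P y. discount lam (H z \<omega>) < 1"
    using AE_start[OF y] AE_space
  proof eventually_elim
    case (elim \<omega>)
    then have \<omega>: "\<omega> \<in> space \<Omega>" by (simp add: space_P[OF y])
    show ?case
    proof (rule hitting_time_cases[OF \<omega>, of z])
      fix \<tau> assume \<tau>: "\<tau> \<ge> 0" "H z \<omega> = ennreal \<tau>" "Y \<tau> \<omega> = z"
      then have "\<tau> \<noteq> 0" using elim(1) \<open>y \<noteq> z\<close> by (auto simp: Y_eq)
      then show ?thesis using \<tau> lam by (simp add: discount_def ennreal_less_one_iff)
    qed simp
  qed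
  have "(\<integral>\<^sup>+\<omega>. discount lam (H z \<omega>) \<partial>P y) < (\<integral>\<^sup>+\<omega>. 1 \<partial>P y)"
  proof (rule nn_integral_less)
    have "(\<integral>\<^sup>+\<omega>. discount lam (H z \<omega>) \<partial>P y) \<le> (\<integral>\<^sup>+\<omega>. 1 \<partial>P y)"
      by (intro nn_integral_mono discount_le_1 lam)
    then show "(\<integral>\<^sup>+\<omega>. discount lam (H z \<omega>) \<partial>P y) \<noteq> \<infinity>"
      by (auto simp: y.emeasure_space_1 top_unique)
    show "AE \<omega> in P y. discount lam (H z \<omega>) \<le> 1" using lt by eventually_elim simp
    show "\<not> (AE \<omega> in P y. 1 \<le> discount lam (H z \<omega>))"
    proof
      assume "AE \<omega> in P y. 1 \<le> discount lam (H z \<omega>)"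
      with lt have "AE \<omega> in P y. False" by eventually_elim simp
      then show False by simp
    qed
  qed (use y in measurable)
  then show ?thesis by (simp add: hitting_discount_def y.emeasure_space_1)
qed

lemma hitting_laplace_less_1:
  assumes "lam > 0" "y \<in> I" "y \<noteq> z"
  shows "0 \<le> hitting_laplace lam z y" "hitting_laplace lam z y < 1"
  using hitting_discount_less_1[OF assms]
  by (auto simp: hitting_laplace_def intro: enn2real_less_iff[THEN iffD2]
      dest: less_trans[OF _ ennreal_one_less_top] simp: enn2real_less_iff)

lemma hits_with_positive_probability:
  assumes y: "y \<in> I" and z: "z \<in> I" and "AE \<omega> in P y. H z \<omega> = \<infinity>"
  shows False
proof -
  interpret y: prob_space "P y" using prob_space_P y .
  have [simp, measurable_cong]: "sets (P y) = sets \<Omega>" using sets_P y by auto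
  have m: "{\<omega> \<in> space \<Omega>. H z \<omega> < \<infinity>} \<in> sets (P y)" by measurable
  have "AE \<omega> in P y. \<omega> \<notin> {\<omega> \<in> space \<Omega>. H z \<omega> < \<infinity>}"
    using assms(3) by eventually_elim simp
  then have "y.prob {\<omega> \<in> space \<Omega>. H z \<omega> < \<infinity>} = 0" using y.prob_eq_0[OF m] by simp
  then show False using regular[OF y z] by simp
qed

lemma hitting_laplace_pos:
  assumes lam: "lam > 0" and y: "y \<in> I" and z: "z \<in> I" and "y \<noteq> z"
  shows "0 < hitting_laplace lam z y"
proof -
  have "hitting_discount lam z y \<noteq> 0"
  proof
    assume "hitting_discount lam z y = 0"
    then have "AE \<omega> in P y. discount lam (H z \<omega>) = 0"
      unfolding hitting_discount_def by (subst (asm) nn_integral_0_iff_AE) (use y in auto)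
    then have "AE \<omega> in P y. H z \<omega> = \<infinity>"
      by eventually_elim (auto simp: discount_def split: if_splits)
    then show False by (rule hits_with_positive_probability[OF y z])
  qed
  moreover have "hitting_discount lam z y < top"
    using hitting_discount_less_1[OF lam y \<open>y \<noteq> z\<close>] less_trans ennreal_one_less_top by blast
  ultimately show ?thesis unfolding hitting_laplace_def by (simp add: enn2real_positive_iff zero_less_iff_neq_zero)
qed

lemma occupation_pos:
  assumes \<omega>: "\<omega> \<in> space \<Omega>" and lam: "lam > 0" and \<tau>: "\<tau> \<ge> 0" and g: "\<forall>\<^sub>F x in nhds (Y \<tau> \<omega>). g x = 1"
  shows "occupation lam g \<omega> > 0"
proof -
  have "\<forall>\<^sub>F t in nhds \<tau>. g (Y t \<omega>) = 1"
    using eventually_compose_filterlim[OF g isCont_Y[OF \<omega>, of \<tau>, unfolded isCont_def]] eventually_nhds_x_imp_x[OF g]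
    unfolding eventually_nhds_conv_at by simp
  then obtain d where d: "d > 0" "\<And>t. dist t \<tau> < d \<Longrightarrow> g (Y t \<omega>) = 1"
    unfolding eventually_nhds_metric by auto
  have "0 < ennreal (exp (- lam * (\<tau> + d / 2))) * ennreal (d / 2)"
    using d(1) by (simp add: ennreal_zero_less_mult_iff)
  also have "\<dots> = (\<integral>\<^sup>+t. ennreal (exp (- lam * (\<tau> + d / 2))) * indicator {\<tau>..\<tau> + d / 2} t \<partial>lborel)"
    using d(1) by (subst nn_integral_cmult_indicator) auto
  also have "\<dots> \<le> occupation lam g \<omega>"
    unfolding occupation_def
  proof (intro nn_integral_mono)
    fix t
    show "ennreal (exp (- lam * (\<tau> + d / 2))) * indicator {\<tau>..\<tau> + d / 2} t \<le>
      ennreal (exp (- lam * t) * g (Y t \<omega>)) * indicator {0..} t"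
    proof (cases "t \<in> {\<tau>..\<tau> + d / 2}")
      case True
      then have "g (Y t \<omega>) = 1" using d by (intro d(2)) (auto simp: dist_real_def)
      then show ?thesis using True \<tau> lam by (auto intro!: ennreal_leI)
    qed simp
  qed
  finally show ?thesis .
qed

text \<open>By regularity \<open>z\<close> is reached with positive probability, and by continuity a
  path that reaches \<open>z\<close> spends a positive length of time in the neighbourhood where
  \<open>g\<close> is 1.\<close>

lemma resolvent_pos:
  assumes lam: "lam > 0" and y: "y \<in> I" and z: "z \<in> I" and [measurable]: "g \<in> borel_measurable borel"
    and g1: "\<And>x. g x \<le> 1" and g: "\<forall>\<^sub>F x in nhds z. g x = 1"
  shows "resolvent lam g y > 0"
proof -
  have [simp, measurable_cong]: "sets (P y) = sets \<Omega>" using sets_P y by auto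
  have "resolvent_nn lam g y \<noteq> 0"
  proof
    assume "resolvent_nn lam g y = 0"
    then have "AE \<omega> in P y. occupation lam g \<omega> = 0"
      unfolding resolvent_nn_def by (subst (asm) nn_integral_0_iff_AE) auto
    then have "AE \<omega> in P y. H z \<omega> = \<infinity>" using AE_space
    proof eventually_elim
      case (elim \<omega>)
      then have \<omega>: "\<omega> \<in> space \<Omega>" by (simp add: space_P[OF y])
      show ?case
      proof (rule hitting_time_cases[OF \<omega>, of z])
        fix \<tau> assume "\<tau> \<ge> 0" "Y \<tau> \<omega> = z"
        then show ?thesis using occupation_pos[OF \<omega> lam, of \<tau> g] elim g by simp
      qed
    qed
    then show False by (rule hits_with_positive_probability[OF y z])
  qed
  then show ?thesis
    using ennreal_resolvent[of lam y g, OF lam y g1] resolvent_nonneg[of lam g y] by (cases "resolvent lam g y = 0") auto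
qed

lemma laplace_transition_cdf:
  assumes y: "y \<in> I"
  shows "laplace lam (\<lambda>t. transition_cdf \<Omega> P X t x y) = resolvent lam (indicator {..x}) y"
proof -
  interpret y: prob_space "P y" using prob_space_P y .
  have [simp, measurable_cong]: "sets (P y) = sets \<Omega>" using sets_P y by auto
  have cdf: "transition_cdf \<Omega> P X t x y = enn2real (\<integral>\<^sup>+\<omega>. indicator {..x} (Y t \<omega>) \<partial>P y)" if "t > 0" for t
  proof -
    have m: "{\<omega> \<in> space \<Omega>. Y t \<omega> \<le> x} \<in> sets (P y)" by measurable
    have "(\<integral>\<^sup>+\<omega>. indicator {..x} (Y t \<omega>) \<partial>P y) = (\<integral>\<^sup>+\<omega>. indicator {\<omega> \<in> space \<Omega>. Y t \<omega> \<le> x} \<omega> \<partial>P y)"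
      by (intro nn_integral_cong) (auto simp: space_P[OF y] split: split_indicator)
    then show ?thesis using m that by (simp add: transition_cdf_def Y_eq measure_def)
  qed
  have "laplace lam (\<lambda>t. transition_cdf \<Omega> P X t x y) =
    enn2real (\<integral>\<^sup>+t\<in>{0<..}. ennreal (exp (- lam * t) * transition_cdf \<Omega> P X t x y) \<partial>lborel)"
  proof (rule laplace_eq_nn_integral)
    have "(\<lambda>t. indicator {0<..} t * transition_cdf \<Omega> P X t x y) =
      (\<lambda>t. indicator {0<..} t * enn2real (\<integral>\<^sup>+\<omega>. indicator {..x} (Y t \<omega>) \<partial>P y))"
      by (auto simp: cdf fun_eq_iff split: split_indicator)
    then show "(\<lambda>t. indicator {0<..} t * transition_cdf \<Omega> P X t x y) \<in> borel_measurable borel" by simp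
  qed (simp add: transition_cdf_def)
  also have "(\<integral>\<^sup>+t\<in>{0<..}. ennreal (exp (- lam * t) * transition_cdf \<Omega> P X t x y) \<partial>lborel) = resolvent_nn lam (indicator {..x}) y"
    unfolding resolvent_nn_eq[OF y borel_measurable_indicator[OF atMost_borel]]
  proof (intro nn_integral_cong_AE)
    show "AE t in lborel. ennreal (exp (- lam * t) * transition_cdf \<Omega> P X t x y) * indicator {0<..} t =
      (\<integral>\<^sup>+\<omega>. ennreal (exp (- lam * t) * indicator {..x} (Y t \<omega>)) \<partial>P y) * indicator {0..} t"
      using AE_lborel_singleton[of 0]
    proof eventually_elim
      case (elim t)
      have "(\<integral>\<^sup>+\<omega>. ennreal (exp (- lam * t) * indicator {..x} (Y t \<omega>)) \<partial>P y) =
        (\<integral>\<^sup>+\<omega>. ennreal (exp (- lam * t)) * indicator {..x} (Y t \<omega>) \<partial>P y)"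
        by (intro nn_integral_cong) (auto split: split_indicator)
      also have "\<dots> = ennreal (exp (- lam * t)) * (\<integral>\<^sup>+\<omega>. indicator {..x} (Y t \<omega>) \<partial>P y)"
        by (rule nn_integral_cmult) measurable
      finally have e: "(\<integral>\<^sup>+\<omega>. ennreal (exp (- lam * t) * indicator {..x} (Y t \<omega>)) \<partial>P y) =
        ennreal (exp (- lam * t)) * (\<integral>\<^sup>+\<omega>. indicator {..x} (Y t \<omega>) \<partial>P y)" .
      have "(\<integral>\<^sup>+\<omega>. indicator {..x} (Y t \<omega>) \<partial>P y) \<le> (\<integral>\<^sup>+\<omega>. 1 \<partial>P y)"
        by (intro nn_integral_mono) (auto split: split_indicator)
      then have "(\<integral>\<^sup>+\<omega>. indicator {..x} (Y t \<omega>) \<partial>P y) < top"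
        using le_less_trans[OF _ ennreal_one_less_top] by (simp add: y.emeasure_space_1)
      then show ?case using elim unfolding e
        by (auto simp: cdf ennreal_mult split: split_indicator)
    qed
  qed
  finally show ?thesis unfolding resolvent_def .
qed

end

section \<open>Laplace transform of the transition density\<close>

lemma continuous_hat: "isCont hat x"
  unfolding hat_def [abs_def] by (intro continuous_intros)

lemma hat_measurable [measurable]: "hat \<in> borel_measurable borel"
  unfolding hat_def [abs_def] by measurable

lemma hat_scaled_eq_0: "m > 0 \<Longrightarrow> 1 / m \<le> \<bar>x - z\<bar> \<Longrightarrow> hat (m * (x - z)) = 0"
  unfolding hat_def abs_mult by (simp add: pos_divide_le_eq mult.commute)

context regular_diffusion
begin

lemma Icc_subset_I: "\<alpha> \<in> I \<Longrightarrow> \<beta> \<in> I \<Longrightarrow> {\<alpha>..\<beta>} \<subseteq> I"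
  by (auto simp: einterval_def) (metis ereal_less_eq(3) le_less_trans less_le_trans)+

lemma I_contains_left: assumes "y \<in> I" obtains \<alpha> where "\<alpha> \<in> I" "\<alpha> < y"
proof -
  obtain e where "e > 0" "ball y e \<subseteq> I" using open_einterval openE assms by blast
  then show ?thesis by (intro that[of "y - e / 2"]) (auto simp: subset_eq dist_real_def)
qed

lemma I_contains_right: assumes "y \<in> I" obtains \<beta> where "\<beta> \<in> I" "y < \<beta>"
proof -
  obtain e where "e > 0" "ball y e \<subseteq> I" using open_einterval openE assms by blast
  then show ?thesis by (intro that[of "y + e / 2"]) (auto simp: subset_eq dist_real_def)
qed

end

context diffusion_with_density
begin

abbreviation "hat_at m z \<equiv> (\<lambda>x. hat (m * (x - z)))"

text \<open>No bound of order \<open>1 / m\<close> is known beforehand at the ends of an interval.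
  It is replaced by a self-improving estimate: a path from an end must first pass
  \<open>\<gamma>\<close> or \<open>\<delta>\<close>, so the values at the ends are at most
  \<open>\<theta> < 1\<close> times the maximum over the interval. The barrier then bounds the
  maximum by \<open>C / m\<close> plus \<open>\<theta>\<close> times itself.\<close>

lemma resolvent_hat_upper:
  assumes lam: "lam > 0" and y: "y \<in> I" and z: "z \<in> I"
  shows "\<exists>C M. \<forall>m\<ge>M. m * resolvent lam (hat_at m z) y \<le> C"
proof -
  obtain \<alpha> where \<alpha>: "\<alpha> \<in> I" "\<alpha> < y" "\<alpha> < z"
    using I_contains_left[of "min y z"] y z by (metis min_def min_less_iff_conj)
  obtain \<beta> where \<beta>: "\<beta> \<in> I" "y < \<beta>" "z < \<beta>"
    using I_contains_right[of "max y z"] y z by (metis max_def max_less_iff_conj)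
  have sub: "{\<alpha>..\<beta>} \<subseteq> I" using \<alpha> \<beta> by (intro Icc_subset_I)
  obtain C where C: "C > 0" "\<And>m. m \<ge> 1 \<Longrightarrow> \<exists>w w' w''. \<forall>x\<in>{\<alpha>..\<beta>}. (w has_real_derivative w' x) (at x) \<and>
       (w' has_real_derivative w'' x) (at x) \<and> 0 \<le> w x \<and> m * w x \<le> C \<and>
       1/2 * \<sigma> x * w'' x + \<mu> x * w' x \<le> - hat (m * (x - z))"
    using upper_barrier[of \<alpha> \<beta> \<mu> \<sigma> z] coefficients continuous_on_subset[OF _ sub] sub by blast
  \<comment> \<open>Fixed points strictly between the ends and \<open>z\<close>. For
    \<open>m \<ge> M\<close> the tent lives between them, so \<open>\<theta>\<close> does not depend
    on \<open>m\<close>.\<close>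
  define \<gamma> \<delta> where "\<gamma> = (\<alpha> + z) / 2" and "\<delta> = (z + \<beta>) / 2"
  have \<gamma>: "\<alpha> < \<gamma>" "\<gamma> < z" "\<gamma> \<in> I" and \<delta>: "z < \<delta>" "\<delta> < \<beta>" "\<delta> \<in> I"
    using \<alpha> \<beta> sub by (auto simp: \<gamma>_def \<delta>_def intro!: subsetD[OF sub])
  define \<theta> where "\<theta> = max (hitting_laplace lam \<gamma> \<alpha>) (hitting_laplace lam \<delta> \<beta>)"
  have \<theta>: "0 \<le> \<theta>" "\<theta> < 1"
    using hitting_laplace_less_1[OF lam \<alpha>(1), of \<gamma>] hitting_laplace_less_1[OF lam \<beta>(1), of \<delta>] \<gamma> \<delta>
    by (auto simp: \<theta>_def)
  define M where "M = max 1 (max (1 / (z - \<gamma>)) (1 / (\<delta> - z)))"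
  have "m * resolvent lam (hat_at m z) y \<le> C / (1 - \<theta>)" if m: "m \<ge> M" for m
  proof -
    have m1: "m \<ge> 1" "m \<ge> 1 / (z - \<gamma>)" "m \<ge> 1 / (\<delta> - z)" using m by (auto simp: M_def)
    then have m2: "1 / m \<le> z - \<gamma>" "1 / m \<le> \<delta> - z" using \<gamma> \<delta> by (auto simp: field_simps)
    define u where "u = resolvent lam (hat_at m z)"
    have u0: "u x \<ge> 0" for x by (simp add: u_def resolvent_nonneg)
    have meas: "hat_at m z \<in> borel_measurable borel" by measurable
    have cont: "continuous_on {\<alpha>..\<beta>} u"
      unfolding u_def using continuous_on_resolvent[OF lam meas] hat_range continuous_on_subset[OF _ sub] by blast
    obtain p where p: "p \<in> {\<alpha>..\<beta>}" "\<And>x. x \<in> {\<alpha>..\<beta>} \<Longrightarrow> u x \<le> u p"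
      using continuous_attains_sup[OF compact_Icc _ cont] \<alpha> \<beta> by force
    have far: "u s \<le> \<theta> * u p" if "s \<in> I" "r \<in> {\<alpha>..\<beta>}" "hitting_laplace lam r s \<le> \<theta>"
      "\<And>x. \<bar>x - z\<bar> < 1 / m \<Longrightarrow> r \<in> closed_segment s x" for r s
    proof -
      have "u s = hitting_laplace lam r s * u r"
        unfolding u_def
      proof (rule resolvent_through[OF that(1) subsetD[OF sub that(2)] meas])
        fix x assume "hat (m * (x - z)) \<noteq> 0"
        then show "r \<in> closed_segment s x" using hat_scaled_eq_0[of m x z] m1 that(4) by force
      qed
      also have "\<dots> \<le> \<theta> * u p" using p(2)[OF that(2)] that(3) u0 \<theta> by (intro mult_mono) auto
      finally show ?thesis .
    qed
    have u\<alpha>: "u \<alpha> \<le> \<theta> * u p"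
      using m2 \<gamma> \<alpha> \<beta> by (intro far[of \<alpha> \<gamma>]) (auto simp: \<theta>_def closed_segment_eq_real_ivl)
    have u\<beta>: "u \<beta> \<le> \<theta> * u p"
      using m2 \<delta> \<alpha> \<beta> by (intro far[of \<beta> \<delta>]) (auto simp: \<theta>_def closed_segment_eq_real_ivl)
    from C(2)[OF m1(1)] obtain w w' w'' where w: "\<And>x. x \<in> {\<alpha>..\<beta>} \<Longrightarrow> (w has_real_derivative w' x) (at x) \<and>
       (w' has_real_derivative w'' x) (at x) \<and> 0 \<le> w x \<and> m * w x \<le> C \<and>
       1/2 * \<sigma> x * w'' x + \<mu> x * w' x \<le> - hat (m * (x - z))" by blast
    \<comment> \<open>A nonnegative constant may be added to a supersolution because
      \<open>lam > 0\<close>; \<open>\<theta> * u p\<close> is the one that dominates the end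
      values.\<close>
    have "u p \<le> w p + \<theta> * u p"
      unfolding u_def
    proof (rule resolvent_le_supersolution[OF lam sub meas,
        where w="\<lambda>x. w x + \<theta> * resolvent lam (hat_at m z) p" and w'=w' and w''=w''])
      show "continuous_on {\<alpha>..\<beta>} (resolvent lam (hat_at m z))" using cont by (simp add: u_def)
      show "((\<lambda>x. w x + \<theta> * resolvent lam (hat_at m z) p) has_real_derivative w' x) (at x)" if "x \<in> {\<alpha>..\<beta>}" for x
        using w[OF that] by (auto intro!: derivative_eq_intros)
      show "hat (m * (x - z)) + (1/2 * \<sigma> x * w'' x + \<mu> x * w' x) \<le> lam * (w x + \<theta> * resolvent lam (hat_at m z) p)"
        if "\<alpha> < x" "x < \<beta>" for x
      proof -
        have "0 \<le> w x" "1/2 * \<sigma> x * w'' x + \<mu> x * w' x \<le> - hat (m * (x - z))" using w[of x] that by auto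
        moreover have "0 \<le> lam * (w x + \<theta> * resolvent lam (hat_at m z) p)"
          using \<theta> lam resolvent_nonneg \<open>0 \<le> w x\<close> by auto
        ultimately show ?thesis by linarith
      qed
      show "isCont (hat_at m z) x" for x
        by (intro isCont_o2[OF _ continuous_hat]) (intro continuous_intros)
      show "resolvent lam (hat_at m z) \<alpha> \<le> w \<alpha> + \<theta> * resolvent lam (hat_at m z) p"
        using u\<alpha> w[of \<alpha>] \<alpha> \<beta> by (simp add: u_def)
      show "resolvent lam (hat_at m z) \<beta> \<le> w \<beta> + \<theta> * resolvent lam (hat_at m z) p"
        using u\<beta> w[of \<beta>] \<alpha> \<beta> by (simp add: u_def)
    qed (use w p hat_range in auto)
    then have "m * (u p * (1 - \<theta>)) \<le> m * w p" using m1 by (intro mult_left_mono) (auto simp: algebra_simps)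
    also have "\<dots> \<le> C" using w[OF p(1)] by simp
    finally have "m * u p \<le> C / (1 - \<theta>)" using \<theta> by (simp add: field_simps)
    moreover have "m * u y \<le> m * u p" using p(2)[of y] \<alpha> \<beta> m1 by (intro mult_left_mono) auto
    ultimately show ?thesis by (simp add: u_def)
  qed
  then show ?thesis by blast
qed

text \<open>The barrier yields the bound only near \<open>z\<close>. It is carried to
  \<open>y\<close> by passage through a fixed point \<open>x0\<close> between \<open>y\<close> and
  the tent, at the price of a factor that is positive by regularity and independent of
  \<open>m\<close>.\<close>

lemma resolvent_hat_lower:
  assumes lam: "lam > 0" and y: "y \<in> I" and z: "z \<in> I" and yz: "y \<noteq> z"
  shows "\<exists>c M. c > 0 \<and> (\<forall>m\<ge>M. c \<le> m * resolvent lam (hat_at m z) y)"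
proof -
  obtain e where e: "e > 0" "ball z e \<subseteq> I" using open_einterval openE z by blast
  define \<rho> where "\<rho> = e / 2"
  have \<rho>: "\<rho> > 0" "{z-\<rho>..z+\<rho>} \<subseteq> I" using e by (auto simp: \<rho>_def subset_eq dist_real_def)
  obtain c M where cM: "c > 0" "M \<ge> 1"
    "\<And>m. m \<ge> M \<Longrightarrow> \<exists>w w' w''. w (z - \<rho>) \<le> 0 \<and> w (z + \<rho>) \<le> 0 \<and>
       (\<forall>x\<in>{z-\<rho>..z+\<rho>}. (w has_real_derivative w' x) (at x) \<and>
       (w' has_real_derivative w'' x) (at x) \<and> (\<bar>x - z\<bar> \<le> \<rho> / 4 \<longrightarrow> c \<le> m * w x) \<and>
       lam * w x \<le> hat (m * (x - z)) + (1/2 * \<sigma> x * w'' x + \<mu> x * w' x))"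
    using lower_barrier[of z \<rho> \<mu> \<sigma> lam] coefficients continuous_on_subset[OF _ \<rho>(2)] \<rho> lam by blast
  \<comment> \<open>\<open>d \<le> \<rho> / 4\<close> keeps \<open>x0\<close> where the barrier is
    at least \<open>c / m\<close>; \<open>d < \<bar>y - z\<bar>\<close> puts \<open>x0\<close>
    strictly between \<open>y\<close> and \<open>z\<close>; and tents with
    \<open>1 / m \<le> d\<close> do not reach past \<open>x0\<close>.\<close>
  define d where "d = min (\<rho> / 4) (\<bar>y - z\<bar> / 2)"
  have d: "d > 0" "d \<le> \<rho> / 4" "d < \<bar>y - z\<bar>" using \<rho>(1) yz by (auto simp: d_def min_less_iff_disj)
  define x0 where "x0 = (if y < z then z - d else z + d)"
  have x0: "x0 \<in> {z-\<rho>..z+\<rho>}" "\<bar>x0 - z\<bar> \<le> \<rho> / 4" "x0 \<in> I" "y \<noteq> x0"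
    using d \<rho> by (auto simp: x0_def intro!: subsetD[OF \<rho>(2)])
  have bound: "hitting_laplace lam x0 y * c \<le> m * resolvent lam (hat_at m z) y" if m: "m \<ge> max M (1 / d)" for m
  proof -
    have m1: "m \<ge> M" "m \<ge> 1" "1 / m \<le> d" using m cM(2) d(1) by (auto simp: field_simps)
    have meas: "hat_at m z \<in> borel_measurable borel" by measurable
    have cont: "continuous_on {z-\<rho>..z+\<rho>} (resolvent lam (hat_at m z))"
      using continuous_on_resolvent[OF lam meas] hat_range continuous_on_subset[OF _ \<rho>(2)] by blast
    from cM(3)[OF m1(1)] obtain w w' w'' where w: "w (z - \<rho>) \<le> 0" "w (z + \<rho>) \<le> 0"
       "\<And>x. x \<in> {z-\<rho>..z+\<rho>} \<Longrightarrow> (w has_real_derivative w' x) (at x) \<and>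
       (w' has_real_derivative w'' x) (at x) \<and> (\<bar>x - z\<bar> \<le> \<rho> / 4 \<longrightarrow> c \<le> m * w x) \<and>
       lam * w x \<le> hat (m * (x - z)) + (1/2 * \<sigma> x * w'' x + \<mu> x * w' x)" by blast
    have "w x0 \<le> resolvent lam (hat_at m z) x0"
    proof (rule resolvent_ge_subsolution[OF lam \<rho>(2) meas _ _ cont, where w=w and w'=w' and w''=w''])
      show "isCont (hat_at m z) x" for x
        by (intro isCont_o2[OF _ continuous_hat]) (intro continuous_intros)
      show "w (z - \<rho>) \<le> resolvent lam (hat_at m z) (z - \<rho>)" "w (z + \<rho>) \<le> resolvent lam (hat_at m z) (z + \<rho>)"
        using w(1,2) resolvent_nonneg order_trans by blast+
    qed (use w(3) x0 hat_range in auto)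
    then have "c \<le> m * resolvent lam (hat_at m z) x0"
      using w(3)[OF x0(1)] x0(2) m1 mult_left_mono[of "w x0" _ m] by (meson le_trans less_eq_real_def order_trans zero_le_one)
    then have "hitting_laplace lam x0 y * c \<le> hitting_laplace lam x0 y * (m * resolvent lam (hat_at m z) x0)"
      using hitting_laplace_less_1[OF lam y x0(4)] by (intro mult_left_mono) auto
    also have "\<dots> = m * resolvent lam (hat_at m z) y"
    proof -
      have "resolvent lam (hat_at m z) y = hitting_laplace lam x0 y * resolvent lam (hat_at m z) x0"
      proof (rule resolvent_through[OF y x0(3) meas])
        fix x assume "hat (m * (x - z)) \<noteq> 0"
        then have "\<bar>x - z\<bar> < 1 / m" using hat_scaled_eq_0[of m x z] m1 by force
        then show "x0 \<in> closed_segment y x" using m1 d by (auto simp: closed_segment_eq_real_ivl x0_def abs_if split: if_splits)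
      qed
      then show ?thesis by simp
    qed
    finally show ?thesis .
  qed
  have "hitting_laplace lam x0 y * c > 0" using hitting_laplace_pos[OF lam y x0(3,4)] cM(1) by simp
  with bound show ?thesis by blast
qed

text \<open>Small times are covered by the locally uniform vanishing of the density off the
  diagonal, the remaining times up to \<open>N\<close> by continuity on a compact set. The bound
  serves as the dominating function in the limit of shrinking tents.\<close>

lemma f_locally_bounded:
  assumes y: "y \<in> I" and z: "z \<in> I" and yz: "y \<noteq> z"
  shows "\<exists>B \<rho>. \<rho> > 0 \<and> (\<forall>t x. 0 < t \<longrightarrow> t \<le> N \<longrightarrow> \<bar>x - z\<bar> \<le> \<rho> \<longrightarrow> x \<in> I \<and> f t x y \<le> B)"
proof -
  obtain e where e: "e > 0" "ball z e \<subseteq> I" using open_einterval openE z by blast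
  have "\<forall>\<^sub>F p in at_right 0 \<times>\<^sub>F nhds z. (\<lambda>(t, x'). f t x' y) p < 1"
    using f_vanish[OF z y] yz by (intro order_tendstoD(2)[where y=0]) auto
  then obtain P Q where PQ: "\<forall>\<^sub>F t in at_right 0. P t" "\<forall>\<^sub>F x in nhds z. Q x"
    "\<And>t x. P t \<Longrightarrow> Q x \<Longrightarrow> f t x y < 1"
    unfolding eventually_prod_filter by auto
  obtain d where d: "d > 0" "\<And>t. 0 < t \<Longrightarrow> t < d \<Longrightarrow> P t"
    using PQ(1) unfolding eventually_at_right_field by auto
  obtain e' where e': "e' > 0" "\<And>x. dist x z < e' \<Longrightarrow> Q x"
    using PQ(2) unfolding eventually_nhds_metric by auto
  define \<rho> where "\<rho> = min e e' / 2"
  have \<rho>: "\<rho> > 0" "\<rho> < e" "\<rho> < e'" using e e' by (auto simp: \<rho>_def)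
  have inI: "x \<in> I" if "\<bar>x - z\<bar> \<le> \<rho>" for x
    using that \<rho> e(2) by (auto simp: subset_eq dist_real_def)
  define K where "K = {d/2..N} \<times> {z-\<rho>..z+\<rho>}"
  have "continuous_on K (\<lambda>p. (\<lambda>(t, x, y). f t x y) (fst p, snd p, y))"
    using d y inI unfolding K_def
    by (intro continuous_on_compose2[OF f_continuous]) (auto intro!: continuous_intros simp: abs_le_iff)
  moreover have "compact K" unfolding K_def by (intro compact_Times compact_Icc)
  ultimately have "compact ((\<lambda>p. (\<lambda>(t, x, y). f t x y) (fst p, snd p, y)) ` K)"
    by (intro compact_continuous_image)
  then have "bdd_above ((\<lambda>p. (\<lambda>(t, x, y). f t x y) (fst p, snd p, y)) ` K)"
    by (intro bounded_imp_bdd_above compact_imp_bounded)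
  then obtain B where B: "\<And>p. p \<in> K \<Longrightarrow> f (fst p) (snd p) y \<le> B" unfolding bdd_above_def by auto
  have "f t x y \<le> max 1 B" if "0 < t" "t \<le> N" "\<bar>x - z\<bar> \<le> \<rho>" for t x
  proof (cases "t < d")
    case True
    then have "f t x y < 1" using that \<rho> by (intro PQ(3) d(2) e'(2)) (auto simp: dist_real_def)
    then show ?thesis by simp
  next
    case False
    then have "(t, x) \<in> K" using that d by (auto simp: K_def abs_le_iff)
    then show ?thesis using B[of "(t, x)"] by simp
  qed
  with inI \<rho>(1) show ?thesis by blast
qed

lemma f_slice_measurable:
  assumes y: "y \<in> I" and z: "z \<in> I"
  shows "(\<lambda>t. indicator {0<..} t * f t z y) \<in> borel_measurable borel"
proof -
  have "continuous_on {0<..} (\<lambda>t. (\<lambda>(t, x, y). f t x y) (t, z, y))"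
    using y z by (intro continuous_on_compose2[OF f_continuous]) (auto intro!: continuous_intros)
  then have "(\<lambda>t. indicator {0<..} t *\<^sub>R f t z y) \<in> borel_measurable borel"
    by (intro borel_measurable_continuous_on_indicator) auto
  then show ?thesis by simp
qed

text \<open>Near time \<open>0\<close> the convergence is dominated because the density vanishes there; large times are
  controlled by the bound on the resolvent with the smaller parameter \<open>lam / 2\<close>.\<close>

lemma resolvent_hat_tendsto:
  assumes lam: "lam > 0" and y: "y \<in> I" and z: "z \<in> I" and yz: "y \<noteq> z"
  defines "\<kappa> \<equiv> enn2real (\<integral>\<^sup>+r. ennreal (hat r) \<partial>lborel)"
  shows "(\<lambda>n. real n * resolvent lam (hat_at (real n) z) y) \<longlonglongrightarrow> \<kappa> * laplace lam (\<lambda>t. f t z y)"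
proof -
  \<comment> \<open>After the substitution \<open>x = z + r / n\<close> the tent becomes the fixed
    \<open>hat r\<close> and only the argument of the density moves with \<open>n\<close>;
    \<open>F\<close> is the pointwise limit of \<open>Fn\<close>.\<close>
  define F where "F = (\<lambda>l (p::real \<times> real). ennreal (exp (- l * fst p) * hat (snd p)) * (ennreal (f (fst p) z y) * indicator {0<..} (fst p)))"
  define Fn where "Fn = (\<lambda>l n (p::real \<times> real). ennreal (exp (- l * fst p) * hat (snd p)) *
    (ennreal (f (fst p) (z + snd p / real n) y) * indicator ({0<..} \<times> I) (fst p, z + snd p / real n)))"
  let ?L = "lborel \<Otimes>\<^sub>M lborel :: (real \<times> real) measure"
  have [measurable]: "(\<lambda>t. ennreal (f t z y) * indicator {0<..} t) \<in> borel_measurable borel"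
  proof -
    have "(\<lambda>t. ennreal (f t z y) * indicator {0<..} t) = (\<lambda>t. ennreal (indicator {0<..} t * f t z y))"
      by (auto simp: fun_eq_iff split: split_indicator)
    then show ?thesis using f_slice_measurable[OF y z] by simp
  qed
  have F_meas [measurable]: "F l \<in> borel_measurable ?L" for l
    unfolding F_def by measurable
  have f_meas: "(\<lambda>p. ennreal (f (fst p) (snd p) y) * indicator ({0<..} \<times> I) p) \<in> borel_measurable (borel \<Otimes>\<^sub>M borel)"
    using f_measurable[OF y] by (simp add: split_beta')
  have Fn_meas [measurable]: "Fn l n \<in> borel_measurable ?L" for l n
  proof -
    have [measurable]: "(\<lambda>p. ennreal (f (fst p) (z + snd p / real n) y) * indicator ({0<..} \<times> I) (fst p, z + snd p / real n)) \<in> borel_measurable (borel \<Otimes>\<^sub>M borel)"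
      using measurable_compose[OF _ f_meas, of "\<lambda>p. (fst p, z + snd p / real n)" "borel \<Otimes>\<^sub>M borel"] by simp
    show ?thesis unfolding Fn_def by measurable
  qed
  have V: "ennreal (real n * resolvent l (hat_at (real n) z) y) = (\<integral>\<^sup>+p. Fn l n p \<partial>?L)"
    if l: "l > 0" and n: "n > 0" for l n
  proof -
    have [measurable]: "(\<lambda>p. ennreal (f (fst p) (snd p) y) * indicator ({0<..} \<times> I) p) \<in> borel_measurable (borel \<Otimes>\<^sub>M borel)"
      by (rule f_meas)
    have "resolvent_nn l (hat_at (real n) z) y = (\<integral>\<^sup>+t. (\<integral>\<^sup>+x. ennreal (exp (- l * t) * hat (real n * (x - z))) *
        (ennreal (f t x y) * indicator ({0<..} \<times> I) (t, x)) \<partial>lborel) \<partial>lborel)"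
      by (subst resolvent_nn_density[OF y]) (auto simp: hat_range lborel.nn_integral_fst[symmetric])
    also have "\<dots> = (\<integral>\<^sup>+t. ennreal (1 / real n) * (\<integral>\<^sup>+r. Fn l n (t, r) \<partial>lborel) \<partial>lborel)"
    proof (intro nn_integral_cong)
      fix t
      have m [measurable]: "(\<lambda>x. ennreal (f t x y) * indicator ({0<..} \<times> I) (t, x)) \<in> borel_measurable borel"
        using measurable_compose[OF _ f_meas, of "\<lambda>x. (t, x)" borel] by simp
      show "(\<integral>\<^sup>+x. ennreal (exp (- l * t) * hat (real n * (x - z))) * (ennreal (f t x y) * indicator ({0<..} \<times> I) (t, x)) \<partial>lborel)
        = ennreal (1 / real n) * (\<integral>\<^sup>+r. Fn l n (t, r) \<partial>lborel)"
        using n by (subst nn_integral_real_affine[where c="1 / real n" and t=z]) (auto simp: Fn_def)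
    qed
    also have "\<dots> = ennreal (1 / real n) * (\<integral>\<^sup>+p. Fn l n p \<partial>?L)"
      by (subst nn_integral_cmult) (auto simp: lborel.nn_integral_fst)
    finally have "resolvent_nn l (hat_at (real n) z) y = ennreal (1 / real n) * (\<integral>\<^sup>+p. Fn l n p \<partial>?L)" .
    then have "ennreal (real n) * resolvent_nn l (hat_at (real n) z) y = (\<integral>\<^sup>+p. Fn l n p \<partial>?L)"
      using n by (simp add: mult.assoc[symmetric] ennreal_mult[symmetric])
    then show ?thesis
      using l y n by (simp add: ennreal_mult resolvent_nonneg ennreal_resolvent hat_range)
  qed
  have lim: "(\<lambda>n. Fn l n p) \<longlonglongrightarrow> F l p" for l p
  proof (cases "fst p > 0")
    case True
    have s: "(\<lambda>n. z + snd p / real n) \<longlonglongrightarrow> z"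
      using tendsto_add[OF tendsto_const[of z] tendsto_divide_0[OF tendsto_const[of "snd p"] filterlim_real_sequentially[THEN filterlim_mono, OF at_top_le_at_infinity order_refl]]]
      by simp
    then have ev: "\<forall>\<^sub>F n in sequentially. z + snd p / real n \<in> I"
      using z by (intro topological_tendstoD[OF s]) auto
    have "(\<lambda>n. (\<lambda>(t, x, y). f t x y) (fst p, z + snd p / real n, y)) \<longlonglongrightarrow> (\<lambda>(t, x, y). f t x y) (fst p, z, y)"
      using True y z ev by (intro continuous_on_tendsto_compose[OF f_continuous] tendsto_intros s) (auto elim: eventually_mono)
    then have "(\<lambda>n. ennreal (exp (- l * fst p) * hat (snd p)) * ennreal (f (fst p) (z + snd p / real n) y))
      \<longlonglongrightarrow> ennreal (exp (- l * fst p) * hat (snd p)) * ennreal (f (fst p) z y)"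
      by (intro ennreal_tendsto_cmult tendsto_ennrealI) auto
    then have "(\<lambda>n. Fn l n p) \<longlonglongrightarrow> ennreal (exp (- l * fst p) * hat (snd p)) * ennreal (f (fst p) z y)"
      by (rule Lim_transform_eventually) (use ev True in \<open>auto elim!: eventually_mono simp: Fn_def\<close>)
    then show ?thesis using True by (simp add: F_def)
  next
    case False
    then show ?thesis by (simp add: F_def Fn_def)
  qed
  have hat_fin: "(\<integral>\<^sup>+r. ennreal (hat r) \<partial>lborel) \<le> 2"
  proof -
    have "(\<integral>\<^sup>+r. ennreal (hat r) \<partial>lborel) \<le> (\<integral>\<^sup>+r. indicator {-1..1::real} r \<partial>lborel)"
      by (intro nn_integral_mono) (auto split: split_indicator simp: hat_def ennreal_neg)
    then show ?thesis by simp
  qed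
  have FF: "(\<integral>\<^sup>+p. F l p \<partial>?L) = (\<integral>\<^sup>+r. ennreal (hat r) \<partial>lborel) * (\<integral>\<^sup>+t\<in>{0<..}. ennreal (exp (- l * t) * f t z y) \<partial>lborel)" for l
  proof -
    have "(\<integral>\<^sup>+p. F l p \<partial>?L) = (\<integral>\<^sup>+t. (\<integral>\<^sup>+r. ennreal (hat r) * (ennreal (exp (- l * t) * f t z y) * indicator {0<..} t) \<partial>lborel) \<partial>lborel)"
      by (subst lborel.nn_integral_fst[symmetric], measurable)
         (auto intro!: nn_integral_cong simp: F_def ennreal_mult'' f_nonneg y z ennreal_mult hat_range mult_ac split: split_indicator)
    also have "\<dots> = (\<integral>\<^sup>+t. (\<integral>\<^sup>+r. ennreal (hat r) \<partial>lborel) * (ennreal (exp (- l * t) * f t z y) * indicator {0<..} t) \<partial>lborel)"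
      by (intro nn_integral_cong nn_integral_multc) measurable
    also have "\<dots> = (\<integral>\<^sup>+r. ennreal (hat r) \<partial>lborel) * (\<integral>\<^sup>+t\<in>{0<..}. ennreal (exp (- l * t) * f t z y) \<partial>lborel)"
    proof (rule nn_integral_cmult)
      have "(\<lambda>t. ennreal (exp (- l * t) * f t z y) * indicator {0<..} t) = (\<lambda>t. ennreal (exp (- l * t)) * (ennreal (f t z y) * indicator {0<..} t))"
        using f_nonneg y z by (auto simp: fun_eq_iff ennreal_mult'' split: split_indicator)
      then show "(\<lambda>t. ennreal (exp (- l * t) * f t z y) * indicator {0<..} t) \<in> borel_measurable lborel" by simp
    qed
    finally show ?thesis .
  qed
  obtain C M where C: "\<And>m. m \<ge> M \<Longrightarrow> m * resolvent lam (hat_at m z) y \<le> C"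
    using resolvent_hat_upper[OF lam y z] by blast
  have "lam / 2 > 0" using lam by simp
  from resolvent_hat_upper[OF this y z]
  obtain C' M' where C': "\<And>m. m \<ge> M' \<Longrightarrow> m * resolvent (lam / 2) (hat_at m z) y \<le> C'" by blast
  have pos: "\<forall>\<^sub>F n in sequentially. n > 0" by (rule eventually_gt_at_top)
  have evM: "\<forall>\<^sub>F n in sequentially. real n \<ge> K" for K :: real
    using filterlim_real_sequentially unfolding filterlim_at_top by blast
  \<comment> \<open>Fatou gives one half of the limit. Together with the uniform bound
    \<open>C\<close> it also makes the limit finite, without which the return to real numbers by
    \<open>enn2real\<close> would not be continuous.\<close>
  have "(\<integral>\<^sup>+p. F lam p \<partial>?L) \<le> liminf (\<lambda>n. \<integral>\<^sup>+p. Fn lam n p \<partial>?L)"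
  proof -
    have "(\<integral>\<^sup>+p. F lam p \<partial>?L) = (\<integral>\<^sup>+p. liminf (\<lambda>n. Fn lam n p) \<partial>?L)"
      by (intro nn_integral_cong lim_imp_Liminf[symmetric] lim) simp
    also have "\<dots> \<le> liminf (\<lambda>n. \<integral>\<^sup>+p. Fn lam n p \<partial>?L)" by (rule nn_integral_liminf) measurable
    finally show ?thesis .
  qed
  note lower = this
  have "liminf (\<lambda>n. \<integral>\<^sup>+p. Fn lam n p \<partial>?L) \<le> ennreal C"
  proof (rule order_trans[OF Liminf_le_Limsup Limsup_bounded])
    show "\<forall>\<^sub>F n in sequentially. (\<integral>\<^sup>+p. Fn lam n p \<partial>?L) \<le> ennreal C"
      using pos evM[of M] by eventually_elim (use C in \<open>auto simp: V[OF lam, symmetric] intro!: ennreal_leI\<close>)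
  qed simp
  with lower have "(\<integral>\<^sup>+p. F lam p \<partial>?L) \<le> ennreal C" by (rule order_trans)
  then have F_fin: "(\<integral>\<^sup>+p. F lam p \<partial>?L) < top" using le_less_trans ennreal_less_top by blast
  have upper: "limsup (\<lambda>n. \<integral>\<^sup>+p. Fn lam n p \<partial>?L) \<le> (\<integral>\<^sup>+p. F lam p \<partial>?L) + ennreal (exp (- (lam / 2) * real N)) * ennreal C'" for N :: nat
  proof -
    let ?i = "\<lambda>p. indicator {..real N} (fst p :: real) :: ennreal"
    obtain B \<rho> where B: "\<rho> > 0" "\<And>t x. 0 < t \<Longrightarrow> t \<le> real N \<Longrightarrow> \<bar>x - z\<bar> \<le> \<rho> \<Longrightarrow> x \<in> I \<and> f t x y \<le> B"
      using f_locally_bounded[OF y z yz, of "real N"] by blast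
    define R where "R = (\<lambda>p::real \<times> real. ennreal (max 0 B) * indicator ({0..real N} \<times> {-1..1}) p)"
    \<comment> \<open>From index \<open>Suc K\<close> on, \<open>z + r / n\<close> with
      \<open>\<bar>r\<bar> \<le> 1\<close> stays in the neighbourhood where the density is bounded;
      the index shift is undone after the limit.\<close>
    obtain K where K: "real K \<ge> 1 / \<rho>" using real_arch_simple by blast
    have conv: "(\<lambda>n. \<integral>\<^sup>+p. Fn lam (n + Suc K) p * ?i p \<partial>?L) \<longlonglongrightarrow> (\<integral>\<^sup>+p. F lam p * ?i p \<partial>?L)"
    proof (rule nn_integral_dominated_convergence[where w=R])
      show "AE p in ?L. Fn lam (n + Suc K) p * ?i p \<le> R p" for n
      proof (rule AE_I2)
        fix p :: "real \<times> real"
        show "Fn lam (n + Suc K) p * ?i p \<le> R p"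
        proof (cases "0 < fst p \<and> fst p \<le> real N \<and> snd p \<in> {-1..1}")
          case True
          let ?m = "real (n + Suc K)"
          have "1 / \<rho> \<le> ?m" using K by simp
          then have "1 / ?m \<le> \<rho>" using B(1) by (simp add: field_simps)
          moreover have "\<bar>snd p / ?m\<bar> \<le> 1 / ?m"
            using True unfolding abs_divide by (intro frac_le) (auto simp: abs_le_iff)
          ultimately have "f (fst p) (z + snd p / ?m) y \<le> B" using B(2)[of "fst p" "z + snd p / ?m"] True by auto
          then have "ennreal (f (fst p) (z + snd p / ?m) y) \<le> ennreal (max 0 B)" by (intro ennreal_leI) auto
          moreover have "ennreal (exp (- lam * fst p) * hat (snd p)) \<le> 1"
            using True lam hat_range[of "snd p"] by (intro ennreal_le_1[THEN iffD2] mult_le_one) auto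
          ultimately have "ennreal (exp (- lam * fst p) * hat (snd p)) * (ennreal (f (fst p) (z + snd p / ?m) y) * indicator ({0<..} \<times> I) (fst p, z + snd p / ?m))
            \<le> 1 * (ennreal (max 0 B) * 1)"
            by (intro mult_mono) (auto split: split_indicator)
          then show ?thesis using True by (cases p) (simp add: R_def Fn_def)
        next
          case False
          then have "Fn lam (n + Suc K) p * ?i p = 0" by (auto simp: Fn_def hat_def split: split_indicator)
          then show ?thesis by (simp only: zero_le)
        qed
      qed
      have "(\<integral>\<^sup>+p. R p \<partial>?L) = ennreal (max 0 B) * emeasure ?L ({0..real N} \<times> {-1..1})"
        unfolding R_def by (rule nn_integral_cmult_indicator) simp
      also have "\<dots> < \<infinity>"
        by (subst lborel.emeasure_pair_measure_Times) (auto simp: ennreal_mult_less_top)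
      finally show "(\<integral>\<^sup>+p. R p \<partial>?L) < \<infinity>" .
      show "AE p in ?L. (\<lambda>n. Fn lam (n + Suc K) p * ?i p) \<longlonglongrightarrow> F lam p * ?i p"
        by (intro AE_I2 tendsto_mult_ennreal LIMSEQ_ignore_initial_segment[OF lim] tendsto_const)
           (auto simp: F_def ennreal_mult_eq_top_iff split: split_indicator)
    qed (auto simp: R_def)
    have conv': "(\<lambda>n. \<integral>\<^sup>+p. Fn lam n p * ?i p \<partial>?L) \<longlonglongrightarrow> (\<integral>\<^sup>+p. F lam p * ?i p \<partial>?L)"
      using conv by (rule LIMSEQ_offset)
    \<comment> \<open>Beyond time \<open>N\<close> one half of the exponent is replaced by its value
      at \<open>N\<close>, the other half remains as the kernel with parameter
      \<open>lam / 2\<close>.\<close>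
    have tail: "Fn lam n p \<le> Fn lam n p * ?i p + ennreal (exp (- (lam / 2) * real N)) * Fn (lam / 2) n p" for n p
    proof (cases "fst p \<le> real N")
      case False
      have "exp (- lam * fst p) \<le> exp (- (lam / 2) * real N) * exp (- (lam / 2) * fst p)"
        using False lam by (simp add: exp_add[symmetric] field_simps)
      then have "exp (- lam * fst p) * hat (snd p) \<le> exp (- (lam / 2) * real N) * exp (- (lam / 2) * fst p) * hat (snd p)"
        by (intro mult_right_mono hat_range)
      then have "ennreal (exp (- lam * fst p) * hat (snd p)) \<le> ennreal (exp (- (lam / 2) * real N)) * ennreal (exp (- (lam / 2) * fst p) * hat (snd p))"
        by (simp add: ennreal_mult[symmetric] hat_range mult.assoc ennreal_leI)
      then have "Fn lam n p \<le> ennreal (exp (- (lam / 2) * real N)) * Fn (lam / 2) n p"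
        unfolding Fn_def mult.assoc[symmetric] by (intro mult_right_mono) auto
      then show ?thesis using False by simp
    qed simp
    have "limsup (\<lambda>n. \<integral>\<^sup>+p. Fn lam n p \<partial>?L) \<le> limsup (\<lambda>n. (\<integral>\<^sup>+p. Fn lam n p * ?i p \<partial>?L) + ennreal (exp (- (lam / 2) * real N)) * ennreal C')"
    proof (rule Limsup_mono)
      show "\<forall>\<^sub>F n in sequentially. (\<integral>\<^sup>+p. Fn lam n p \<partial>?L) \<le> (\<integral>\<^sup>+p. Fn lam n p * ?i p \<partial>?L) + ennreal (exp (- (lam / 2) * real N)) * ennreal C'"
        using pos evM[of M']
      proof eventually_elim
        case (elim n)
        have "(\<integral>\<^sup>+p. Fn lam n p \<partial>?L) \<le> (\<integral>\<^sup>+p. Fn lam n p * ?i p + ennreal (exp (- (lam / 2) * real N)) * Fn (lam / 2) n p \<partial>?L)"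
          by (intro nn_integral_mono tail)
        also have "\<dots> = (\<integral>\<^sup>+p. Fn lam n p * ?i p \<partial>?L) + ennreal (exp (- (lam / 2) * real N)) * (\<integral>\<^sup>+p. Fn (lam / 2) n p \<partial>?L)"
          by (subst nn_integral_add) (auto simp: nn_integral_cmult)
        also have "(\<integral>\<^sup>+p. Fn (lam / 2) n p \<partial>?L) \<le> ennreal C'"
          using elim C' lam by (auto simp: V[symmetric] intro!: ennreal_leI)
        finally show ?case by (simp add: add_left_mono mult_left_mono)
      qed
    qed
    also have "\<dots> = (\<integral>\<^sup>+p. F lam p * ?i p \<partial>?L) + ennreal (exp (- (lam / 2) * real N)) * ennreal C'"
      by (intro lim_imp_Limsup tendsto_add conv') auto
    also have "(\<integral>\<^sup>+p. F lam p * ?i p \<partial>?L) \<le> (\<integral>\<^sup>+p. F lam p \<partial>?L)"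
      by (intro nn_integral_mono) (auto split: split_indicator)
    finally show ?thesis by (simp add: add_right_mono)
  qed
  \<comment> \<open>The estimate holds for every cut-off \<open>N\<close>, and the tail term
    vanishes as \<open>N\<close> grows.\<close>
  have "limsup (\<lambda>n. \<integral>\<^sup>+p. Fn lam n p \<partial>?L) \<le> (\<integral>\<^sup>+p. F lam p \<partial>?L) + ennreal 0 * ennreal C'"
  proof (rule LIMSEQ_le_const)
    have "(\<lambda>N. exp (- (lam / 2) * real N)) \<longlonglongrightarrow> 0"
    proof -
      have "(\<lambda>N. exp (- (lam / 2)) ^ N) \<longlonglongrightarrow> 0" using lam by (intro LIMSEQ_power_zero) auto
      then show ?thesis by (simp add: exp_of_nat_mult[symmetric] mult.commute)
    qed
    then show "(\<lambda>N. (\<integral>\<^sup>+p. F lam p \<partial>?L) + ennreal (exp (- (lam / 2) * real N)) * ennreal C') \<longlonglongrightarrow> (\<integral>\<^sup>+p. F lam p \<partial>?L) + ennreal 0 * ennreal C'"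
      by (intro tendsto_add tendsto_const tendsto_mult_ennreal tendsto_ennrealI) auto
  qed (use upper in auto)
  then have "limsup (\<lambda>n. \<integral>\<^sup>+p. Fn lam n p \<partial>?L) \<le> (\<integral>\<^sup>+p. F lam p \<partial>?L)" by simp
  with lower Liminf_le_Limsup[of sequentially "\<lambda>n. \<integral>\<^sup>+p. Fn lam n p \<partial>?L"]
  have "liminf (\<lambda>n. \<integral>\<^sup>+p. Fn lam n p \<partial>?L) = (\<integral>\<^sup>+p. F lam p \<partial>?L)"
    "limsup (\<lambda>n. \<integral>\<^sup>+p. Fn lam n p \<partial>?L) = (\<integral>\<^sup>+p. F lam p \<partial>?L)"
    by (auto intro: antisym order_trans)
  then have "(\<lambda>n. \<integral>\<^sup>+p. Fn lam n p \<partial>?L) \<longlonglongrightarrow> (\<integral>\<^sup>+p. F lam p \<partial>?L)"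
    by (intro Liminf_eq_Limsup) auto
  then have "(\<lambda>n. enn2real (\<integral>\<^sup>+p. Fn lam n p \<partial>?L)) \<longlonglongrightarrow> enn2real (\<integral>\<^sup>+p. F lam p \<partial>?L)"
    using F_fin by (intro tendsto_enn2real) auto
  moreover have "enn2real (\<integral>\<^sup>+p. F lam p \<partial>?L) = \<kappa> * laplace lam (\<lambda>t. f t z y)"
    unfolding FF \<kappa>_def enn2real_mult
    by (subst laplace_eq_nn_integral[OF f_slice_measurable[OF y z]]) (auto simp: f_nonneg y z)
  moreover have "\<forall>\<^sub>F n in sequentially. enn2real (\<integral>\<^sup>+p. Fn lam n p \<partial>?L) = real n * resolvent lam (hat_at (real n) z) y"
    using pos by eventually_elim (simp add: V[OF lam, symmetric] resolvent_nonneg)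
  ultimately show ?thesis by (simp add: Lim_transform_eventually)
qed

end

section \<open>The two-barrier formulas\<close>

lemma cramer_2x2:
  fixes p q :: real
  assumes "u = p * ua + q * ub" "w = p * wa + q * wb" and D: "ua * wb - ub * wa \<noteq> 0"
  shows "p = (u * wb - ub * w) / (ua * wb - ub * wa)" "q = (ua * w - u * wa) / (ua * wb - ub * wa)"
proof -
  have "p * (ua * wb - ub * wa) = u * wb - ub * w" "q * (ua * wb - ub * wa) = ua * w - u * wa"
    unfolding assms(1,2) by (simp_all add: algebra_simps)
  with D show "p = (u * wb - ub * w) / (ua * wb - ub * wa)" "q = (ua * w - u * wa) / (ua * wb - ub * wa)"
    by (simp_all add: eq_divide_eq)
qed

context regular_diffusion
begin

definition exit_laplace :: "real \<Rightarrow> real \<Rightarrow> real \<Rightarrow> real \<Rightarrow> real"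
  where "exit_laplace lam c d x = enn2real (\<integral>\<^sup>+\<omega>\<in>{\<omega> \<in> space \<Omega>. H c \<omega> < H d \<omega>}.
    discount lam (H c \<omega>) \<partial>P x)"

lemma exit_laplace_finite:
  assumes "lam > 0" "x \<in> I"
  shows "(\<integral>\<^sup>+\<omega>\<in>{\<omega> \<in> space \<Omega>. H c \<omega> < H d \<omega>}.
    discount lam (H c \<omega>) \<partial>P x) < top"
proof -
  interpret prob_space "P x" using prob_space_P assms by simp
  have "(\<integral>\<^sup>+\<omega>\<in>{\<omega> \<in> space \<Omega>. H c \<omega> < H d \<omega>}.
    discount lam (H c \<omega>) \<partial>P x) \<le> (\<integral>\<^sup>+\<omega>. 1 \<partial>P x)"
    using discount_le_1[OF assms(1)] by (intro nn_integral_mono) (auto split: split_indicator)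
  then show ?thesis using le_less_trans[OF _ ennreal_one_less_top] by (simp add: emeasure_space_1)
qed

lemma resolvent_two_barriers:
  assumes lam: "lam > 0" and a: "a \<in> I" and b: "b \<in> I" and ab: "a < x" "x < b"
    and g: "g \<in> borel_measurable borel" and g1: "\<And>u. g u \<le> 1" and zero: "\<And>u. a < u \<Longrightarrow> u < b \<Longrightarrow> g u = 0"
  shows "resolvent lam g x = exit_laplace lam a b x * resolvent lam g a + exit_laplace lam b a x * resolvent lam g b"
proof -
  have x: "x \<in> I" using Icc_subset_I[OF a b] ab by auto
  have fin: "resolvent_nn lam g y < top" if "y \<in> I" for y
    using resolvent_nn_le[of lam y g, OF lam that g1] le_less_trans ennreal_less_top by blast
  have "resolvent lam g x = enn2real
    ((\<integral>\<^sup>+\<omega>\<in>{\<omega> \<in> space \<Omega>. H a \<omega> < H b \<omega>}. discount lam (H a \<omega>) \<partial>P x) * resolvent_nn lam g a +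
     (\<integral>\<^sup>+\<omega>\<in>{\<omega> \<in> space \<Omega>. H b \<omega> < H a \<omega>}. discount lam (H b \<omega>) \<partial>P x) * resolvent_nn lam g b)"
    unfolding resolvent_def using resolvent_nn_two_barriers[OF a b ab g zero, of lam] by simp
  also have "\<dots> = exit_laplace lam a b x * resolvent lam g a + exit_laplace lam b a x * resolvent lam g b"
    unfolding resolvent_def exit_laplace_def enn2real_mult[symmetric]
    by (intro enn2real_plus)
       (simp_all add: ennreal_mult_less_top fin[OF a] fin[OF b] exit_laplace_finite[OF lam x])
  finally show ?thesis .
qed

lemma laplace_hitting_density:
  assumes "y \<in> I" "time_density_on (P y) (H z) (space \<Omega>) g"
  shows "laplace lam g = hitting_laplace lam z y"
proof -
  have "space \<Omega> \<in> sets (P y)" using sets_P[OF assms(1)] by simp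
  then have "laplace lam g = enn2real (\<integral>\<^sup>+\<omega>\<in>space \<Omega>. discount lam (H z \<omega>) \<partial>P y)"
    using assms by (intro time_density_on_laplace[OF assms(2)]) auto
  also have "(\<integral>\<^sup>+\<omega>\<in>space \<Omega>. discount lam (H z \<omega>) \<partial>P y) = hitting_discount lam z y"
    unfolding hitting_discount_def by (intro nn_integral_cong) (simp add: space_P[OF assms(1)])
  finally show ?thesis by (simp add: hitting_laplace_def)
qed

lemma laplace_exit_density:
  assumes x: "x \<in> I" and "time_density_on (P x) (H c)
    {\<omega> \<in> space \<Omega>. H c \<omega> < H d \<omega>} g"
  shows "laplace lam g = exit_laplace lam c d x"
  unfolding exit_laplace_def
proof (rule time_density_on_laplace[OF assms(2)])
  show "{\<omega> \<in> space \<Omega>. H c \<omega> < H d \<omega>} \<in> sets (P x)"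
    unfolding sets_P[OF x] by measurable
qed (use x in measurable)

end

context diffusion_with_density
begin

text \<open>Since \<open>g\<close> vanishes between the barriers, \<open>w\<close> is there at once
  a supersolution and a subsolution with the boundary values of the resolvent, and the two
  comparisons pinch it.\<close>

lemma resolvent_eq_backward_solution:
  assumes lam: "lam > 0" and a: "a \<in> I" and b: "b \<in> I" and ab: "a < x" "x < b"
    and g: "g \<in> borel_measurable borel" and g01: "\<And>u. 0 \<le> g u" "\<And>u. g u \<le> 1"
    and zero: "\<And>u. a < u \<Longrightarrow> u < b \<Longrightarrow> g u = 0"
    and w: "solves_backward \<mu> \<sigma> I lam w" and bd: "w a = resolvent lam g a" "w b = resolvent lam g b"
  shows "resolvent lam g x = w x"
proof -
  have sub: "{a..b} \<subseteq> I" by (rule Icc_subset_I[OF a b])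
  have cont: "continuous_on {a..b} (resolvent lam g)"
    using continuous_on_resolvent[OF lam g g01] continuous_on_subset[OF _ sub] by blast
  from w obtain w' w'' where
    w: "\<And>x. x \<in> I \<Longrightarrow> (w has_real_derivative w' x) (at x) \<and> (w' has_real_derivative w'' x) (at x) \<and>
       1/2 * \<sigma> x * w'' x + \<mu> x * w' x - lam * w x = 0"
    unfolding solves_backward_def by metis
  have ode: "1/2 * \<sigma> u * w'' u + \<mu> u * w' u = lam * w u" if "a < u" "u < b" for u
  proof -
    have "u \<in> I" using that sub by auto
    then show ?thesis using w[of u] by simp
  qed
  have isCont_g: "isCont g u" if "a < u" "u < b" for u
  proof -
    have "\<forall>\<^sub>F v in nhds u. v \<in> {a<..<b}" using that by (intro eventually_nhds_in_open) auto
    then have "\<forall>\<^sub>F v in nhds u. g v = 0" by eventually_elim (use zero in auto)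
    then show ?thesis using isCont_cong[of g "\<lambda>_. 0" u] by simp
  qed
  have x: "x \<in> {a..b}" using ab by simp
  show ?thesis
  proof (rule antisym)
    show "resolvent lam g x \<le> w x"
      by (rule resolvent_le_supersolution[OF lam sub g g01 cont _ _ isCont_g, where w'=w' and w''=w''])
         (use w sub bd x ode zero in \<open>auto\<close>)
    show "w x \<le> resolvent lam g x"
      by (rule resolvent_ge_subsolution[OF lam sub g g01 cont _ _ isCont_g, where w'=w' and w''=w''])
         (use w sub bd x ode zero in \<open>auto\<close>)
  qed
qed

lemma eventually_hat_at_support:
  assumes "d > 0"
  shows "\<forall>\<^sub>F n in sequentially. \<forall>x. hat_at (real n) z x \<noteq> 0 \<longrightarrow> \<bar>x - z\<bar> < d"
proof -
  have "\<forall>\<^sub>F n in sequentially. real n \<ge> 1 / d"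
    using filterlim_real_sequentially unfolding filterlim_at_top by blast
  then show ?thesis using eventually_gt_at_top[of 0]
  proof eventually_elim
    case (elim n)
    then have "1 / real n \<le> d" using assms by (simp add: field_simps)
    then show ?case using hat_scaled_eq_0[of "real n" _ z] elim by force
  qed
qed

text \<open>The area of the tent is never computed: a positive product shows that neither the area
  nor the transform vanishes.\<close>

lemma density_laplace_pos:
  assumes lam: "lam > 0" and y: "y \<in> I" and z: "z \<in> I" and yz: "y \<noteq> z"
  shows "0 < enn2real (\<integral>\<^sup>+r. ennreal (hat r) \<partial>lborel) * laplace lam (\<lambda>t. f t z y)"
proof -
  obtain c M where c: "c > 0" "\<And>m. m \<ge> M \<Longrightarrow> c \<le> m * resolvent lam (hat_at m z) y"
    using resolvent_hat_lower[OF assms] by blast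
  have "\<forall>\<^sub>F n in sequentially. real n \<ge> M"
    using filterlim_real_sequentially unfolding filterlim_at_top by blast
  then have "\<forall>\<^sub>F n in sequentially. c \<le> real n * resolvent lam (hat_at (real n) z) y"
    by eventually_elim (rule c(2))
  then have "c \<le> enn2real (\<integral>\<^sup>+r. ennreal (hat r) \<partial>lborel) * laplace lam (\<lambda>t. f t z y)"
    by (intro tendsto_lowerbound[OF resolvent_hat_tendsto[OF assms]]) auto
  then show ?thesis using c(1) by simp
qed

text \<open>A linear relation between resolvents at several starting points, valid for all
  \<open>g\<close> supported near \<open>z\<close>, survives the limit along tents at
  \<open>z\<close>; the common area factor cancels. Both passage relations for the density are
  instances.\<close>

lemma density_laplace_linear:
  assumes lam: "lam > 0" and z: "z \<in> I" and d: "d > 0"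
    and y: "x \<in> I" "x \<noteq> z" "a \<in> I" "a \<noteq> z" "b \<in> I" "b \<noteq> z"
    and rel: "\<And>g. g \<in> borel_measurable borel \<Longrightarrow> (\<And>u. g u \<le> 1) \<Longrightarrow> (\<And>u. g u \<noteq> 0 \<Longrightarrow> \<bar>u - z\<bar> < d) \<Longrightarrow>
      resolvent lam g x = p * resolvent lam g a + q * resolvent lam g b"
  shows "laplace lam (\<lambda>t. f t z x) = p * laplace lam (\<lambda>t. f t z a) + q * laplace lam (\<lambda>t. f t z b)"
proof -
  define \<kappa> where "\<kappa> = enn2real (\<integral>\<^sup>+r. ennreal (hat r) \<partial>lborel)"
  have "\<kappa> \<noteq> 0" using density_laplace_pos[OF lam y(1) z y(2)] by (auto simp: \<kappa>_def)
  let ?u = "\<lambda>n y. real n * resolvent lam (hat_at (real n) z) y"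
  have lim: "(\<lambda>n. ?u n y) \<longlonglongrightarrow> \<kappa> * laplace lam (\<lambda>t. f t z y)" if "y \<in> I" "y \<noteq> z" for y
    unfolding \<kappa>_def by (rule resolvent_hat_tendsto[OF lam that(1) z that(2)])
  from eventually_hat_at_support[OF d, of z]
  have "\<forall>\<^sub>F n in sequentially. ?u n x = p * ?u n a + q * ?u n b"
  proof eventually_elim
    case (elim n)
    then have "resolvent lam (hat_at (real n) z) x =
      p * resolvent lam (hat_at (real n) z) a + q * resolvent lam (hat_at (real n) z) b"
      by (intro rel) (auto simp: hat_range)
    then show ?case by (simp add: algebra_simps)
  qed
  from Lim_transform_eventually[OF lim[OF y(1,2)] this]
  have "(\<lambda>n. p * ?u n a + q * ?u n b) \<longlonglongrightarrow> \<kappa> * laplace lam (\<lambda>t. f t z x)" .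
  moreover have "(\<lambda>n. p * ?u n a + q * ?u n b) \<longlonglongrightarrow>
    p * (\<kappa> * laplace lam (\<lambda>t. f t z a)) + q * (\<kappa> * laplace lam (\<lambda>t. f t z b))"
    by (intro tendsto_intros lim y)
  ultimately have "\<kappa> * laplace lam (\<lambda>t. f t z x) =
    \<kappa> * (p * laplace lam (\<lambda>t. f t z a) + q * laplace lam (\<lambda>t. f t z b))"
    using LIMSEQ_unique by (fastforce simp: algebra_simps)
  then show ?thesis using \<open>\<kappa> \<noteq> 0\<close> by simp
qed

lemma density_laplace_two_barriers:
  assumes lam: "lam > 0" and a: "a \<in> I" and b: "b \<in> I" and ab: "a < x" "x < b"
    and z: "z \<in> I" and out: "z < a \<or> b < z"
  shows "laplace lam (\<lambda>t. f t z x) =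
    exit_laplace lam a b x * laplace lam (\<lambda>t. f t z a) + exit_laplace lam b a x * laplace lam (\<lambda>t. f t z b)"
proof (rule density_laplace_linear[OF lam z, where d="if z < a then a - z else z - b"])
  fix g assume g: "g \<in> borel_measurable borel" "\<And>u. g u \<le> (1::real)"
    and supp: "\<And>u. g u \<noteq> 0 \<Longrightarrow> \<bar>u - z\<bar> < (if z < a then a - z else z - b)"
  show "resolvent lam g x = exit_laplace lam a b x * resolvent lam g a + exit_laplace lam b a x * resolvent lam g b"
  proof (rule resolvent_two_barriers[OF lam a b ab g])
    show "g u = 0" if "a < u" "u < b" for u
      by (rule ccontr) (use supp[of u] that out in \<open>auto simp: abs_if split: if_splits\<close>)
  qed
next
  show "x \<in> I" using Icc_subset_I[OF a b] ab by auto
qed (use a b ab out in auto)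

lemma density_laplace_through:
  assumes lam: "lam > 0" and y: "y \<in> I" and x: "x \<in> I" and z: "z \<in> I"
    and sep: "y < x \<and> x < z \<or> z < x \<and> x < y"
  shows "laplace lam (\<lambda>t. f t z y) = hitting_laplace lam x y * laplace lam (\<lambda>t. f t z x)"
proof -
  \<comment> \<open>A one-barrier relation is the two-barrier form with the second coefficient
    0.\<close>
  have "laplace lam (\<lambda>t. f t z y) = hitting_laplace lam x y * laplace lam (\<lambda>t. f t z x) + 0 * laplace lam (\<lambda>t. f t z x)"
  proof (rule density_laplace_linear[OF lam z, where d="\<bar>x - z\<bar>"])
    fix g assume "g \<in> borel_measurable borel" and supp: "\<And>u. g u \<noteq> (0::real) \<Longrightarrow> \<bar>u - z\<bar> < \<bar>x - z\<bar>"
    then have "resolvent lam g y = hitting_laplace lam x y * resolvent lam g x"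
    proof (intro resolvent_through[OF y x])
      show "x \<in> closed_segment y u" if "g u \<noteq> 0" for u
        using supp[OF that] sep by (auto simp: closed_segment_eq_real_ivl abs_if split: if_splits)
    qed
    then show "resolvent lam g y = hitting_laplace lam x y * resolvent lam g x + 0 * resolvent lam g x" by simp
  qed (use x y sep in auto)
  then show ?thesis by simp
qed

lemma density_laplace_nonzero:
  assumes "lam > 0" "y \<in> I" "z \<in> I" "y \<noteq> z"
  shows "laplace lam (\<lambda>t. f t z y) \<noteq> 0"
  using density_laplace_pos[OF assms] by auto

end

theorem corollary3p1:
  fixes \<Omega> :: "'w measure" and P :: "real \<Rightarrow> 'w measure" and X :: "real \<Rightarrow> 'w \<Rightarrow> real"
    and r1 r2 :: ereal and \<mu> \<sigma> :: "real \<Rightarrow> real"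
    and a b x0 lam :: real
    and f :: "real \<Rightarrow> real \<Rightarrow> real \<Rightarrow> real"
    and fTa fTb :: "real \<Rightarrow> real \<Rightarrow> real"
    and ga gb :: "real \<Rightarrow> real"
    and v1 v2 :: "real \<Rightarrow> real \<Rightarrow> real"
  assumes diffusion: "regular_diffusion \<Omega> P X r1 r2 \<mu> \<sigma>"
    and boundaries: "a \<in> einterval r1 r2" "b \<in> einterval r1 r2" "a < x0" "x0 < b"
    and lam: "lam > 0"
    and f: "transition_density P X (einterval r1 r2) f"
    and fTa: "\<And>y. y \<in> einterval r1 r2 \<Longrightarrow> y \<noteq> a \<Longrightarrow>
               time_density_on (P y) (hitting_time X a) (space \<Omega>) (\<lambda>t. fTa t y)"
    and fTb: "\<And>y. y \<in> einterval r1 r2 \<Longrightarrow> y \<noteq> b \<Longrightarrow>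
               time_density_on (P y) (hitting_time X b) (space \<Omega>) (\<lambda>t. fTb t y)"
    and ga: "time_density_on (P x0) (hitting_time X a)
               {\<omega> \<in> space \<Omega>. hitting_time X a \<omega> < hitting_time X b \<omega>} ga"
    and gb: "time_density_on (P x0) (hitting_time X b)
               {\<omega> \<in> space \<Omega>. hitting_time X a \<omega> > hitting_time X b \<omega>} gb"
    and v: "fundamental_solutions \<mu> \<sigma> (einterval r1 r2) lam (v1 lam) (v2 lam)"
  shows "let FX = \<lambda>x y. laplace lam (\<lambda>t. transition_cdf \<Omega> P X t x y);
             fX = \<lambda>x y. laplace lam (\<lambda>t. f t x y);
             LTa = \<lambda>y. laplace lam (\<lambda>t. fTa t y);
             LTb = \<lambda>y. laplace lam (\<lambda>t. fTb t y);
             Ga = laplace lam ga;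
             Gb = laplace lam gb
         in
           (Ga = (LTb x0 * LTa b - LTa x0) / (LTa b * LTb a - 1) \<and>
            Gb = (LTa x0 * LTb a - LTb x0) / (LTa b * LTb a - 1)) \<and>
           (Ga = ((1 - lam * FX b x0) * FX a b - (1 - lam * FX b b) * FX a x0) /
                 ((1 - lam * FX b a) * FX a b - (1 - lam * FX b b) * FX a a) \<and>
            Gb = ((1 - lam * FX b x0) * FX a a - (1 - lam * FX b a) * FX a x0) /
                 ((1 - lam * FX b b) * FX a a - (1 - lam * FX b a) * FX a b)) \<and>
           (\<forall>x1\<in>einterval r1 r2. \<forall>x2\<in>einterval r1 r2. x1 > b \<longrightarrow> x2 < a \<longrightarrow>
              Ga = (fX x1 x0 * fX x2 b - fX x1 b * fX x2 x0) /
                   (fX x1 a * fX x2 b - fX x1 b * fX x2 a) \<and>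
              Gb = (fX x1 a * fX x2 x0 - fX x1 x0 * fX x2 a) /
                   (fX x1 a * fX x2 b - fX x1 b * fX x2 a)) \<and>
           (Ga = (v1 lam x0 * v2 lam b - v2 lam x0 * v1 lam b) /
                 (v1 lam a * v2 lam b - v2 lam a * v1 lam b) \<and>
            Gb = (v1 lam a * v2 lam x0 - v2 lam a * v1 lam x0) /
                 (v1 lam a * v2 lam b - v2 lam a * v1 lam b))"
proof -
  interpret regular_diffusion \<Omega> P X r1 r2 \<mu> \<sigma> by (rule diffusion)
  interpret diffusion_with_density \<Omega> P X r1 r2 \<mu> \<sigma> f by unfold_locales (rule f)
  define FX where "FX = (\<lambda>x y. laplace lam (\<lambda>t. transition_cdf \<Omega> P X t x y))"
  define fX where "fX = (\<lambda>x y. laplace lam (\<lambda>t. f t x y))"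
  define LTa where "LTa = (\<lambda>y. laplace lam (\<lambda>t. fTa t y))"
  define LTb where "LTb = (\<lambda>y. laplace lam (\<lambda>t. fTb t y))"
  define Ga where "Ga = laplace lam ga"
  define Gb where "Gb = laplace lam gb"
  note a = boundaries(1) and b = boundaries(2) and ab = boundaries(3,4)
  have x0: "x0 \<in> I" using Icc_subset_I[OF a b] ab by auto
  have Ga: "Ga = exit_laplace lam a b x0" unfolding Ga_def by (rule laplace_exit_density[OF x0 ga])
  have Gb: "Gb = exit_laplace lam b a x0" unfolding Gb_def by (rule laplace_exit_density[OF x0 gb])
  define \<phi>a where "\<phi>a = hitting_laplace lam a"
  define \<phi>b where "\<phi>b = hitting_laplace lam b"
  have LTa: "LTa y = \<phi>a y" if "y \<in> I" "y \<noteq> a" for y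
    unfolding LTa_def \<phi>a_def by (rule laplace_hitting_density[OF that(1) fTa[OF that]])
  have LTb: "LTb y = \<phi>b y" if "y \<in> I" "y \<noteq> b" for y
    unfolding LTb_def \<phi>b_def by (rule laplace_hitting_density[OF that(1) fTb[OF that]])
  have \<phi>\<phi>: "\<phi>b a * \<phi>a b < 1"
  proof -
    have "0 \<le> \<phi>b a" "\<phi>b a < 1" "0 \<le> \<phi>a b" "\<phi>a b < 1"
      using hitting_laplace_less_1[OF lam a, of b] hitting_laplace_less_1[OF lam b, of a] ab
      by (auto simp: \<phi>a_def \<phi>b_def)
    then show ?thesis using mult_strict_mono'[of "\<phi>b a" 1 "\<phi>a b" 1] by simp
  qed
  let ?l = "indicator {..a} :: real \<Rightarrow> real" and ?r = "indicator {b<..} :: real \<Rightarrow> real"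
  define L where "L = resolvent lam ?l"
  define R where "R = resolvent lam ?r"
  have ind01: "(0::real) \<le> indicator A u" "indicator A u \<le> (1::real)" for A and u :: real
    by (auto split: split_indicator)
  have Lzero: "?l u = 0" "?r u = 0" if "a < u" "u < b" for u using that by auto
  have L2: "L x0 = Ga * L a + Gb * L b" and R2: "R x0 = Ga * R a + Gb * R b"
    unfolding L_def R_def Ga Gb
    by (rule resolvent_two_barriers[OF lam a b ab]; auto intro: Lzero ind01 split: split_indicator)+
  have L\<phi>: "L y = \<phi>a y * L a" if "y \<in> I" "y \<ge> a" for y
    unfolding L_def \<phi>a_def using that a
    by (intro resolvent_through) (auto simp: closed_segment_eq_real_ivl split: split_indicator_asm)
  have R\<phi>: "R y = \<phi>b y * R b" if "y \<in> I" "y \<le> b" for y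
    unfolding R_def \<phi>b_def using that b
    by (intro resolvent_through) (auto simp: closed_segment_eq_real_ivl split: split_indicator_asm)
  have La: "L a > 0"
  proof -
    obtain z where z: "z \<in> I" "z < a" using I_contains_left[OF a] .
    have "\<forall>\<^sub>F u in nhds z. u \<in> {..<a}" using z by (intro eventually_nhds_in_open) auto
    then have "\<forall>\<^sub>F u in nhds z. ?l u = 1" by eventually_elim auto
    then show ?thesis unfolding L_def by (intro resolvent_pos[OF lam a z(1)]) (auto intro: ind01)
  qed
  have Rb: "R b > 0"
  proof -
    obtain z where z: "z \<in> I" "b < z" using I_contains_right[OF b] .
    have "\<forall>\<^sub>F u in nhds z. u \<in> {b<..}" using z by (intro eventually_nhds_in_open) auto
    then have "\<forall>\<^sub>F u in nhds z. ?r u = 1" by eventually_elim auto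
    then show ?thesis unfolding R_def by (intro resolvent_pos[OF lam b z(1)]) (auto intro: ind01)
  qed
  have ab': "a \<le> b" "x0 \<noteq> a" "x0 \<noteq> b" "b \<noteq> a" using ab by auto
  have Lb: "L b = \<phi>a b * L a" and Ra: "R a = \<phi>b a * R b" using L\<phi>[OF b] R\<phi>[OF a] ab' by auto
  have detRL: "R a * L b - R b * L a \<noteq> 0"
  proof -
    have "R a * L b - R b * L a = R b * L a * (\<phi>b a * \<phi>a b - 1)" unfolding Lb Ra by (simp add: algebra_simps)
    then show ?thesis using La Rb \<phi>\<phi> by simp
  qed
  \<comment> \<open>The decomposition of \<open>L\<close> divided by \<open>L a > 0\<close>. The
    explicit 1 stands for the transform at the barrier itself, where hitting is immediate and no
    density is assumed.\<close>
  have "LTa x0 = Ga * 1 + Gb * LTa b"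
  proof -
    have "\<phi>a x0 * L a = (Ga + Gb * \<phi>a b) * L a" using L2 L\<phi>[OF x0] Lb ab by (simp add: algebra_simps)
    then show ?thesis using La LTa x0 b ab' by simp
  qed
  moreover have "LTb x0 = Ga * LTb a + Gb * 1"
  proof -
    have "\<phi>b x0 * R b = (Ga * \<phi>b a + Gb) * R b" using R2 R\<phi>[OF x0] Ra ab by (simp add: algebra_simps)
    then show ?thesis using Rb LTb x0 a ab' by simp
  qed
  moreover have "LTb a * LTa b - 1 * 1 \<noteq> 0" using \<phi>\<phi> LTa[OF b] LTb[OF a] ab' by simp
  ultimately have "Ga = (LTb x0 * LTa b - 1 * LTa x0) / (LTb a * LTa b - 1 * 1)"
    "Gb = (LTb a * LTa x0 - LTb x0 * 1) / (LTb a * LTa b - 1 * 1)"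
    using cramer_2x2[of "LTb x0" Ga "LTb a" Gb 1 "LTa x0" 1 "LTa b"] by blast+
  then have part1: "Ga = (LTb x0 * LTa b - LTa x0) / (LTa b * LTb a - 1) \<and>
    Gb = (LTa x0 * LTb a - LTb x0) / (LTa b * LTb a - 1)" by (simp add: mult.commute)
  have FL: "FX a y = L y" if "y \<in> I" for y
    unfolding FX_def L_def by (rule laplace_transition_cdf[OF that])
  have FR: "1 - lam * FX b y = lam * R y" if "y \<in> I" for y
  proof -
    have "?r = (\<lambda>u. 1 - indicator {..b} u)" by (auto simp: fun_eq_iff split: split_indicator)
    then have "R y = 1 / lam - FX b y"
      unfolding FX_def R_def laplace_transition_cdf[OF that]
      using resolvent_complement[OF lam that, of "indicator {..b}"] ind01 by simp
    then show ?thesis using lam by (simp add: right_diff_distrib)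
  qed
  have "lam * R x0 = Ga * (lam * R a) + Gb * (lam * R b)" using R2 by (simp add: algebra_simps)
  from cramer_2x2[OF this L2]
  have c2: "Ga = (lam * R x0 * L b - lam * R b * L x0) / (lam * R a * L b - lam * R b * L a)"
    "Gb = (lam * R a * L x0 - lam * R x0 * L a) / (lam * R a * L b - lam * R b * L a)"
    using detRL lam by (simp_all add: mult.assoc right_diff_distrib[symmetric])
  \<comment> \<open>The stated expression for \<open>Gb\<close> has the signs of numerator and
    denominator both opposite to those of Cramer's rule.\<close>
  have "Gb = (lam * R x0 * L a - lam * R a * L x0) / (lam * R b * L a - lam * R a * L b)"
    using c2(2) minus_divide_divide[of "lam * R a * L x0 - lam * R x0 * L a" "lam * R a * L b - lam * R b * L a"] by simp
  with c2(1) have part2: "Ga = ((1 - lam * FX b x0) * FX a b - (1 - lam * FX b b) * FX a x0) /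
                 ((1 - lam * FX b a) * FX a b - (1 - lam * FX b b) * FX a a) \<and>
            Gb = ((1 - lam * FX b x0) * FX a a - (1 - lam * FX b a) * FX a x0) /
                 ((1 - lam * FX b b) * FX a a - (1 - lam * FX b a) * FX a b)"
    by (simp only: FL FR a b x0)
  have part3: "Ga = (fX x1 x0 * fX x2 b - fX x1 b * fX x2 x0) / (fX x1 a * fX x2 b - fX x1 b * fX x2 a) \<and>
      Gb = (fX x1 a * fX x2 x0 - fX x1 x0 * fX x2 a) / (fX x1 a * fX x2 b - fX x1 b * fX x2 a)"
    if x1: "x1 \<in> I" "x1 > b" and x2: "x2 \<in> I" "x2 < a" for x1 x2
  proof -
    have e: "fX x1 x0 = Ga * fX x1 a + Gb * fX x1 b" "fX x2 x0 = Ga * fX x2 a + Gb * fX x2 b"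
      unfolding fX_def Ga Gb using x1 x2 by (auto intro!: density_laplace_two_barriers[OF lam a b ab])
    have 1: "fX x1 a = \<phi>b a * fX x1 b"
      unfolding fX_def \<phi>b_def using x1 ab by (intro density_laplace_through[OF lam a b]) auto
    have 2: "fX x2 b = \<phi>a b * fX x2 a"
      unfolding fX_def \<phi>a_def using x2 ab by (intro density_laplace_through[OF lam b a]) auto
    have nz: "fX x1 b \<noteq> 0" "fX x2 a \<noteq> 0"
      unfolding fX_def using density_laplace_nonzero[OF lam b x1(1)] density_laplace_nonzero[OF lam a x2(1)] x1(2) x2(2)
      by simp_all
    have "fX x1 a * fX x2 b - fX x1 b * fX x2 a = fX x1 b * fX x2 a * (\<phi>b a * \<phi>a b - 1)"
      unfolding 1 2 by (simp add: algebra_simps)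
    then have "fX x1 a * fX x2 b - fX x1 b * fX x2 a \<noteq> 0" using nz \<phi>\<phi> by simp
    from cramer_2x2[OF e this] show ?thesis by blast
  qed
  have "is_interval I" unfolding is_interval_1 using Icc_subset_I by fastforce
  then have Dv: "v1 lam a * v2 lam b - v2 lam a * v1 lam b \<noteq> 0"
    using fundamental_solutions_det_nonzero[OF v lam _ coefficients a b] ab by simp
  define D where "D = v1 lam a * v2 lam b - v2 lam a * v1 lam b"
  define Ha where "Ha = (v1 lam x0 * v2 lam b - v2 lam x0 * v1 lam b) / D"
  define Hb where "Hb = (v1 lam a * v2 lam x0 - v2 lam a * v1 lam x0) / D"
  have D0: "D \<noteq> 0" using Dv by (simp add: D_def)
  have Hg: "resolvent lam g x0 = Ha * resolvent lam g a + Hb * resolvent lam g b"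
    if g: "g \<in> borel_measurable borel" "\<And>u. 0 \<le> g u" "\<And>u. g u \<le> 1" "\<And>u. a < u \<Longrightarrow> u < b \<Longrightarrow> g u = 0" for g
  proof -
    define ua ub where "ua = resolvent lam g a" and "ub = resolvent lam g b"
    \<comment> \<open>The solution of the backward equation with boundary values \<open>ua\<close>
      at \<open>a\<close> and \<open>ub\<close> at \<open>b\<close>, with coefficients again from
      Cramer's rule.\<close>
    define w where "w = (\<lambda>x. (v2 lam b * ua - v2 lam a * ub) / D * v1 lam x + (v1 lam a * ub - v1 lam b * ua) / D * v2 lam x)"
    have "solves_backward \<mu> \<sigma> I lam w"
      unfolding w_def using v unfolding fundamental_solutions_def by (intro solves_backward_combination) auto
    moreover have wab: "w a = ua" "w b = ub"
    proof -
      have "w a = D * ua / D" "w b = D * ub / D"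
        unfolding w_def times_divide_eq_left add_divide_distrib[symmetric]
        by (rule arg_cong[where f="\<lambda>x. x / D"], simp add: D_def algebra_simps)+
      then show "w a = ua" "w b = ub" using D0 by auto
    qed
    ultimately have "resolvent lam g x0 = w x0"
      by (intro resolvent_eq_backward_solution[OF lam a b ab g]) (auto simp: ua_def ub_def)
    also have "\<dots> = Ha * ua + Hb * ub"
      unfolding w_def Ha_def Hb_def times_divide_eq_left add_divide_distrib[symmetric]
      by (rule arg_cong[where f="\<lambda>x. x / D"]) (simp add: algebra_simps)
    finally show ?thesis by (simp add: ua_def ub_def)
  qed
  \<comment> \<open>\<open>Ha\<close> and \<open>Hb\<close> satisfy the same two equations as
    \<open>Ga\<close> and \<open>Gb\<close>, with the nonzero determinant \<open>detRL\<close>, so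
    the pairs coincide.\<close>
  have "R x0 = Ha * R a + Hb * R b" "L x0 = Ha * L a + Hb * L b"
    unfolding R_def L_def by (rule Hg; auto intro: Lzero ind01 split: split_indicator)+
  from cramer_2x2[OF this detRL] cramer_2x2[OF R2 L2 detRL]
  have part4: "Ga = Ha \<and> Gb = Hb" by simp
  show ?thesis
    unfolding Let_def FX_def[symmetric] fX_def[symmetric] LTa_def[symmetric] LTb_def[symmetric]
      Ga_def[symmetric] Gb_def[symmetric]
    using part1 part2 part3 part4 unfolding Ha_def Hb_def D_def by blast
qed

end
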